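(* Assume the Construction below, with $(r_n)$ satisfying $\sum_{n\geq1}\frac{|\log r_n|}{2^n}<\infty$ and the sequence $(m_n)$ still free, and let $u=\lim_n u_n$ where $u_n=\frac{1}{2^n\#\mathcal S_n}\sum_{s\in\mathcal S_n}\log\max(|P_{n,s}|,\delta_n)$ (a continuous plurisubharmonic potential of the current $T=dd^cu$). Let $\psi$ be any gauge function such that $\frac{\psi(r)}{r|\log r|}\to\infty$ as $r\to0$. Then the sequence $(m_n)$ can be chosen so that $u$ is of class $C^{1+\psi}$ (locally) in $D(0,1/2)\times\mathbb{D}$.
   Context: A gauge function is a continuous increasing function $\psi$ defined on a neighborhood of $0$ in $\mathbb{R}^+$ with $\psi(0)=0$. A function is of class $C^{1+\psi}$ if it is $C^1$ and its first derivatives have modulus of continuity $O(\psi)$. Notation: $D(a,r)$ is the open disk of center $a$ and radius $r$ in $\mathbb{C}$, $\mathbb{D}=D(0,1)$, and $\mathbb{Z}^2$ is identified with the Gaussian integers $\mathbb{Z}+i\mathbb{Z}\subset\mathbb{C}$. Construction. Let $(a_n)_{n\geq1}$ be a sequence of points of $D(0,1/4)$ such that both subsequences $(a_{2p})$ and $(a_{2p+1})$ are dense in $D(0,1/4)$. Put $A_n(z,w)=z-a_n$ if $n$ is odd and $A_n(z,w)=z+\frac{w}{100}-a_n$ if $n$ is even. Let $(r_n)_{n\geq1}$ be a sequence of positive reals decreasing to $0$ with $r_n\leq 1/10$, and $(m_n)_{n\geq1}$ a sequence of positive integers. Define $\delta_0=1/2$, $\delta_{n+1}=\frac{\delta_n^2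 r_{n+1}}{4m_{n+1}^2}$ and $\varepsilon_{n+1}=\frac{\delta_n^2}{2m_{n+1}^2}$. Put $\Sigma_{n+1}=\overline{D}\big(0,\delta_n(1-\frac1{m_{n+1}})\big)\cap\frac{3\delta_n}{m_{n+1}}\mathbb{Z}^2$ (a finite set). Let $\mathcal S_0=\{0\}$, $P_{0,0}(z,w)=w$, and inductively $\mathcal S_{n+1}=\mathcal S_n\times\Sigma_{n+1}$ and, for $s'=(s,\sigma)\in\mathcal S_{n+1}$, $P_{n+1,s'}=(P_{n,s}-\sigma)^2-\varepsilon_{n+1}A_{n+1}$. Set (all sets taken in $D(0,1/2)\times\mathbb{D}$) $X_{n,s}=\{|P_{n,s}|<\delta_n\}$, $X_n=\bigcup_{s\in\mathcal S_n}X_{n,s}$, and $X^{\mathrm{int}}_{n+1,s,\sigma}=\{|P_{n,s}-\sigma|<\delta_n/m_{n+1}\}$ for $s\in\mathcal S_n,\sigma\in\Sigma_{n+1}$. *)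

theory Defs
  imports "HOL-Analysis.Analysis"
begin

text \<open>Sequences indexed from 1 are represented as functions on nat; index 0 is unused.
  Points of C^2 are pairs (z,w) :: complex \<times> complex.\<close>

primrec delta :: "(nat \<Rightarrow> real) \<Rightarrow> (nat \<Rightarrow> nat) \<Rightarrow> nat \<Rightarrow> real" where
  "delta r m 0 = 1/2"
| "delta r m (Suc n) = (delta r m n)^2 * r (Suc n) / (4 * (real (m (Suc n)))^2)"

definition eps :: "(nat \<Rightarrow> real) \<Rightarrow> (nat \<Rightarrow> nat) \<Rightarrow> nat \<Rightarrow> real" where
  "eps r m n = (delta r m (n - 1))^2 / (2 * (real (m n))^2)"

definition Aff :: "(nat \<Rightarrow> complex) \<Rightarrow> nat \<Rightarrow> complex \<times> complex \<Rightarrow> complex" where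
  "Aff a n p = (if odd n then fst p - a n else fst p + snd p / 100 - a n)"

definition Sig :: "(nat \<Rightarrow> real) \<Rightarrow> (nat \<Rightarrow> nat) \<Rightarrow> nat \<Rightarrow> complex set" where
  "Sig r m n = {\<sigma>. cmod \<sigma> \<le> delta r m (n - 1) * (1 - 1 / real (m n)) \<and>
      (\<exists>j k :: int. \<sigma> = complex_of_real (3 * delta r m (n - 1) / real (m n)) * (of_int j + \<i> * of_int k))}"

text \<open>S_n = Sigma_1 \<times> ... \<times> Sigma_n, an element s being a function with s k \<in> Sigma_k
  for 1 \<le> k \<le> n and s k = 0 otherwise (S_0 is a singleton).\<close>
definition Sidx :: "(nat \<Rightarrow> real) \<Rightarrow> (nat \<Rightarrow> nat) \<Rightarrow> nat \<Rightarrow> (nat \<Rightarrow> complex) set" where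
  "Sidx r m n = {s. \<forall>k. (1 \<le> k \<and> k \<le> n \<longrightarrow> s k \<in> Sig r m k) \<and> ((k = 0 \<or> n < k) \<longrightarrow> s k = 0)}"

primrec Pol :: "(nat \<Rightarrow> complex) \<Rightarrow> (nat \<Rightarrow> real) \<Rightarrow> (nat \<Rightarrow> nat) \<Rightarrow> nat \<Rightarrow> (nat \<Rightarrow> complex)
    \<Rightarrow> complex \<times> complex \<Rightarrow> complex" where
  "Pol a r m 0 s p = snd p"
| "Pol a r m (Suc n) s p = (Pol a r m n s p - s (Suc n))^2
      - complex_of_real (eps r m (Suc n)) * Aff a (Suc n) p"

definition u_approx :: "(nat \<Rightarrow> complex) \<Rightarrow> (nat \<Rightarrow> real) \<Rightarrow> (nat \<Rightarrow> nat) \<Rightarrow> nat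
    \<Rightarrow> complex \<times> complex \<Rightarrow> real" where
  "u_approx a r m n p = (1 / (2 ^ n * real (card (Sidx r m n)))) *
      (\<Sum>s\<in>Sidx r m n. ln (max (cmod (Pol a r m n s p)) (delta r m n)))"

definition Omega :: "(complex \<times> complex) set" where
  "Omega = ball 0 (1/2) \<times> ball 0 1"

definition gauge_fun :: "(real \<Rightarrow> real) \<Rightarrow> bool" where
  "gauge_fun \<psi> \<longleftrightarrow> (\<exists>\<rho>>0. continuous_on {0..\<rho>} \<psi> \<and> mono_on {0..\<rho>} \<psi>) \<and> \<psi> 0 = 0"

definition C1psi_loc :: "(real \<Rightarrow> real) \<Rightarrow> (complex \<times> complex \<Rightarrow> real) \<Rightarrow> (complex \<times> complex) set \<Rightarrow> bool" where
  "C1psi_loc \<psi> f U \<longleftrightarrow> (\<exists>f'. (\<forall>p\<in>U. (f has_derivative f' p) (at p)) \<and>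
     continuous_on U (\<lambda>p. Blinfun (f' p)) \<and>
     (\<forall>x\<in>U. \<exists>e>0. \<exists>C. ball x e \<subseteq> U \<and>
        (\<forall>p\<in>ball x e. \<forall>q\<in>ball x e. onorm (\<lambda>v. f' p v - f' q v) \<le> C * \<psi> (dist p q))))"

end

(*
  Replace log max(|P|, delta) by the logarithmic potential V_delta(P) of the uniform probability
  on the disk of radius delta: V_delta is C^{1,1}, equals log |P| outside the disk, and differs from
  log max(|P|, delta) by at most 1/2, so the averages of 2^{-n} V_{delta_n}(P_{n,s}) still converge
  to u.  Passing from level n to n + 1 replaces V_{delta_n} by the average, over a lattice of mesh
  3 delta_n / m filling the disk, of half the potentials of the new branches.  With the data up to
  level n frozen, the gradient of the difference is at most C m^{-1/9} (the lattice average converges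
  to the potential of Lebesgue measure) and is Lipschitz with constant C (1 + log m) (the lattice sum
  of 1 / dist^2 is of order m^2 log m).  For |p - q| = t one may use the first bound if
  t >= m^{-1/9} and the second one otherwise, so the modulus of continuity is O(t |log t|) uniformly
  in m, while it is as small as desired for t bounded below.  Since psi(t) / (t |log t|) tends to
  infinity, a large m makes it at most psi(t), and the resulting series converges in C^{1+psi}.
*)
theory Submission
  imports Defs
begin

section \<open>The potential of a uniform disk\<close>

text \<open>The gradient of log max(|P|, delta) jumps across |P| = delta, so a modulus of continuity
  of gradients cannot be followed along the u_n themselves; potentials that are C^{1,1} at every
  level make this possible. All estimates are then on gradients, and the functions come back at the
  end from uniform convergence of the gradients on a convex domain together with convergence at one
  point. With l = delta_n / m, the new radius delta_{n+1} = l^2 r / 4 is, up to the factor r / 4,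
  the square of the radius at which a branch is isolated. Hence a truncated branch is never smaller
  than (r / 4) max(|P - sigma|, l)^2: replacing the branch by this square costs powers of 1 / r, and
  the only loss depending on m is log m. The constant C involves delta_n, r_{n+1} and a C^{1,1}
  bound of the finitely many P_{n,s}, but not m_{n+1}. It may grow at any rate with n, because
  m_{n+1} is chosen after it. The weights that make the series converge are already present: each
  increment carries the factor 2^{-n} of the normalisation, so m_{n+1} only has to bring the
  unweighted gradient increment below 1 and its modulus below psi.\<close>

definition Kd :: "real \<Rightarrow> complex \<Rightarrow> complex" where
  "Kd d z = cnj z / complex_of_real ((max (cmod z) d)\<^sup>2)"

text \<open>\<open>Kd d\<close> is twice the z-derivative of \<open>Vd d\<close>, that is, the
  Cauchy transform of the uniform probability on the disk: \<open>cnj z / d^2\<close> inside and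
  \<open>1 / z\<close> outside, merged into one formula by the \<open>max\<close>. Real
  differentials are thus handled as \<open>Re (Kd d z * h)\<close>.\<close>

definition Vd :: "real \<Rightarrow> complex \<Rightarrow> real" where
  "Vd d z = (if cmod z \<le> d then ln d + ((cmod z / d)\<^sup>2 - 1) / 2 else ln (cmod z))"

lemma norm_Kd_le:
  assumes "d > 0"
  shows "cmod (Kd d z) \<le> 1 / max (cmod z) d"
proof -
  have "cmod (Kd d z) = cmod z / (max (cmod z) d)\<^sup>2"
    by (simp add: Kd_def norm_divide norm_power)
  also have "\<dots> \<le> max (cmod z) d / (max (cmod z) d)\<^sup>2"
    by (intro divide_right_mono) auto
  also have "\<dots> = 1 / max (cmod z) d"
    using assms by (simp add: power2_eq_square)
  finally show ?thesis .
qed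

lemma Kd_outside:
  assumes "d > 0" "d \<le> cmod z"
  shows "Kd d z = 1 / z"
proof -
  have "z \<noteq> 0" using assms by auto
  then show ?thesis
    using assms complex_norm_square[of z]
    by (simp add: Kd_def max_def field_simps of_real_power[symmetric] del: of_real_power)
qed

lemma Kd_scale:
  assumes "c > 0"
  shows "Kd (c * d) (of_real c * z) = Kd d z / of_real c"
proof -
  have "max (c * cmod z) (c * d) = c * max (cmod z) d"
    using assms by (simp add: max_mult_distrib_left)
  then show ?thesis
    using assms by (simp add: Kd_def norm_mult power_mult_distrib power2_eq_square field_simps)
qed

text \<open>Outside the disk this is the identity for 1/z - 1/w. In general, with M and N the
  truncated moduli, the difference of the two squared sides factors as ((|z|/M)^2 - (|w|/N)^2)(1/M^2
  - 1/N^2). As |z| grows, |z|/M does not decrease and 1/M does not increase, so the product is at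
  most 0.\<close>

lemma Kd_diff_le:
  assumes d: "d > 0"
  shows "cmod (Kd d z - Kd d w) \<le> cmod (z - w) / (max (cmod z) d * max (cmod w) d)"
proof -
  define M N where "M = max (cmod z) d" and "N = max (cmod w) d"
  have MN: "M > 0" "N > 0" using d by (auto simp: M_def N_def)
  have sq: "(cmod (u - v))\<^sup>2 = (cmod u)\<^sup>2 + (cmod v)\<^sup>2 - 2 * Re (u * cnj v)" for u v :: complex
    unfolding cmod_power2 by (simp add: power2_eq_square algebra_simps)
  have K: "Kd d z = cnj z / of_real (M\<^sup>2)" "Kd d w = cnj w / of_real (N\<^sup>2)"
    by (simp_all add: Kd_def M_def N_def)
  define X where "X = Re (z * cnj w)"
  have n: "(cmod (Kd d z))\<^sup>2 = (cmod z)\<^sup>2 / M^4" "(cmod (Kd d w))\<^sup>2 = (cmod w)\<^sup>2 / N^4"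
    by (simp_all add: K norm_divide norm_power power_divide flip: power_mult)
  have "Re (Kd d z * cnj (Kd d w)) = Re (complex_of_real (1 / (M\<^sup>2 * N\<^sup>2)) * (cnj z * w))"
    by (simp add: K)
  also have "\<dots> = 1 / (M\<^sup>2 * N\<^sup>2) * Re (cnj z * w)"
    by (simp del: of_real_divide of_real_power)
  also have "\<dots> = X / (M\<^sup>2 * N\<^sup>2)"
    by (simp add: X_def)
  finally have "Re (Kd d z * cnj (Kd d w)) = X / (M\<^sup>2 * N\<^sup>2)" .
  then have L: "(cmod (Kd d z - Kd d w))\<^sup>2
      = (cmod z)\<^sup>2 / M^4 + (cmod w)\<^sup>2 / N^4 - 2 * X / (M\<^sup>2 * N\<^sup>2)"
    by (simp add: sq n)
  have R: "(cmod (z - w) / (M * N))\<^sup>2 = ((cmod z)\<^sup>2 + (cmod w)\<^sup>2 - 2 * X) / (M\<^sup>2 * N\<^sup>2)"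
    by (simp add: sq X_def power_divide power_mult_distrib)
  have diff: "(cmod (Kd d z - Kd d w))\<^sup>2 - (cmod (z - w) / (M * N))\<^sup>2
      = ((cmod z / M)\<^sup>2 - (cmod w / N)\<^sup>2) * (1 / M\<^sup>2 - 1 / N\<^sup>2)"
    unfolding L R using MN
    by (simp add: field_simps power2_eq_square power4_eq_xxxx)
  have "((cmod z / M)\<^sup>2 - (cmod w / N)\<^sup>2) * (1 / M\<^sup>2 - 1 / N\<^sup>2) \<le> 0"
  proof (cases "cmod z \<le> cmod w")
    case True
    then have "M \<le> N" by (auto simp: M_def N_def)
    have "1 / N\<^sup>2 \<le> 1 / M\<^sup>2" using MN \<open>M \<le> N\<close> by (intro divide_left_mono) (auto intro: power_mono)
    moreover have "cmod z / M \<le> cmod w / N"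
      using True d by (auto simp: M_def N_def max_def field_simps)
    then have "(cmod z / M)\<^sup>2 \<le> (cmod w / N)\<^sup>2" using MN by (intro power_mono) auto
    ultimately show ?thesis by (intro mult_nonpos_nonneg) auto
  next
    case False
    then have "N \<le> M" by (auto simp: M_def N_def)
    have "1 / M\<^sup>2 \<le> 1 / N\<^sup>2" using MN \<open>N \<le> M\<close> by (intro divide_left_mono) (auto intro: power_mono)
    moreover have "cmod w / N \<le> cmod z / M"
      using False d by (auto simp: M_def N_def max_def field_simps)
    then have "(cmod w / N)\<^sup>2 \<le> (cmod z / M)\<^sup>2" using MN by (intro power_mono) auto
    ultimately show ?thesis by (intro mult_nonneg_nonpos) auto
  qed
  then have "(cmod (Kd d z - Kd d w))\<^sup>2 \<le> (cmod (z - w) / (M * N))\<^sup>2"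
    using diff by linarith
  then show ?thesis
    using MN unfolding M_def N_def by (metis abs_le_square_iff abs_norm_cancel abs_of_nonneg
        divide_nonneg_nonneg less_imp_le mult_nonneg_nonneg norm_ge_zero)
qed

text \<open>\<open>Vd d\<close> is written as a function \<open>ph\<close> of |z|^2, which unlike
  |z| is smooth at 0. Its two formulas meet at x = d^2 with the same value ln d and the same slope
  1/(2 d^2), so they glue differentiably.\<close>

lemma Vd_has_derivative:
  assumes d: "d > 0"
  shows "(Vd d has_derivative (\<lambda>h. Re (Kd d z * h))) (at z)"
proof -
  define ph where "ph = (\<lambda>x::real. if x \<in> {..d\<^sup>2} then ln d + (x / d\<^sup>2 - 1) / 2 else ln x / 2)"
  have eq: "Vd d y = ph ((Re y)\<^sup>2 + (Im y)\<^sup>2)" for y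
  proof -
    have "(cmod y \<le> d) = ((cmod y)\<^sup>2 \<le> d\<^sup>2)"
      using d by (metis abs_le_square_iff abs_norm_cancel abs_of_pos)
    moreover have "ln (cmod y) = ln ((cmod y)\<^sup>2) / 2"
      by (cases "y = 0") (auto simp: ln_realpow)
    ultimately show ?thesis
      by (simp add: Vd_def ph_def power_divide flip: cmod_power2)
  qed
  have "(ph has_derivative (*) (1 / (2 * max x (d\<^sup>2)))) (at x)" if "x \<ge> 0" for x
  proof -
    have ev: "(ph has_derivative (if x \<in> {..d\<^sup>2} then (*) (1 / (2*d\<^sup>2)) else (*) (1 / (2*x))))
       (at x within ({..d\<^sup>2} \<union> {d\<^sup>2<..}))"
      unfolding ph_def
    proof (rule has_derivative_If_within_closures[where S = "{..d\<^sup>2}" and T = "{d\<^sup>2<..}"])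
      show "((\<lambda>x. ln d + (x / d\<^sup>2 - 1) / 2) has_derivative (*) (1 / (2*d\<^sup>2)))
          (at x within {..d\<^sup>2} \<union> (closure {..d\<^sup>2} \<inter> closure {d\<^sup>2<..}))"
        using d by (auto intro!: derivative_eq_intros simp: fun_eq_iff power2_eq_square)
      show "((\<lambda>x. ln x / 2) has_derivative (*) (1 / (2*x)))
          (at x within {d\<^sup>2<..} \<union> (closure {..d\<^sup>2} \<inter> closure {d\<^sup>2<..}))"
        if "x \<in> {d\<^sup>2<..} \<union> (closure {..d\<^sup>2} \<inter> closure {d\<^sup>2<..})"
      proof -
        have "x > 0" using that d by (auto intro: less_le_trans[of 0 "d\<^sup>2"] less_trans[of 0 "d\<^sup>2"])
        then show ?thesis by (auto intro!: derivative_eq_intros simp: field_simps)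
      qed
      show "x \<in> {..d\<^sup>2} \<union> {d\<^sup>2<..}" by auto
      show "(*) (1 / (2*d\<^sup>2)) = (*) (1 / (2*x))"
        if "x \<in> closure {..d\<^sup>2}" "x \<in> closure {d\<^sup>2<..}"
        using that by simp
    qed (use d in \<open>auto simp: ln_realpow\<close>)
    moreover have "{..d\<^sup>2} \<union> {d\<^sup>2<..} = UNIV" by auto
    ultimately show ?thesis by (auto simp: max_def split: if_splits)
  qed
  from this[of "(Re z)\<^sup>2 + (Im z)\<^sup>2"]
  have ph': "(ph has_derivative (*) (1 / (2 * max ((Re z)\<^sup>2 + (Im z)\<^sup>2) (d\<^sup>2)))) (at ((Re z)\<^sup>2 + (Im z)\<^sup>2))"
    by simp
  have "((\<lambda>y. (Re y)\<^sup>2 + (Im y)\<^sup>2) has_derivative (\<lambda>h. 2 * (Re z * Re h + Im z * Im h))) (at z)"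
    by (auto intro!: derivative_eq_intros simp: algebra_simps)
  from has_derivative_compose[OF this ph']
  have *: "((\<lambda>y. ph ((Re y)\<^sup>2 + (Im y)\<^sup>2)) has_derivative
     (\<lambda>h. 1 / (2 * max ((Re z)\<^sup>2 + (Im z)\<^sup>2) (d\<^sup>2)) * (2 * (Re z * Re h + Im z * Im h)))) (at z)"
    by simp
  have m: "max ((Re z)\<^sup>2 + (Im z)\<^sup>2) (d\<^sup>2) = (max (cmod z) d)\<^sup>2"
    using d by (auto simp: max_def cmod_power2[symmetric] power_mono abs_le_square_iff[symmetric])
  have "1 / (2 * max ((Re z)\<^sup>2 + (Im z)\<^sup>2) (d\<^sup>2)) * (2 * (Re z * Re h + Im z * Im h)) = Re (Kd d z * h)" for h
  proof -
    have "Re (Kd d z * h) = Re (complex_of_real (1 / (max (cmod z) d)\<^sup>2) * (cnj z * h))"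
      by (simp add: Kd_def)
    also have "\<dots> = 1 / (max (cmod z) d)\<^sup>2 * Re (cnj z * h)"
      by (simp del: of_real_divide of_real_power)
    finally show ?thesis
      unfolding m by (simp add: distrib_left[symmetric] mult.assoc[symmetric] del: distrib_left_numeral)
  qed
  then show ?thesis using * by (simp add: eq[abs_def])
qed

lemma Vd_outside: "d \<le> cmod z \<Longrightarrow> d > 0 \<Longrightarrow> Vd d z = ln (cmod z)"
  by (auto simp: Vd_def)

lemma Vd_minus_ln_max:
  assumes "d > 0"
  shows "\<bar>Vd d z - ln (max (cmod z) d)\<bar> \<le> 1/2"
proof (cases "cmod z \<le> d")
  case True
  then have "0 \<le> cmod z / d" "cmod z / d \<le> 1" using assms by auto
  then have "0 \<le> (cmod z / d)\<^sup>2" "(cmod z / d)\<^sup>2 \<le> 1" by (auto intro: power_le_one)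
  then show ?thesis using True unfolding Vd_def by (auto simp: max_def)
next
  case False
  then show ?thesis by (auto simp: Vd_def max_def)
qed

section \<open>Rotation invariance of planar Lebesgue measure\<close>

text \<open>Lebesgue measure is determined by its values on boxes, and a box in the plane is a
  product of two intervals. This opens Fubini in the real and imaginary parts.\<close>

lemma lborel_complex_pair:
  "lborel = distr (lborel \<Otimes>\<^sub>M lborel) borel (\<lambda>(x::real, y::real). Complex x y)"
proof (rule lborel_eqI)
  have [measurable]: "(\<lambda>(x::real, y::real). Complex x y) \<in> borel_measurable (lborel \<Otimes>\<^sub>M lborel)"
    by (simp add: Complex_eq split_beta')
  fix l u :: complex assume lu: "\<And>b. b \<in> Basis \<Longrightarrow> l \<bullet> b \<le> u \<bullet> b"
  have le: "Re l \<le> Re u" "Im l \<le> Im u"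
    using lu[of 1] lu[of \<i>] by (auto simp: Basis_complex_def)
  have "(\<lambda>(x::real, y::real). Complex x y) -` box l u = {Re l<..<Re u} \<times> {Im l<..<Im u}"
    by (auto simp: box_def Basis_complex_def)
  then show "emeasure (distr (lborel \<Otimes>\<^sub>M lborel) borel (\<lambda>(x::real, y::real). Complex x y)) (box l u)
      = (\<Prod>b\<in>Basis. (u - l) \<bullet> b)"
    using le by (simp add: emeasure_distr space_pair_measure lborel.emeasure_pair_measure_Times
        Basis_complex_def ennreal_mult)
qed simp

lemma nn_integral_lborel_complex:
  assumes [measurable]: "f \<in> borel_measurable borel"
  shows "(\<integral>\<^sup>+z. f z \<partial>lborel) = (\<integral>\<^sup>+x. \<integral>\<^sup>+y. f (Complex x y) \<partial>lborel \<partial>lborel)"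
    and "(\<integral>\<^sup>+z. f z \<partial>lborel) = (\<integral>\<^sup>+y. \<integral>\<^sup>+x. f (Complex x y) \<partial>lborel \<partial>lborel)"
proof -
  have [measurable]: "(\<lambda>(x::real, y::real). Complex x y) \<in> borel_measurable (lborel \<Otimes>\<^sub>M lborel)"
    by (simp add: Complex_eq split_beta')
  have f: "(\<lambda>(x, y). f (Complex x y)) \<in> borel_measurable (lborel \<Otimes>\<^sub>M lborel)"
    by (simp add: Complex_eq split_beta')
  have "(\<integral>\<^sup>+z. f z \<partial>lborel) = (\<integral>\<^sup>+p. f (case p of (x, y) \<Rightarrow> Complex x y) \<partial>(lborel \<Otimes>\<^sub>M lborel))"
    by (subst lborel_complex_pair, subst nn_integral_distr) auto
  also have "\<dots> = (\<integral>\<^sup>+p. (case p of (x, y) \<Rightarrow> f (Complex x y)) \<partial>(lborel \<Otimes>\<^sub>M lborel))"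
    by (simp add: split_beta')
  finally have e: "(\<integral>\<^sup>+z. f z \<partial>lborel) = (\<integral>\<^sup>+p. (case p of (x, y) \<Rightarrow> f (Complex x y)) \<partial>(lborel \<Otimes>\<^sub>M lborel))" .
  show "(\<integral>\<^sup>+z. f z \<partial>lborel) = (\<integral>\<^sup>+x. \<integral>\<^sup>+y. f (Complex x y) \<partial>lborel \<partial>lborel)"
    unfolding e by (subst lborel.nn_integral_fst[OF f, symmetric]) simp
  show "(\<integral>\<^sup>+z. f z \<partial>lborel) = (\<integral>\<^sup>+y. \<integral>\<^sup>+x. f (Complex x y) \<partial>lborel \<partial>lborel)"
    unfolding e by (subst lborel_pair.nn_integral_snd[OF f, symmetric]) simp
qed

text \<open>With the imaginary part in the outer integral, the shear is a translation of the inner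
  variable.\<close>

lemma nn_integral_shear_Re:
  assumes [measurable]: "f \<in> borel_measurable borel"
  shows "(\<integral>\<^sup>+z. f (Complex (Re z + t * Im z) (Im z)) \<partial>lborel) = (\<integral>\<^sup>+z. f z \<partial>lborel)"
proof -
  have m [measurable]: "(\<lambda>x. f (Complex x y)) \<in> borel_measurable borel" for y
    by (simp add: Complex_eq)
  have "(\<lambda>z. f (Complex (Re z + t * Im z) (Im z))) \<in> borel_measurable borel"
    by (simp add: Complex_eq)
  then have "(\<integral>\<^sup>+z. f (Complex (Re z + t * Im z) (Im z)) \<partial>lborel)
      = (\<integral>\<^sup>+y. \<integral>\<^sup>+x. f (Complex (t * y + 1 * x) y) \<partial>lborel \<partial>lborel)"
    by (subst nn_integral_lborel_complex(2)) (auto simp: add.commute)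
  also have "\<dots> = (\<integral>\<^sup>+y. \<integral>\<^sup>+x. f (Complex x y) \<partial>lborel \<partial>lborel)"
    using nn_integral_real_affine[OF m, of 1] by simp
  also have "\<dots> = (\<integral>\<^sup>+z. f z \<partial>lborel)"
    by (simp add: nn_integral_lborel_complex(2))
  finally show ?thesis .
qed

lemma nn_integral_shear_Im:
  assumes [measurable]: "f \<in> borel_measurable borel"
  shows "(\<integral>\<^sup>+z. f (Complex (Re z) (Im z + t * Re z)) \<partial>lborel) = (\<integral>\<^sup>+z. f z \<partial>lborel)"
proof -
  have m [measurable]: "(\<lambda>y. f (Complex x y)) \<in> borel_measurable borel" for x
    by (simp add: Complex_eq)
  have "(\<lambda>z. f (Complex (Re z) (Im z + t * Re z))) \<in> borel_measurable borel"
    by (simp add: Complex_eq)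
  then have "(\<integral>\<^sup>+z. f (Complex (Re z) (Im z + t * Re z)) \<partial>lborel)
      = (\<integral>\<^sup>+x. \<integral>\<^sup>+y. f (Complex x (t * x + 1 * y)) \<partial>lborel \<partial>lborel)"
    by (subst nn_integral_lborel_complex(1)) (auto simp: add.commute)
  also have "\<dots> = (\<integral>\<^sup>+x. \<integral>\<^sup>+y. f (Complex x y) \<partial>lborel \<partial>lborel)"
    using nn_integral_real_affine[OF m, of 1] by simp
  also have "\<dots> = (\<integral>\<^sup>+z. f z \<partial>lborel)"
    by (simp add: nn_integral_lborel_complex(1))
  finally show ?thesis .
qed

text \<open>A rotation that is not real is a product of three shears.\<close>

lemma nn_integral_rotate:
  assumes f: "f \<in> borel_measurable borel" and c: "cmod c = 1"
  shows "(\<integral>\<^sup>+z. f (c * z) \<partial>lborel) = (\<integral>\<^sup>+z. f z \<partial>lborel)"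
proof -
  have nonreal: "(\<integral>\<^sup>+z. f (c * z) \<partial>lborel) = (\<integral>\<^sup>+z. f z \<partial>lborel)"
    if [measurable]: "f \<in> borel_measurable borel" and c: "cmod c = 1" and im: "Im c \<noteq> 0"
    for c and f :: "complex \<Rightarrow> ennreal"
  proof -
    \<comment> \<open>For c = cis theta, t is - tan (theta / 2). The rotation is a horizontal shear
      of slope t, a vertical one of slope b = sin theta, and the horizontal one again; dividing by b
      is what requires c to be non-real.\<close>
    define a b t where "a = Re c" and "b = Im c" and "t = (a - 1) / b"
    have ab: "a\<^sup>2 + b\<^sup>2 = 1"
      using c cmod_power2[of c] by (simp add: a_def b_def)
    have bt: "b * t = a - 1" using im by (simp add: t_def b_def)
    have t2: "t * (1 + a) = - b"
      using ab im unfolding t_def b_def by (simp add: field_simps power2_eq_square)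
    define g where "g = (\<lambda>z. f (Complex (Re z + t * Im z) (Im z)))"
    define h where "h = (\<lambda>z. g (Complex (Re z) (Im z + b * Re z)))"
    have [measurable]: "g \<in> borel_measurable borel"
      unfolding g_def by (simp add: Complex_eq)
    have [measurable]: "h \<in> borel_measurable borel"
      unfolding h_def by (simp add: Complex_eq)
    have "f (c * z) = h (Complex (Re z + t * Im z) (Im z))" for z
    proof -
      define x y where "x = Re z" and "y = Im z"
      have "y + b * (x + t * y) = b * x + a * y"
        using bt by (simp add: algebra_simps) (metis add.commute diff_add_cancel distrib_left mult.assoc mult.commute mult_1)
      moreover have "(x + t * y) + t * (b * x + a * y) = (1 + b * t) * x + (t * (1 + a)) * y"
        by (simp add: algebra_simps)
      then have "(x + t * y) + t * (b * x + a * y) = a * x - b * y"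
        by (simp only: bt t2) simp
      ultimately have "Complex (a * x - b * y) (b * x + a * y)
          = Complex ((x + t * y) + t * (y + b * (x + t * y))) (y + b * (x + t * y))"
        by simp
      moreover have "c * z = Complex (a * x - b * y) (b * x + a * y)"
        by (simp add: complex_eq_iff a_def b_def x_def y_def)
      ultimately show ?thesis
        by (simp add: h_def g_def x_def y_def)
    qed
    then have "(\<integral>\<^sup>+z. f (c * z) \<partial>lborel) = (\<integral>\<^sup>+z. h z \<partial>lborel)"
      using nn_integral_shear_Re[of h t] by simp
    also have "\<dots> = (\<integral>\<^sup>+z. g z \<partial>lborel)"
      unfolding h_def by (rule nn_integral_shear_Im) simp
    also have "\<dots> = (\<integral>\<^sup>+z. f z \<partial>lborel)"
      unfolding g_def by (rule nn_integral_shear_Re) simp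
    finally show ?thesis .
  qed
  show ?thesis
  proof (cases "Im c = 0")
    case False
    then show ?thesis using nonreal f c by blast
  next
    case True
    \<comment> \<open>A real c is the product of the two non-real unit numbers \<i> and - \<i> * c,
      to which the previous case applies in turn.\<close>
    then have "Im (- \<i> * c) \<noteq> 0"
      using c by (auto simp: cmod_def)
    moreover have "cmod (- \<i> * c) = 1" using c by (simp add: norm_mult)
    moreover have fi: "(\<lambda>z. f (\<i> * z)) \<in> borel_measurable borel"
      using f by measurable
    ultimately have "(\<integral>\<^sup>+z. f (\<i> * (- \<i> * c * z)) \<partial>lborel) = (\<integral>\<^sup>+z. f (\<i> * z) \<partial>lborel)"
      by (intro nonreal)
    also have "\<dots> = (\<integral>\<^sup>+z. f z \<partial>lborel)"
      using f by (intro nonreal) auto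
    finally show ?thesis by (simp add: mult.assoc[symmetric])
  qed
qed

lemma distr_lborel_rotate:
  assumes "cmod c = 1"
  shows "distr lborel borel ((*) c) = lborel"
proof (rule measure_eqI)
  fix A assume "A \<in> sets (distr lborel borel ((*) c))"
  then have [measurable]: "A \<in> sets borel" by simp
  have "emeasure (distr lborel borel ((*) c)) A = (\<integral>\<^sup>+z. indicator A z \<partial>(distr lborel borel ((*) c)))"
    by (simp only: nn_integral_indicator sets_distr \<open>A \<in> sets borel\<close>)
  also have "\<dots> = (\<integral>\<^sup>+z. indicator A (c * z) \<partial>lborel)"
    by (rule nn_integral_distr) auto
  also have "\<dots> = emeasure lborel A"
    using assms by (subst nn_integral_rotate) auto
  finally show "emeasure (distr lborel borel ((*) c)) A = emeasure lborel A" .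
qed simp

lemma integral_rotate:
  fixes f :: "complex \<Rightarrow> 'a::{banach, second_countable_topology}"
  assumes "f \<in> borel_measurable borel" "cmod c = 1"
  shows "(\<integral>z. f (c * z) \<partial>lborel) = (\<integral>z. f z \<partial>lborel)"
proof -
  have "(\<integral>z. f z \<partial>lborel) = (\<integral>z. f z \<partial>(distr lborel borel ((*) c)))"
    using assms by (simp add: distr_lborel_rotate)
  also have "\<dots> = (\<integral>z. f (c * z) \<partial>lborel)"
    using assms by (intro integral_distr) auto
  finally show ?thesis by simp
qed

section \<open>The Cauchy kernel integrated over a disk\<close>

lemma measure_ball_complex:
  "R \<ge> 0 \<Longrightarrow> measure lborel (ball (c::complex) R) = pi * R\<^sup>2"
  "R \<ge> 0 \<Longrightarrow> measure lborel (cball (c::complex) R) = pi * R\<^sup>2"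
  by (simp_all add: content_ball content_cball unit_ball_vol_2)

lemma continuous_on_Kd:
  assumes "d > 0" "continuous_on S f"
  shows "continuous_on S (\<lambda>x. Kd d (f x))"
  unfolding Kd_def using assms
  by (intro continuous_intros) (auto simp: max_def)

lemma bounded_borel_fmeasurable:
  fixes S :: "complex set"
  shows "S \<in> sets borel \<Longrightarrow> bounded S \<Longrightarrow> S \<in> fmeasurable lborel"
  using emeasure_bounded_finite[of S] by (simp add: fmeasurable_def)

lemma integrable_indicator_bounded:
  fixes S :: "complex set"
  shows "S \<in> sets borel \<Longrightarrow> bounded S \<Longrightarrow> integrable lborel (indicator S :: complex \<Rightarrow> real)"
  using emeasure_bounded_finite[of S] by (simp add: integrable_indicator_iff)

lemma set_integrable_bounded:
  fixes f :: "complex \<Rightarrow> complex"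
  assumes "f \<in> borel_measurable borel" "S \<in> sets borel" "bounded S" "\<And>y. y \<in> S \<Longrightarrow> cmod (f y) \<le> M"
  shows "set_integrable lborel S f"
proof -
  have "integrable lborel (indicator S :: complex \<Rightarrow> real)"
    using assms(2,3) by (rule integrable_indicator_bounded)
  then have "integrable lborel (\<lambda>y. M * indicator S y)" by simp
  then show ?thesis
    unfolding set_integrable_def
    by (rule Bochner_Integration.integrable_bound)
       (use assms in \<open>auto simp: indicator_def intro!: AE_I2 intro: order_trans[OF _ abs_ge_self]\<close>)
qed

lemma norm_set_integral_le:
  fixes f :: "complex \<Rightarrow> complex"
  assumes "f \<in> borel_measurable borel" "S \<in> sets borel" "bounded S" "\<And>y. y \<in> S \<Longrightarrow> cmod (f y) \<le> M"
  shows "cmod (LINT y:S|lborel. f y) \<le> M * measure lborel S"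
proof -
  have i: "integrable lborel (indicator S :: complex \<Rightarrow> real)"
    using assms(2,3) by (rule integrable_indicator_bounded)
  have "cmod (LINT y:S|lborel. f y) \<le> (\<integral>y. M * indicator S y \<partial>lborel)"
    unfolding set_lebesgue_integral_def
  proof (rule Bochner_Integration.integral_norm_bound_integral)
    show "integrable lborel (\<lambda>y. indicator S y *\<^sub>R f y)"
      using set_integrable_bounded[OF assms] by (simp add: set_integrable_def)
    show "integrable lborel (\<lambda>y. M * indicator S y)" using i by simp
  qed (use assms(4) in \<open>auto simp: indicator_def\<close>)
  then show ?thesis by simp
qed

text \<open>In the factorisation of the difference of powers the cofactor is a sum of nonnegative
  terms, one of which is a^N. The resulting lower bound for |\<zeta>^N - y^N| keeps the averaged
  Cauchy kernels bounded independently of N, as dominated convergence needs.\<close>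

lemma power_diff_ge:
  fixes a b :: real
  assumes "a \<ge> 0" "b \<ge> 0"
  shows "\<bar>a - b\<bar> * a ^ N \<le> \<bar>a ^ Suc N - b ^ Suc N\<bar>"
proof -
  have "a ^ Suc N - b ^ Suc N = (a - b) * (\<Sum>i<Suc N. b ^ (Suc N - Suc i) * a ^ i)"
    by (rule power_diff_sumr2)
  moreover have "a ^ N \<le> (\<Sum>i<Suc N. b ^ (Suc N - Suc i) * a ^ i)"
    using assms by (simp add: sum_nonneg)
  ultimately show ?thesis
    using assms by (simp add: abs_mult mult_left_mono sum_nonneg del: sum.lessThan_Suc)
qed

text \<open>Averaging over the rotations by powers of \<open>cis (pi / 2 ^ j)\<close> turns
  \<open>1 / (\<zeta> - y)\<close> into \<open>\<zeta> ^ (N - 1) / (\<zeta> ^ N - y ^ N)\<close> with \<open>N = 2 ^ Suc j\<close>, which tends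
  to \<open>1 / \<zeta>\<close> for \<open>cmod y < cmod \<zeta>\<close> and to \<open>0\<close> for \<open>cmod y > cmod \<zeta>\<close>.\<close>

lemma integral_Cauchy_kernel_rotation_invariant:
  fixes \<zeta> :: complex
  assumes S: "S \<in> sets borel" "bounded S"
    and rot: "\<And>c y. cmod c = 1 \<Longrightarrow> c * y \<in> S \<longleftrightarrow> y \<in> S"
    and \<tau>: "\<tau> > 0" "\<And>y. y \<in> S \<Longrightarrow> \<tau> \<le> \<bar>cmod \<zeta> - cmod y\<bar>"
  shows "(LINT y:S|lborel. 1 / (\<zeta> - y)) = (1 / \<zeta>) * measure lborel {y\<in>S. cmod y < cmod \<zeta>}"
proof -
  define F where "F = (\<lambda>N y. \<zeta> ^ (N - 1) / (\<zeta> ^ N - y ^ N))"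
  have [measurable]: "F N \<in> borel_measurable borel" for N
    unfolding F_def by measurable
  have ne: "\<zeta> ^ N \<noteq> y ^ N" if "y \<in> S" "N > 0" for y N
  proof
    assume "\<zeta> ^ N = y ^ N"
    then have "cmod \<zeta> ^ N = cmod y ^ N" by (metis norm_power)
    then have "cmod \<zeta> = cmod y" using that by (simp add: power_eq_iff_eq_base)
    then show False using \<tau> that by fastforce
  qed
  have bound: "cmod (F N y) \<le> 1 / \<tau>" if "y \<in> S" "N > 0" for y N
  proof -
    obtain M where N: "N = Suc M" using \<open>N > 0\<close> gr0_implies_Suc by blast
    have "\<tau> * cmod \<zeta> ^ M \<le> \<bar>cmod \<zeta> - cmod y\<bar> * cmod \<zeta> ^ M"
      using \<tau>(2)[OF \<open>y \<in> S\<close>] by (intro mult_right_mono) auto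
    also have "\<dots> \<le> \<bar>cmod \<zeta> ^ N - cmod y ^ N\<bar>"
      unfolding N by (rule power_diff_ge) auto
    also have "\<dots> \<le> cmod (\<zeta> ^ N - y ^ N)"
      by (metis norm_power norm_triangle_ineq3)
    finally have "\<tau> * cmod \<zeta> ^ M \<le> cmod (\<zeta> ^ N - y ^ N)" .
    moreover have "cmod (\<zeta> ^ N - y ^ N) > 0" using ne[OF that] by simp
    ultimately show ?thesis
      using \<tau>(1) unfolding F_def by (simp add: N norm_divide norm_power field_simps del: power_Suc)
  qed
  have int: "set_integrable lborel S (F N)" if "N > 0" for N
    using S bound that by (intro set_integrable_bounded) auto
  \<comment> \<open>Since c^N = -1, passing from N to 2 N is the partial fraction identity 1/(Z - Y)
    + 1/(Z + Y) = 2 Z/(Z^2 - Y^2) with Z = \<zeta>^N and Y = y^N, followed by rotation invariance of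
    the integral.\<close>
  have dbl: "(LINT y:S|lborel. F (2 * N) y) = (LINT y:S|lborel. F N y)" if N: "N > 0" for N
  proof -
    define c where "c = cis (pi / N)"
    have "c ^ N = cis (real N * (pi / N))"
      unfolding c_def by (rule Complex.DeMoivre)
    then have c: "cmod c = 1" "c ^ N = -1"
      using N by (simp_all add: c_def)
    have F2: "F (2 * N) y = (F N y + F N (c * y)) / 2" if "y \<in> S" for y
    proof -
      define Z Y where "Z = \<zeta> ^ N" and "Y = y ^ N"
      have "Z \<noteq> Y" using ne[OF that N] by (simp add: Z_def Y_def)
      have "c * y \<in> S" using rot c that by blast
      then have "Z \<noteq> - Y" using ne[of "c * y" N] N by (simp add: Z_def Y_def power_mult_distrib c)
      have "2 * N - 1 = (N - 1) + N" using N by simp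
      then have e: "\<zeta> ^ (2 * N - 1) = \<zeta> ^ (N - 1) * Z" by (simp only: power_add Z_def)
      have z: "Z - Y \<noteq> 0" "Z + Y \<noteq> 0"
        using \<open>Z \<noteq> Y\<close> \<open>Z \<noteq> - Y\<close> by (auto simp: add_eq_0_iff2)
      have "F (2 * N) y = \<zeta> ^ (N - 1) * Z / (Z\<^sup>2 - Y\<^sup>2)"
        unfolding F_def e by (simp add: Z_def Y_def power_mult[symmetric] mult.commute)
      also have "Z\<^sup>2 - Y\<^sup>2 = (Z - Y) * (Z + Y)" by (simp add: power2_eq_square algebra_simps)
      also have "\<zeta> ^ (N - 1) * Z / ((Z - Y) * (Z + Y))
          = (\<zeta> ^ (N - 1) / (Z - Y) + \<zeta> ^ (N - 1) / (Z + Y)) / 2"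
      proof -
        have "\<zeta> ^ (N - 1) / (Z - Y) + \<zeta> ^ (N - 1) / (Z + Y)
            = (2 * (\<zeta> ^ (N - 1) * Z)) / ((Z - Y) * (Z + Y))"
          unfolding add_frac_eq[OF z] by (simp add: algebra_simps)
        then show ?thesis by (simp only: times_divide_eq_right[symmetric] nonzero_mult_div_cancel_left) simp
      qed
      also have "\<dots> = (F N y + F N (c * y)) / 2"
        by (simp add: F_def power_mult_distrib c Z_def Y_def)
      finally show ?thesis .
    qed
    have ic: "(\<integral>y. indicator S (c * y) *\<^sub>R F N (c * y) \<partial>lborel) = (\<integral>y. indicator S y *\<^sub>R F N y \<partial>lborel)"
      using S c by (intro integral_rotate) auto
    have indc: "indicator S (c * y) = (indicator S y :: real)" for y
      using rot[OF c(1)] by (simp add: indicator_def)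
    have "c * y \<in> S" if "y \<in> S" for y using rot c that by blast
    then have int2: "set_integrable lborel S (\<lambda>y. F N (c * y))"
      using S bound N by (intro set_integrable_bounded) auto
    have "(LINT y:S|lborel. F (2 * N) y) = (LINT y:S|lborel. (F N y + F N (c * y)) / 2)"
      using S F2 by (intro set_lebesgue_integral_cong) auto
    also have "\<dots> = ((LINT y:S|lborel. F N y) + (LINT y:S|lborel. F N (c * y))) / 2"
      using int[OF N] int2 by (simp add: set_integral_add)
    also have "(LINT y:S|lborel. F N (c * y)) = (LINT y:S|lborel. F N y)"
      using ic by (simp add: set_lebesgue_integral_def indc)
    finally show ?thesis by simp
  qed
  have const: "(LINT y:S|lborel. F (2 ^ j) y) = (LINT y:S|lborel. 1 / (\<zeta> - y))" for j
  proof (induction j)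
    case 0
    then show ?case by (simp add: F_def)
  next
    case (Suc j)
    then show ?case using dbl[of "2 ^ j"] by simp
  qed
  have Fz: "F N y = (1 / \<zeta>) * (\<zeta> ^ N / (\<zeta> ^ N - y ^ N))" if "\<zeta> \<noteq> 0" "N > 0" for N y
  proof -
    have "\<zeta> ^ N = \<zeta> ^ (N - 1) * \<zeta>" using that by (metis power_minus_mult)
    then show ?thesis using that by (simp add: F_def)
  qed
  have lim: "(\<lambda>j. F (2 ^ j) y) \<longlonglongrightarrow> (if cmod y < cmod \<zeta> then 1 / \<zeta> else 0)" if "y \<in> S" for y
  proof -
    have pow: "(\<lambda>j. x ^ (2 ^ j)) \<longlonglongrightarrow> 0" if "cmod x < 1" for x :: complex
    proof -
      have "strict_mono (\<lambda>j::nat. (2::nat) ^ j)" by (simp add: strict_mono_def)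
      from LIMSEQ_subseq_LIMSEQ[OF LIMSEQ_power_zero[OF that] this] show ?thesis
        by (simp add: comp_def)
    qed
    have ne0: "cmod y \<noteq> cmod \<zeta>" using \<tau> that by fastforce
    consider "cmod y < cmod \<zeta>" | "\<zeta> = 0" "y \<noteq> 0" | "cmod \<zeta> < cmod y" "\<zeta> \<noteq> 0"
      using ne0 by force
    then show ?thesis
    proof cases
      case 1
      then have "\<zeta> \<noteq> 0" by auto
      have "F (2 ^ j) y = (1 / \<zeta>) * (1 / (1 - (y / \<zeta>) ^ (2 ^ j)))" for j
        using \<open>\<zeta> \<noteq> 0\<close> ne[OF that, of "2 ^ j"]
        by (simp add: Fz power_divide divide_simps)
      moreover have "(\<lambda>j. (1 / \<zeta>) * (1 / (1 - (y / \<zeta>) ^ (2 ^ j)))) \<longlonglongrightarrow> (1 / \<zeta>) * (1 / (1 - 0))"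
        using 1 \<open>\<zeta> \<noteq> 0\<close> by (intro tendsto_intros pow) (auto simp: norm_divide)
      ultimately show ?thesis using 1 by simp
    next
      case 2
      \<comment> \<open>The exponent 1 is skipped: for \<zeta> = 0 the kernel \<open>F 1\<close> is
        -1/y, and only from N = 2 on does the numerator vanish.\<close>
      have "F (2 ^ Suc j) y = 0" for j
      proof -
        have "(2::nat) ^ Suc j - 1 > 0" by (simp add: Suc_lessI)
        then show ?thesis using 2 by (simp add: F_def zero_power del: power_Suc)
      qed
      then have "(\<lambda>j. F (2 ^ Suc j) y) \<longlonglongrightarrow> 0" by simp
      then have "(\<lambda>j. F (2 ^ j) y) \<longlonglongrightarrow> 0" by (rule LIMSEQ_imp_Suc)
      then show ?thesis using 2 by simp
    next
      case 3
      then have "y \<noteq> 0" by auto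
      have "F (2 ^ j) y = (1 / \<zeta>) * (- ((\<zeta> / y) ^ (2 ^ j)) / (1 - (\<zeta> / y) ^ (2 ^ j)))" for j
        using \<open>\<zeta> \<noteq> 0\<close> \<open>y \<noteq> 0\<close> ne[OF that, of "2 ^ j"]
        by (simp add: Fz power_divide divide_simps) (simp add: algebra_simps)
      moreover have "(\<lambda>j. (1 / \<zeta>) * (- ((\<zeta> / y) ^ (2 ^ j)) / (1 - (\<zeta> / y) ^ (2 ^ j)))) \<longlonglongrightarrow> (1 / \<zeta>) * (- 0 / (1 - 0))"
        using 3 \<open>y \<noteq> 0\<close> by (intro tendsto_intros pow) (auto simp: norm_divide)
      ultimately show ?thesis using 3 by simp
    qed
  qed
  have "(\<lambda>j. LINT y:S|lborel. F (2 ^ j) y) \<longlonglongrightarrow> (LINT y:S|lborel. (if cmod y < cmod \<zeta> then 1 / \<zeta> else 0))"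
    unfolding set_lebesgue_integral_def
  proof (rule integral_dominated_convergence)
    have "set_integrable lborel S (\<lambda>y. complex_of_real (1 / \<tau>))"
      using S by (intro set_integrable_bounded) auto
    then show "integrable lborel (\<lambda>y. cmod (indicator S y *\<^sub>R complex_of_real (1 / \<tau>)))"
      unfolding set_integrable_def by (rule integrable_norm)
    show "AE y in lborel. (\<lambda>j. indicator S y *\<^sub>R F (2 ^ j) y)
        \<longlonglongrightarrow> indicator S y *\<^sub>R (if cmod y < cmod \<zeta> then 1 / \<zeta> else 0)"
    proof (intro AE_I2)
      show "(\<lambda>j. indicator S y *\<^sub>R F (2 ^ j) y)
        \<longlonglongrightarrow> indicator S y *\<^sub>R (if cmod y < cmod \<zeta> then 1 / \<zeta> else 0)" for y
        using lim[of y] by (cases "y \<in> S") auto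
    qed
    show "AE y in lborel. cmod (indicator S y *\<^sub>R F (2 ^ j) y)
        \<le> cmod (indicator S y *\<^sub>R complex_of_real (1 / \<tau>))" for j
      using bound[of _ "2 ^ j"] \<tau>(1) by (intro AE_I2) (auto simp: indicator_def norm_divide)
  qed (use S in auto)
  then have "(LINT y:S|lborel. 1 / (\<zeta> - y)) = (LINT y:S|lborel. (if cmod y < cmod \<zeta> then 1 / \<zeta> else 0))"
    by (simp add: const LIMSEQ_const_iff)
  also have "\<dots> = (\<integral>y. indicator {y\<in>S. cmod y < cmod \<zeta>} y *\<^sub>R (1 / \<zeta>) \<partial>lborel)"
    unfolding set_lebesgue_integral_def
    by (intro Bochner_Integration.integral_cong) (auto simp: indicator_def)
  also have "\<dots> = measure lborel {y\<in>S. cmod y < cmod \<zeta>} *\<^sub>R (1 / \<zeta>)"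
  proof -
    have [measurable]: "{y\<in>S. cmod y < cmod \<zeta>} \<in> sets borel" using S by measurable
    have "emeasure lborel {y\<in>S. cmod y < cmod \<zeta>} < \<infinity>"
      using S by (intro emeasure_bounded_finite bounded_subset[OF S(2)]) auto
    then show ?thesis by (subst integral_scaleR_left) (auto simp: integrable_indicator_iff)
  qed
  finally show ?thesis by (simp add: scaleR_conv_of_real)
qed


text \<open>On the annulus where \<open>cmod y\<close> is \<open>h ^ 3\<close>-close to \<open>cmod \<zeta>\<close> the kernel is at most
  \<open>h powr - 3\<close> on the disk of radius \<open>h\<^sup>2\<close> about \<open>\<zeta>\<close> and at most \<open>h powr - 2\<close> off it; both
  contributions are \<open>O(h)\<close>.\<close>

lemma disc_integral_Kd:
  fixes \<zeta> :: complex
  assumes h: "0 < h" "h \<le> 1"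
  shows "cmod ((LINT y:ball 0 1|lborel. Kd (h ^ 3) (\<zeta> - y)) - pi * Kd 1 \<zeta>) \<le> 11 * pi * h"
proof -
  define \<tau> where "\<tau> = h ^ 3"
  have \<tau>: "0 < \<tau>" "\<tau> \<le> 1" "\<tau> \<le> h"
    using h power_le_one[of h 3] power_decreasing[of 1 3 h] by (auto simp: \<tau>_def)
  define B where "B = ball (0::complex) 1"
  define S where "S = {y\<in>B. \<tau> \<le> \<bar>cmod \<zeta> - cmod y\<bar>}"
  define A where "A = {y\<in>B. \<bar>cmod \<zeta> - cmod y\<bar> < \<tau>}"
  define E where "E = ball \<zeta> (h\<^sup>2)"
  have [measurable]: "B \<in> sets borel" "E \<in> sets borel" by (simp_all add: B_def E_def)
  have [measurable]: "S \<in> sets borel" "A \<in> sets borel"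
    unfolding S_def A_def by measurable
  have bdd: "bounded S" "bounded A" "bounded B" "bounded E"
    by (auto simp: S_def A_def B_def E_def intro: bounded_subset[OF bounded_ball[of 0 1]])
  have Kmeas [measurable]: "(\<lambda>y. Kd \<tau> (\<zeta> - y)) \<in> borel_measurable borel"
    using \<tau>(1) by (intro borel_measurable_continuous_onI continuous_on_Kd continuous_intros)
  have Kb: "cmod (Kd \<tau> z) \<le> 1 / \<tau>" for z
    by (rule order_trans[OF norm_Kd_le[OF \<tau>(1)]]) (use \<tau> in \<open>auto intro!: divide_left_mono mult_pos_pos simp: max_def\<close>)
  have Kint: "set_integrable lborel X (\<lambda>y. Kd \<tau> (\<zeta> - y))" if "X \<in> sets borel" "bounded X" for X
    using Kb that by (intro set_integrable_bounded) auto
  have split: "(LINT y:B|lborel. Kd \<tau> (\<zeta> - y))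
      = (LINT y:S|lborel. Kd \<tau> (\<zeta> - y)) + ((LINT y:A\<inter>E|lborel. Kd \<tau> (\<zeta> - y)) + (LINT y:A-E|lborel. Kd \<tau> (\<zeta> - y)))"
  proof -
    have 1: "B = S \<union> A" "S \<inter> A = {}" by (auto simp: S_def A_def)
    have 2: "A = (A \<inter> E) \<union> (A - E)" "(A \<inter> E) \<inter> (A - E) = {}" by auto
    have b: "bounded (A \<inter> E)" "bounded (A - E)" using bdd by (auto intro: bounded_subset)
    have "(LINT y:B|lborel. Kd \<tau> (\<zeta> - y)) = (LINT y:S|lborel. Kd \<tau> (\<zeta> - y)) + (LINT y:A|lborel. Kd \<tau> (\<zeta> - y))"
      using bdd unfolding 1(1) by (intro set_integral_Un 1 Kint) auto
    also have "(LINT y:A|lborel. Kd \<tau> (\<zeta> - y))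
       = (LINT y:A\<inter>E|lborel. Kd \<tau> (\<zeta> - y)) + (LINT y:A-E|lborel. Kd \<tau> (\<zeta> - y))"
      using b by (subst 2(1), intro set_integral_Un 2 Kint) auto
    finally show ?thesis .
  qed
  have "cmod (LINT y:A\<inter>E|lborel. Kd \<tau> (\<zeta> - y)) \<le> 1 / \<tau> * measure lborel (A \<inter> E)"
    using Kb bdd by (intro norm_set_integral_le) (auto intro: bounded_subset)
  also have "\<dots> \<le> 1 / \<tau> * measure lborel E"
    using \<tau> bdd by (intro mult_left_mono measure_mono_fmeasurable)
       (auto intro!: bounded_borel_fmeasurable intro: bounded_subset)
  also have "\<dots> = pi * h"
    using h by (simp add: E_def measure_ball_complex \<tau>_def power2_eq_square power3_eq_cube)
  finally have AE: "cmod (LINT y:A\<inter>E|lborel. Kd \<tau> (\<zeta> - y)) \<le> pi * h" .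
  \<comment> \<open>Either \<open>A\<close> is empty or |\<zeta>| < 1 + \<tau> \<le> 2; then
    \<open>A\<close> lies in an annulus of outer radius |\<zeta>| + \<tau> and width at most 2
    \<tau>.\<close>
  have mA: "measure lborel A \<le> 8 * pi * \<tau>"
  proof (cases "A = {}")
    case True
    then show ?thesis using \<tau> by simp
  next
    case False
    then have z2: "cmod \<zeta> \<le> 2" using \<tau> by (auto simp: A_def B_def)
    define R where "R = max 0 (cmod \<zeta> - \<tau>)"
    have sub: "A \<subseteq> ball 0 (cmod \<zeta> + \<tau>) - ball 0 R"
      by (auto simp: A_def R_def max_def split: if_splits)
    have sub2: "ball (0::complex) R \<subseteq> ball 0 (cmod \<zeta> + \<tau>)"
      using \<tau> by (intro subset_ball) (auto simp: R_def)
    have "measure lborel A \<le> measure lborel (ball (0::complex) (cmod \<zeta> + \<tau>) - ball 0 R)"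
      by (intro measure_mono_fmeasurable sub) (auto intro!: bounded_borel_fmeasurable bounded_diff)
    also have "\<dots> = measure lborel (ball (0::complex) (cmod \<zeta> + \<tau>)) - measure lborel (ball (0::complex) R)"
      using sub2 emeasure_bounded_finite[OF bounded_ball, of "0::complex" "cmod \<zeta> + \<tau>"]
      by (intro measure_Diff) auto
    also have "\<dots> = pi * ((cmod \<zeta> + \<tau>)\<^sup>2 - R\<^sup>2)"
      using \<tau> by (simp add: measure_ball_complex R_def algebra_simps)
    also have "\<dots> \<le> pi * (8 * \<tau>)"
    proof (intro mult_left_mono)
      show "(cmod \<zeta> + \<tau>)\<^sup>2 - R\<^sup>2 \<le> 8 * \<tau>"
      proof (cases "\<tau> \<le> cmod \<zeta>")
        case True
        then have "(cmod \<zeta> + \<tau>)\<^sup>2 - R\<^sup>2 = 4 * cmod \<zeta> * \<tau>"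
          by (simp add: R_def power2_eq_square algebra_simps)
        also have "\<dots> \<le> 4 * 2 * \<tau>" using z2 \<tau> by (intro mult_right_mono) auto
        finally show ?thesis by simp
      next
        case False
        then have "(cmod \<zeta> + \<tau>)\<^sup>2 \<le> (2 * \<tau>)\<^sup>2" using \<tau>(1) by (intro power_mono) auto
        also have "\<dots> = 4 * \<tau> * \<tau>" by (simp add: power2_eq_square)
        also have "\<dots> \<le> 4 * \<tau> * 1" using \<tau> by (intro mult_left_mono) auto
        finally show ?thesis using \<tau> zero_le_power2[of R] by linarith
      qed
    qed auto
    finally show ?thesis by simp
  qed
  have "cmod (LINT y:A-E|lborel. Kd \<tau> (\<zeta> - y)) \<le> 1 / h\<^sup>2 * measure lborel (A - E)"
  proof (intro norm_set_integral_le)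
    fix y assume "y \<in> A - E"
    then have "h\<^sup>2 \<le> cmod (\<zeta> - y)" by (auto simp: E_def dist_norm)
    have "cmod (Kd \<tau> (\<zeta> - y)) \<le> 1 / max (cmod (\<zeta> - y)) \<tau>"
      by (rule norm_Kd_le[OF \<tau>(1)])
    also have "\<dots> \<le> 1 / h\<^sup>2" using \<open>h\<^sup>2 \<le> _\<close> h \<tau> by (intro divide_left_mono mult_pos_pos) auto
    finally show "cmod (Kd \<tau> (\<zeta> - y)) \<le> 1 / h\<^sup>2" .
  qed (use bdd in auto)
  also have "\<dots> \<le> 1 / h\<^sup>2 * measure lborel A"
    using h bdd by (intro mult_left_mono measure_mono_fmeasurable)
       (auto intro!: bounded_borel_fmeasurable intro: bounded_subset)
  also have "\<dots> \<le> 1 / h\<^sup>2 * (8 * pi * \<tau>)"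
    using mA h by (intro mult_left_mono) auto
  also have "\<dots> = 8 * pi * h"
    using h by (simp add: \<tau>_def power2_eq_square power3_eq_cube)
  finally have AmE: "cmod (LINT y:A-E|lborel. Kd \<tau> (\<zeta> - y)) \<le> 8 * pi * h" .
  have "(LINT y:S|lborel. Kd \<tau> (\<zeta> - y)) = (LINT y:S|lborel. 1 / (\<zeta> - y))"
  proof (intro set_lebesgue_integral_cong ballI impI allI)
    fix y assume "y \<in> S"
    then have "\<tau> \<le> cmod (\<zeta> - y)"
      using norm_triangle_ineq3[of \<zeta> y] by (auto simp: S_def)
    then show "Kd \<tau> (\<zeta> - y) = 1 / (\<zeta> - y)" by (rule Kd_outside[OF \<tau>(1)])
  qed auto
  also have "\<dots> = (1 / \<zeta>) * measure lborel {y\<in>S. cmod y < cmod \<zeta>}"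
    using bdd \<tau> by (intro integral_Cauchy_kernel_rotation_invariant[where \<tau> = \<tau>])
      (auto simp: S_def B_def norm_mult)
  finally have Sint: "(LINT y:S|lborel. Kd \<tau> (\<zeta> - y)) = (1 / \<zeta>) * measure lborel {y\<in>S. cmod y < cmod \<zeta>}" .
  \<comment> \<open>pi * Kd 1 \<zeta> is 1/\<zeta> times the area of the part of the unit disk with
    |y| < |\<zeta>|. Leaving out the annulus changes that area by at most 2 pi \<tau> |\<zeta>|, and
    1/\<zeta> cancels the factor |\<zeta>|. For |\<zeta>| < \<tau> no area is left, and
    \<open>Kd 1 \<zeta>\<close> is itself small.\<close>
  have main: "cmod ((1 / \<zeta>) * measure lborel {y\<in>S. cmod y < cmod \<zeta>} - pi * Kd 1 \<zeta>) \<le> 2 * pi * h"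
  proof -
    have set: "{y\<in>S. cmod y < cmod \<zeta>} = {y. cmod y < 1 \<and> cmod y \<le> cmod \<zeta> - \<tau>}"
      using \<tau> by (auto simp: S_def B_def)
    consider "1 + \<tau> \<le> cmod \<zeta>" | "\<tau> \<le> cmod \<zeta>" "cmod \<zeta> < 1 + \<tau>" | "cmod \<zeta> < \<tau>" by linarith
    then show ?thesis
    proof cases
      case 1
      then have "{y\<in>S. cmod y < cmod \<zeta>} = ball 0 1" unfolding set by auto
      then show ?thesis
        using 1 h \<tau> by (simp add: measure_ball_complex Kd_outside)
    next
      case 2
      then have "\<zeta> \<noteq> 0" using \<tau> by auto
      have "{y\<in>S. cmod y < cmod \<zeta>} = cball 0 (cmod \<zeta> - \<tau>)" unfolding set using 2 by auto
      then have m: "measure lborel {y\<in>S. cmod y < cmod \<zeta>} = pi * (cmod \<zeta> - \<tau>)\<^sup>2"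
        using 2 by (simp add: measure_ball_complex)
      define q where "q = (min (cmod \<zeta>) 1)\<^sup>2"
      have K: "Kd 1 \<zeta> = (1 / \<zeta>) * complex_of_real q"
      proof (cases "cmod \<zeta> \<le> 1")
        case True
        then show ?thesis
          using \<open>\<zeta> \<noteq> 0\<close> complex_norm_square[of \<zeta>] by (simp add: Kd_def q_def max_def min_def)
      next
        case False
        then show ?thesis by (simp add: Kd_outside q_def)
      qed
      have "\<bar>(cmod \<zeta> - \<tau>)\<^sup>2 - q\<bar> \<le> 2 * \<tau> * cmod \<zeta>"
      proof (cases "cmod \<zeta> \<le> 1")
        case True
        have "(cmod \<zeta> - \<tau>)\<^sup>2 - q = - (\<tau> * (2 * cmod \<zeta> - \<tau>))"
          using True by (simp add: q_def power2_eq_square algebra_simps)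
        moreover have "0 \<le> \<tau> * (2 * cmod \<zeta> - \<tau>)" using 2 \<tau> by (intro mult_nonneg_nonneg) auto
        moreover have "\<tau> * (2 * cmod \<zeta> - \<tau>) \<le> \<tau> * (2 * cmod \<zeta>)" using \<tau> by (intro mult_left_mono) auto
        ultimately show ?thesis by (simp add: mult_ac)
      next
        case False
        have "(1 - \<tau>)\<^sup>2 \<le> (cmod \<zeta> - \<tau>)\<^sup>2" using False \<tau> by (intro power_mono) auto
        moreover have "(cmod \<zeta> - \<tau>)\<^sup>2 \<le> 1" using 2 by (intro power_le_one) auto
        moreover have "1 - 2 * \<tau> \<le> (1 - \<tau>)\<^sup>2" by (simp add: power2_eq_square algebra_simps)
        moreover have "\<tau> * 1 \<le> \<tau> * cmod \<zeta>" using False \<tau> by (intro mult_left_mono) auto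
        moreover have "q = 1" using False by (simp add: q_def)
        ultimately show ?thesis by simp
      qed
      have "(1 / \<zeta>) * measure lborel {y\<in>S. cmod y < cmod \<zeta>} - pi * Kd 1 \<zeta>
          = (pi / \<zeta>) * complex_of_real ((cmod \<zeta> - \<tau>)\<^sup>2 - q)"
        unfolding m K by (simp add: right_diff_distrib)
      then have "cmod ((1 / \<zeta>) * measure lborel {y\<in>S. cmod y < cmod \<zeta>} - pi * Kd 1 \<zeta>)
          = (pi / cmod \<zeta>) * \<bar>(cmod \<zeta> - \<tau>)\<^sup>2 - q\<bar>"
        by (simp only: norm_mult norm_divide norm_of_real abs_of_nonneg[OF pi_ge_zero])
      also have "\<dots> \<le> (pi / cmod \<zeta>) * (2 * \<tau> * cmod \<zeta>)"
        using \<open>\<bar>_ - q\<bar> \<le> _\<close> by (intro mult_left_mono) auto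
      also have "\<dots> = 2 * pi * \<tau>" using \<open>\<zeta> \<noteq> 0\<close> by simp
      also have "\<dots> \<le> 2 * pi * h" using \<tau> by simp
      finally show ?thesis .
    next
      case 3
      then have "{y\<in>S. cmod y < cmod \<zeta>} = {}" unfolding set using norm_ge_zero by (smt (verit) Collect_empty_eq)
      then have "measure lborel {y\<in>S. cmod y < cmod \<zeta>} = 0" by (simp only: measure_empty)
      moreover have "cmod (Kd 1 \<zeta>) \<le> h"
        using 3 \<tau> by (simp add: Kd_def norm_divide max_def)
      ultimately show ?thesis using h mult_left_mono[of "cmod (Kd 1 \<zeta>)" "2 * h" pi] by (simp add: norm_mult mult_ac)
    qed
  qed
  have "cmod ((LINT y:B|lborel. Kd \<tau> (\<zeta> - y)) - pi * Kd 1 \<zeta>)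
      \<le> cmod ((1 / \<zeta>) * measure lborel {y\<in>S. cmod y < cmod \<zeta>} - pi * Kd 1 \<zeta>)
        + cmod (LINT y:A\<inter>E|lborel. Kd \<tau> (\<zeta> - y)) + cmod (LINT y:A-E|lborel. Kd \<tau> (\<zeta> - y))"
    unfolding split Sint
    by (rule order_trans[OF _ add_right_mono[OF norm_triangle_ineq]], rule order_trans[OF _ norm_triangle_ineq])
       (simp add: algebra_simps)
  also have "\<dots> \<le> 2 * pi * h + pi * h + 8 * pi * h"
    using main AE AmE by (intro add_mono)
  finally show ?thesis by (simp add: B_def \<tau>_def)
qed

section \<open>Lattice averages over a disk\<close>

text \<open>The set \<open>Sig\<close> divided by the radius of its disk, so that every lattice
  estimate is proved on the unit disk and transported by dilation.\<close>

definition disc_lattice :: "nat \<Rightarrow> complex set" where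
  "disc_lattice m = {x. cmod x \<le> 1 - 1 / real m \<and>
      (\<exists>j k :: int. x = complex_of_real (3 / real m) * (of_int j + \<i> * of_int k))}"

text \<open>Both coordinates are rounded to multiples of l. The floor makes the cells half-open
  squares, so they partition the plane and each lattice point owns area l^2 exactly.\<close>

definition nearest :: "real \<Rightarrow> complex \<Rightarrow> complex" where
  "nearest l y = complex_of_real l *
     (of_int \<lfloor>Re y / l + 1/2\<rfloor> + \<i> * of_int \<lfloor>Im y / l + 1/2\<rfloor>)"

lemma nearest_components:
  assumes "l > 0"
  shows "\<bar>Re (nearest l y) - Re y\<bar> \<le> l / 2" "\<bar>Im (nearest l y) - Im y\<bar> \<le> l / 2"
proof -
  have *: "\<bar>l * of_int \<lfloor>t / l + 1/2\<rfloor> - t\<bar> \<le> l / 2" for t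
  proof -
    have "\<bar>of_int \<lfloor>t / l + 1/2\<rfloor> - t / l\<bar> \<le> 1 / 2" by linarith
    then have "l * \<bar>of_int \<lfloor>t / l + 1/2\<rfloor> - t / l\<bar> \<le> l * (1 / 2)"
      using assms by (intro mult_left_mono) auto
    moreover have "l * \<bar>of_int \<lfloor>t / l + 1/2\<rfloor> - t / l\<bar> = \<bar>l * (of_int \<lfloor>t / l + 1/2\<rfloor> - t / l)\<bar>"
      using assms by (simp add: abs_mult)
    ultimately show ?thesis using assms by (simp add: right_diff_distrib)
  qed
  show "\<bar>Re (nearest l y) - Re y\<bar> \<le> l / 2" "\<bar>Im (nearest l y) - Im y\<bar> \<le> l / 2"
    using *[of "Re y"] *[of "Im y"] by (simp_all add: nearest_def)
qed

lemma norm_nearest_diff: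
  assumes "l > 0"
  shows "cmod (nearest l y - y) \<le> l"
  using cmod_le[of "nearest l y - y"] nearest_components[OF assms, of y] by simp

lemma measure_nearest_cell:
  fixes j k :: int
  assumes l: "l > 0" and x: "x = complex_of_real l * (of_int j + \<i> * of_int k)"
  shows "{y. nearest l y = x} \<in> sets borel" "bounded {y. nearest l y = x}"
    "measure lborel {y. nearest l y = x} = l\<^sup>2"
proof -
  define a b where "a = l * (of_int j - 1/2)" and "b = l * (of_int k - 1/2)"
  have fl: "\<lfloor>t / l + 1/2\<rfloor> = i \<longleftrightarrow> l * (of_int i - 1/2) \<le> t \<and> t < l * (of_int i - 1/2) + l" for t and i :: int
    using l by (simp add: floor_eq_iff field_simps)
  have "{y. nearest l y = x} = {y. \<lfloor>Re y / l + 1/2\<rfloor> = j \<and> \<lfloor>Im y / l + 1/2\<rfloor> = k}"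
    using l by (auto simp: nearest_def x complex_eq_iff)
  then have eq: "{y. nearest l y = x} = {y. a \<le> Re y \<and> Re y < a + l \<and> b \<le> Im y \<and> Im y < b + l}"
    by (auto simp: fl a_def b_def)
  have sub: "box (Complex a b) (Complex (a + l) (b + l)) \<subseteq> {y. nearest l y = x}"
    "{y. nearest l y = x} \<subseteq> cbox (Complex a b) (Complex (a + l) (b + l))"
    unfolding eq by (auto simp: box_def cbox_def Basis_complex_def)
  show m: "{y. nearest l y = x} \<in> sets borel"
    unfolding eq by measurable
  show b: "bounded {y. nearest l y = x}"
    using sub(2) bounded_subset[OF bounded_cbox] by blast
  have "measure lborel (cbox (Complex a b) (Complex (a + l) (b + l))) = l\<^sup>2"
    using l by (simp add: measure_lborel_cbox_eq Basis_complex_def power2_eq_square)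
  moreover have "measure lborel (box (Complex a b) (Complex (a + l) (b + l))) = l\<^sup>2"
    using l by (simp add: measure_lborel_box_eq Basis_complex_def power2_eq_square)
  moreover have "measure lborel (box (Complex a b) (Complex (a + l) (b + l))) \<le> measure lborel {y. nearest l y = x}"
    using m b by (intro measure_mono_fmeasurable sub bounded_borel_fmeasurable) auto
  moreover have "measure lborel {y. nearest l y = x} \<le> measure lborel (cbox (Complex a b) (Complex (a + l) (b + l)))"
    using m b by (intro measure_mono_fmeasurable sub bounded_borel_fmeasurable) auto
  ultimately show "measure lborel {y. nearest l y = x} = l\<^sup>2" by simp
qed

lemma disc_lattice_subset:
  assumes "m > 0"
  shows "disc_lattice m \<subseteq> (\<lambda>(j, k). complex_of_real (3 / real m) * (of_int j + \<i> * of_int k))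
            ` ({- int m..int m} \<times> {- int m..int m})"
proof
  fix x assume "x \<in> disc_lattice m"
  then obtain j k :: int where x: "x = complex_of_real (3 / real m) * (of_int j + \<i> * of_int k)"
    and n: "cmod x \<le> 1 - 1 / real m" by (auto simp: disc_lattice_def)
  have *: "\<bar>i\<bar> \<le> int m" if "\<bar>3 / real m * of_int i\<bar> \<le> 1" for i :: int
  proof -
    have "\<bar>real_of_int i\<bar> * 3 \<le> real m" using that assms by (simp add: abs_mult field_simps)
    then show ?thesis by linarith
  qed
  have "cmod x \<le> 1" using n by (rule order_trans) simp
  then have "\<bar>Re x\<bar> \<le> 1" "\<bar>Im x\<bar> \<le> 1"
    using abs_Re_le_cmod[of x] abs_Im_le_cmod[of x] by linarith+
  then have "\<bar>j\<bar> \<le> int m" "\<bar>k\<bar> \<le> int m"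
    by (auto intro!: * simp: x)
  then show "x \<in> (\<lambda>(j, k). complex_of_real (3 / real m) * (of_int j + \<i> * of_int k))
            ` ({- int m..int m} \<times> {- int m..int m})"
    using x by (intro image_eqI[of _ _ "(j, k)"]) auto
qed

lemma finite_disc_lattice: "m > 0 \<Longrightarrow> finite (disc_lattice m)"
  by (rule finite_subset[OF disc_lattice_subset]) auto

lemma card_disc_lattice_le:
  assumes "m > 0"
  shows "real (card (disc_lattice m)) \<le> 9 * (real m)\<^sup>2"
proof -
  have "card (disc_lattice m) \<le> card ({- int m..int m} \<times> {- int m..int m})"
    by (rule surj_card_le[OF _ disc_lattice_subset[OF assms]]) auto
  also have "\<dots> = (2 * m + 1)\<^sup>2"
    by (simp add: card_cartesian_product power2_eq_square nat_add_distrib nat_mult_distrib)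
  also have "\<dots> \<le> (3 * m)\<^sup>2" using assms by (intro power_mono) auto
  finally have "real (card (disc_lattice m)) \<le> real ((3 * m)\<^sup>2)" by (simp only: of_nat_le_iff)
  then show ?thesis by (simp add: power_mult_distrib)
qed

text \<open>The Riemann sum is the integral of the step function \<open>F\<close> with value f(x) on
  the cell of a lattice point x. On the disk of radius 1 - 2 l the nearest lattice point has modulus
  at most 1 - l \<le> 1 - 1/m, hence belongs to the lattice, and the error is at most L l. On the
  annulus up to 1 + l, of area at most 6 pi l, it is at most 2 M; beyond, both functions
  vanish.\<close>

lemma disc_lattice_Riemann_sum:
  fixes f :: "complex \<Rightarrow> complex"
  assumes m: "m \<ge> 6" and l: "l = 3 / real m"
    and f: "continuous_on UNIV f" "\<And>y. cmod (f y) \<le> M" "\<And>y z. cmod (f y - f z) \<le> L * cmod (y - z)"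
  shows "cmod (of_real (l\<^sup>2) * (\<Sum>x\<in>disc_lattice m. f x) - (LINT y:ball 0 1|lborel. f y))
    \<le> pi * l * (L + 12 * M)"
proof -
  have l0: "0 < l" "l \<le> 1/2" using m by (auto simp: l field_simps)
  have M0: "M \<ge> 0" using f(2)[of 0] norm_ge_zero order_trans by blast
  have L0: "L \<ge> 0" using f(3)[of 0 1] order_trans[OF norm_ge_zero] by fastforce
  define \<Lambda> where "\<Lambda> = disc_lattice m"
  define cell where "cell = (\<lambda>x. {y. nearest l y = x})"
  define F where "F = (\<lambda>y. \<Sum>x\<in>\<Lambda>. indicator (cell x) y *\<^sub>R f x)"
  define U where "U = (ball 0 (1 - 2 * l) :: complex set)"
  define A where "A = (cball 0 (1 + l) - ball 0 (1 - 2 * l) :: complex set)"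
  have fin: "finite \<Lambda>" using m by (simp add: \<Lambda>_def finite_disc_lattice)
  have lat: "\<exists>j k::int. x = complex_of_real l * (of_int j + \<i> * of_int k)" if "x \<in> \<Lambda>" for x
    using that by (auto simp: \<Lambda>_def disc_lattice_def l)
  have icell: "integrable lborel (indicator (cell x) :: complex \<Rightarrow> real)" if "x \<in> \<Lambda>" for x
    using lat[OF that] measure_nearest_cell(1,2)[OF l0(1)]
    unfolding cell_def by (intro integrable_indicator_bounded) blast+
  have Fint: "integrable lborel F"
    unfolding F_def using icell by (intro Bochner_Integration.integrable_sum integrable_scaleR_left) auto
  have Fval: "(\<integral>y. F y \<partial>lborel) = of_real (l\<^sup>2) * (\<Sum>x\<in>\<Lambda>. f x)"
  proof -
    have "(\<integral>y. F y \<partial>lborel) = (\<Sum>x\<in>\<Lambda>. \<integral>y. indicator (cell x) y *\<^sub>R f x \<partial>lborel)"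
      unfolding F_def using icell by (intro Bochner_Integration.integral_sum integrable_scaleR_left) auto
    also have "\<dots> = (\<Sum>x\<in>\<Lambda>. of_real (l\<^sup>2) * f x)"
    proof (rule sum.cong[OF refl])
      fix x assume "x \<in> \<Lambda>"
      then have "measure lborel (cell x) = l\<^sup>2"
        using lat measure_nearest_cell(3)[OF l0(1)] unfolding cell_def by blast
      then show "(\<integral>y. indicator (cell x) y *\<^sub>R f x \<partial>lborel) = of_real (l\<^sup>2) * f x"
        using icell[OF \<open>x \<in> \<Lambda>\<close>] by (simp add: scaleR_conv_of_real)
    qed
    finally show ?thesis by (simp add: sum_distrib_left)
  qed
  have Fy: "F y = (if nearest l y \<in> \<Lambda> then f (nearest l y) else 0)" for y
  proof -
    have "F y = (\<Sum>x\<in>\<Lambda>. if nearest l y = x then f x else 0)"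
      unfolding F_def by (intro sum.cong) (auto simp: cell_def indicator_def)
    then show ?thesis using fin by (simp add: sum.delta)
  qed
  have iU: "integrable lborel (indicator U :: complex \<Rightarrow> real)"
    and iA: "integrable lborel (indicator A :: complex \<Rightarrow> real)"
    by (auto simp: U_def A_def intro!: integrable_indicator_bounded bounded_diff)
  have fmeas: "f \<in> borel_measurable borel" using f(1) by (intro borel_measurable_continuous_onI)
  have fint: "integrable lborel (\<lambda>y. indicator (ball 0 1) y *\<^sub>R f y)"
    using set_integrable_bounded[OF fmeas _ bounded_ball f(2)] by (simp add: set_integrable_def)
  have ptw: "cmod (F y - indicator (ball 0 1) y *\<^sub>R f y) \<le> L * l * indicator U y + 2 * M * indicator A y" for y
  proof -
    have near: "cmod (nearest l y - y) \<le> l" by (rule norm_nearest_diff[OF l0(1)])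
    have b: "cmod (nearest l y) \<le> cmod y + l" "cmod y \<le> cmod (nearest l y) + l"
      using near norm_triangle_ineq2[of "nearest l y" y] norm_triangle_ineq3[of y "nearest l y"]
      by (auto simp: norm_minus_commute)
    have "y \<in> U \<or> y \<in> A \<or> cmod y > 1 + l" by (auto simp: U_def A_def)
    then consider "y \<in> U" | "y \<in> A" | "cmod y > 1 + l" by blast
    then show ?thesis
    proof cases
      case 1
      then have "cmod (nearest l y) \<le> 1 - l" using b by (auto simp: U_def)
      also have "\<dots> \<le> 1 - 1 / real m" by (simp add: l divide_right_mono)
      finally have "nearest l y \<in> \<Lambda>"
        unfolding \<Lambda>_def disc_lattice_def nearest_def l by blast
      moreover have "y \<in> ball 0 1" using 1 l0 by (auto simp: U_def)
      moreover have "cmod (f (nearest l y) - f y) \<le> L * l"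
        using f(3)[of "nearest l y" y] mult_left_mono[OF near L0] by linarith
      moreover have "0 \<le> 2 * M * indicator A y" using M0 by simp
      ultimately show ?thesis using 1 by (auto simp: Fy)
    next
      case 2
      have "cmod (F y) \<le> M" using f(2) M0 by (simp add: Fy)
      moreover have "cmod (indicator (ball 0 1) y *\<^sub>R f y) \<le> M" using f(2)[of y] M0 by (auto simp: indicator_def)
      moreover have "0 \<le> L * l * indicator U y" using L0 l0 by simp
      ultimately show ?thesis
        using 2 norm_triangle_ineq4[of "F y" "indicator (ball 0 1) y *\<^sub>R f y"] by simp
    next
      case 3
      then have "cmod (nearest l y) > 1" using b by linarith
      then have "nearest l y \<notin> \<Lambda>" by (auto simp: \<Lambda>_def disc_lattice_def intro!: add_pos_nonneg)
         (smt (verit) of_nat_0_le_iff zero_le_divide_1_iff)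
      then show ?thesis using 3 l0 L0 M0 by (simp add: Fy)
    qed
  qed
  have mU: "measure lborel U \<le> pi"
    using l0 by (simp add: U_def measure_ball_complex power_le_one)
  have mA: "measure lborel A \<le> 6 * pi * l"
  proof -
    have "measure lborel A = measure lborel (cball 0 (1 + l) :: complex set) - measure lborel (ball 0 (1 - 2 * l) :: complex set)"
      unfolding A_def using l0 emeasure_bounded_finite[OF bounded_cball, of "0::complex" "1 + l"]
      by (intro measure_Diff) auto
    also have "\<dots> = pi * ((1 + l)\<^sup>2 - (1 - 2 * l)\<^sup>2)"
      using l0 by (simp add: measure_ball_complex right_diff_distrib)
    also have "\<dots> \<le> pi * (6 * l)"
      using l0 by (intro mult_left_mono) (auto simp: power2_eq_square algebra_simps)
    finally show ?thesis by simp
  qed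
  have "of_real (l\<^sup>2) * (\<Sum>x\<in>disc_lattice m. f x) - (LINT y:ball 0 1|lborel. f y)
     = (\<integral>y. F y - indicator (ball 0 1) y *\<^sub>R f y \<partial>lborel)"
    using Fint fint by (simp add: Fval[unfolded \<Lambda>_def] set_lebesgue_integral_def)
  also have "cmod \<dots> \<le> (\<integral>y. L * l * indicator U y + 2 * M * indicator A y \<partial>lborel)"
    using Fint fint iU iA ptw by (intro Bochner_Integration.integral_norm_bound_integral) auto
  also have "\<dots> = L * l * measure lborel U + 2 * M * measure lborel A"
    using iU iA by simp
  also have "\<dots> \<le> L * l * pi + 2 * M * (6 * pi * l)"
    using mU mA L0 l0 M0 by (intro add_mono mult_left_mono) auto
  also have "\<dots> = pi * l * (L + 12 * M)" by (simp add: algebra_simps)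
  finally show ?thesis .
qed

text \<open>Summation over square shells: the shell at distance N + 1 has 8 (N + 1) points and
  contributes 8/(N + 1), at most 8 (ln (N + 1) - ln N). The 9 counts the points of the initial
  square, each of weight 1; the inner \<open>max 1\<close> covers the origin.\<close>

lemma sum_square_inverse_max_le:
  assumes "N \<ge> 1"
  shows "(\<Sum>(a, b)\<in>{- int N..int N} \<times> {- int N..int N}. 1 / (real_of_int (max 1 (max \<bar>a\<bar> \<bar>b\<bar>)))\<^sup>2)
    \<le> 9 + 8 * ln (real N)"
  using assms
proof (induction N rule: dec_induct)
  case base
  have "{- int 1..int 1} = {-1, 0, 1}" by auto
  then show ?case by (simp add: sum.cartesian_product[symmetric])
next
  case (step N)
  let ?g = "\<lambda>(a, b). 1 / (real_of_int (max 1 (max \<bar>a\<bar> \<bar>b\<bar>)))\<^sup>2"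
  define Q where "Q = (\<lambda>N. {- int N..int N} \<times> {- int N..int N})"
  have sub: "Q N \<subseteq> Q (Suc N)" by (auto simp: Q_def)
  have cQ: "card (Q N) = (2 * N + 1)\<^sup>2" for N
    by (simp add: Q_def card_cartesian_product power2_eq_square nat_add_distrib nat_mult_distrib)
  have "card (Q (Suc N) - Q N) = 8 * (N + 1)"
    using sub by (subst card_Diff_subset) (auto simp: cQ, auto simp: Q_def power2_eq_square algebra_simps)
  moreover have "?g p = 1 / (real N + 1)\<^sup>2" if "p \<in> Q (Suc N) - Q N" for p
  proof -
    obtain a b where p: "p = (a, b)" by (cases p)
    have "max 1 (max \<bar>a\<bar> \<bar>b\<bar>) = int N + 1" using that by (auto simp: Q_def p)
    then show ?thesis by (simp add: p)
  qed
  ultimately have "sum ?g (Q (Suc N) - Q N) = (8 * (real N + 1)) * (1 / (real N + 1)\<^sup>2)"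
    by (simp add: sum.cong[where h = "\<lambda>_. 1 / (real N + 1)\<^sup>2", OF refl])
  also have "\<dots> = 8 * (1 / (real N + 1))"
    by (simp add: power2_eq_square divide_simps)
  also have "1 / (real N + 1) \<le> ln (real (Suc N)) - ln (real N)"
  proof -
    have "ln (real N / (real N + 1)) \<le> real N / (real N + 1) - 1"
      using step by (intro ln_le_minus_one) auto
    also have "\<dots> = - (1 / (real N + 1))" by (simp add: field_simps)
    finally show ?thesis using step by (simp add: ln_div add.commute)
  qed
  finally have "sum ?g (Q (Suc N) - Q N) \<le> 8 * (ln (real (Suc N)) - ln (real N))" by simp
  moreover have "sum ?g (Q (Suc N)) = sum ?g (Q (Suc N) - Q N) + sum ?g (Q N)"
    by (rule sum.subset_diff[OF sub]) (simp add: Q_def)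
  ultimately show ?case using step.IH by (simp add: Q_def)
qed

text \<open>Indices are counted from the lattice point nearest to \<zeta>; a point at offset (a, b)
  is then at distance at least max(|a|, |b|)/m, and the shell sum applies. For |\<zeta>| < 2 the
  offsets are at most 2 m, since the index of a point and that of the nearest point are each at most
  m. For |\<zeta>| \<ge> 2 every summand is at most 1 and counting suffices.\<close>

lemma disc_lattice_sum_le:
  assumes m: "m \<ge> 6"
  shows "(\<Sum>x\<in>disc_lattice m. 1 / (max (cmod (\<zeta> - x)) (1 / real m))\<^sup>2) \<le> 17 * (real m)\<^sup>2 * (1 + ln (real m))"
proof (cases "cmod \<zeta> \<ge> 2")
  case True
  have "1 / (max (cmod (\<zeta> - x)) (1 / real m))\<^sup>2 \<le> 1" if "x \<in> disc_lattice m" for x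
  proof -
    have "cmod x \<le> 1 - 1 / real m" using that by (simp add: disc_lattice_def)
    then have "cmod x \<le> 1" by (rule order_trans) simp
    then have "1 \<le> max (cmod (\<zeta> - x)) (1 / real m)"
      using norm_triangle_ineq2[of \<zeta> x] True by linarith
    then show ?thesis by (simp add: one_le_power)
  qed
  then have "(\<Sum>x\<in>disc_lattice m. 1 / (max (cmod (\<zeta> - x)) (1 / real m))\<^sup>2) \<le> real (card (disc_lattice m)) * 1"
    by (intro sum_bounded_above) auto
  also have "\<dots> \<le> 9 * (real m)\<^sup>2" using card_disc_lattice_le[of m] m by simp
  also have "\<dots> \<le> 17 * (real m)\<^sup>2 * (1 + ln (real m))"
    using m mult_left_mono[of 1 "1 + ln (real m)" "17 * (real m)\<^sup>2"] by (simp add: ln_ge_zero)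
  finally show ?thesis .
next
  case False
  define l where "l = 3 / real m"
  have l: "l > 0" "1 / real m \<le> l / 2" using m by (auto simp: l_def field_simps)
  define P where "P = (\<lambda>(a::int, b::int). complex_of_real l * (of_int (a + \<lfloor>Re \<zeta> / l + 1/2\<rfloor>) + \<i> * of_int (b + \<lfloor>Im \<zeta> / l + 1/2\<rfloor>)))"
  define Q where "Q = {- int (2 * m)..int (2 * m)} \<times> {- int (2 * m)..int (2 * m)}"
  have inj: "inj_on P Q"
    using l by (auto simp: inj_on_def P_def complex_eq_iff)
  have sub: "disc_lattice m \<subseteq> P ` Q"
  proof
    fix x assume "x \<in> disc_lattice m"
    then obtain p where p: "p \<in> {- int m..int m} \<times> {- int m..int m}"
      and x: "x = (case p of (j, k) \<Rightarrow> complex_of_real l * (of_int j + \<i> * of_int k))"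
      using disc_lattice_subset[of m] m unfolding l_def by force
    obtain j k where jk: "p = (j, k)" by (cases p)
    have fl: "\<bar>\<lfloor>t / l + 1/2\<rfloor>\<bar> \<le> int m" if "\<bar>t\<bar> \<le> 2" for t
    proof -
      have "\<bar>t / l\<bar> \<le> 2 / l" using that l by (simp add: abs_div_pos[symmetric] divide_right_mono)
      also have "2 / l + 1 \<le> real m" using m by (simp add: l_def)
      finally show ?thesis by linarith
    qed
    have "\<bar>Re \<zeta>\<bar> \<le> 2" "\<bar>Im \<zeta>\<bar> \<le> 2"
      using False abs_Re_le_cmod[of \<zeta>] abs_Im_le_cmod[of \<zeta>] by linarith+
    then have "(j - \<lfloor>Re \<zeta> / l + 1/2\<rfloor>, k - \<lfloor>Im \<zeta> / l + 1/2\<rfloor>) \<in> Q"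
      using fl[of "Re \<zeta>"] fl[of "Im \<zeta>"] p by (auto simp: Q_def jk)
    moreover have "P (j - \<lfloor>Re \<zeta> / l + 1/2\<rfloor>, k - \<lfloor>Im \<zeta> / l + 1/2\<rfloor>) = x"
      by (simp add: P_def x jk)
    ultimately show "x \<in> P ` Q" by (metis image_eqI)
  qed
  have summand: "1 / (max (cmod (\<zeta> - P p)) (1 / real m))\<^sup>2
      \<le> (real m)\<^sup>2 * (case p of (a, b) \<Rightarrow> 1 / (real_of_int (max 1 (max \<bar>a\<bar> \<bar>b\<bar>)))\<^sup>2)" for p
  proof -
    obtain a b where p: "p = (a, b)" by (cases p)
    define M where "M = max (cmod (\<zeta> - P p)) (1 / real m)"
    have M: "M > 0" "1 / real m \<le> M" using m by (auto simp: M_def less_max_iff_disj)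
    \<comment> \<open>Here u is the rounded coordinate, so l u is within l/2 of t, and |t - l (i +
      u)| \<ge> l |i| - l/2 \<ge> (l/2) |i| as soon as |i| \<ge> 1. The mesh 3/m gives l/2 \<ge>
      1/m.\<close>
    have comp: "1 / real m * \<bar>real_of_int i\<bar> \<le> \<bar>t - l * (of_int i + u)\<bar>"
      if "\<bar>l * u - t\<bar> \<le> l / 2" "i \<noteq> 0" for i and t u :: real
    proof -
      have "1 \<le> \<bar>real_of_int i\<bar>" using that by linarith
      then have "l / 2 * \<bar>real_of_int i\<bar> \<le> l * \<bar>real_of_int i\<bar> - l / 2"
        using l mult_left_mono[of 1 "\<bar>real_of_int i\<bar>" "l / 2"] by linarith
      also have "\<dots> \<le> \<bar>l * of_int i\<bar> - \<bar>l * u - t\<bar>" using that l by (simp add: abs_mult)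
      also have "\<dots> \<le> \<bar>t - l * (of_int i + u)\<bar>" by (simp add: algebra_simps)
      finally show ?thesis
        using l mult_right_mono[of "1 / real m" "l / 2" "\<bar>real_of_int i\<bar>"] by linarith
    qed
    have near: "\<bar>l * of_int \<lfloor>Re \<zeta> / l + 1/2\<rfloor> - Re \<zeta>\<bar> \<le> l / 2" "\<bar>l * of_int \<lfloor>Im \<zeta> / l + 1/2\<rfloor> - Im \<zeta>\<bar> \<le> l / 2"
      using nearest_components[OF l(1), of \<zeta>] by (simp_all add: nearest_def)
    have "1 / real m * \<bar>real_of_int a\<bar> \<le> M"
    proof (cases "a = 0")
      case True
      then show ?thesis using M by simp
    next
      case False
      from comp[OF near(1) this] have "1 / real m * \<bar>real_of_int a\<bar> \<le> \<bar>Re (\<zeta> - P p)\<bar>"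
        by (simp add: P_def p)
      also have "\<dots> \<le> M" using abs_Re_le_cmod[of "\<zeta> - P p"] by (simp add: M_def)
      finally show ?thesis .
    qed
    moreover have "1 / real m * \<bar>real_of_int b\<bar> \<le> M"
    proof (cases "b = 0")
      case True
      then show ?thesis using M by simp
    next
      case False
      from comp[OF near(2) this] have "1 / real m * \<bar>real_of_int b\<bar> \<le> \<bar>Im (\<zeta> - P p)\<bar>"
        by (simp add: P_def p)
      also have "\<dots> \<le> M" using abs_Im_le_cmod[of "\<zeta> - P p"] by (simp add: M_def)
      finally show ?thesis .
    qed
    moreover define q where "q = real_of_int (max 1 (max \<bar>a\<bar> \<bar>b\<bar>))"
    moreover have "q = 1 \<or> q = \<bar>real_of_int a\<bar> \<or> q = \<bar>real_of_int b\<bar>"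
      unfolding q_def by linarith
    ultimately have "q / real m \<le> M" using M(2) by auto
    moreover have "q > 0" by (simp add: q_def)
    ultimately have "1 / M\<^sup>2 \<le> 1 / (q / real m)\<^sup>2"
      using m M(1) by (intro divide_left_mono power_mono mult_pos_pos zero_less_power) auto
    then show ?thesis
      by (simp add: p power_divide flip: M_def[unfolded p] q_def)
  qed
  have "(\<Sum>x\<in>disc_lattice m. 1 / (max (cmod (\<zeta> - x)) (1 / real m))\<^sup>2)
      \<le> (\<Sum>x\<in>P ` Q. 1 / (max (cmod (\<zeta> - x)) (1 / real m))\<^sup>2)"
    by (intro sum_mono2 sub) (auto simp: Q_def)
  also have "\<dots> = (\<Sum>p\<in>Q. 1 / (max (cmod (\<zeta> - P p)) (1 / real m))\<^sup>2)"
    by (simp add: sum.reindex[OF inj])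
  also have "\<dots> \<le> (\<Sum>p\<in>Q. (real m)\<^sup>2 * (case p of (a, b) \<Rightarrow> 1 / (real_of_int (max 1 (max \<bar>a\<bar> \<bar>b\<bar>)))\<^sup>2))"
    by (intro sum_mono summand)
  also have "\<dots> = (real m)\<^sup>2 * (\<Sum>(a, b)\<in>Q. 1 / (real_of_int (max 1 (max \<bar>a\<bar> \<bar>b\<bar>)))\<^sup>2)"
    by (simp only: sum_distrib_left)
  also have "\<dots> \<le> (real m)\<^sup>2 * (9 + 8 * ln (real (2 * m)))"
    unfolding Q_def using m by (intro mult_left_mono sum_square_inverse_max_le) auto
  also have "\<dots> \<le> (real m)\<^sup>2 * (17 * (1 + ln (real m)))"
  proof (intro mult_left_mono)
    have "ln (real (2 * m)) = ln 2 + ln (real m)" using m by (simp add: ln_mult)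
    moreover have "ln (2::real) \<le> 1" using ln_le_minus_one[of 2] by simp
    moreover have "ln (real m) \<ge> 0" using m by simp
    ultimately show "9 + 8 * ln (real (2 * m)) \<le> 17 * (1 + ln (real m))" by simp
  qed simp
  finally show ?thesis by (simp only: mult_ac)
qed

text \<open>The Riemann sum of the constant 1. The threshold 72 makes the error 36 pi / m at most
  pi/2, so that at least pi/2 > 3/2 of the area remains.\<close>

lemma card_disc_lattice_approx:
  assumes m: "m \<ge> 72"
  shows "\<bar>(3 / real m)\<^sup>2 * real (card (disc_lattice m)) - pi\<bar> \<le> 12 * pi * (3 / real m)"
    and "(real m)\<^sup>2 / 6 \<le> real (card (disc_lattice m))"
proof -
  have "cmod (of_real ((3 / real m)\<^sup>2) * (\<Sum>x\<in>disc_lattice m. 1) - (LINT y:ball (0::complex) 1|lborel. (1::complex)))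
    \<le> pi * (3 / real m) * (0 + 12 * 1)"
    using m by (intro disc_lattice_Riemann_sum) auto
  moreover have "(LINT y:ball (0::complex) 1|lborel. (1::complex)) = of_real pi"
    by (simp add: set_lebesgue_integral_def measure_ball_complex scaleR_conv_of_real)
  ultimately have "cmod (complex_of_real ((3 / real m)\<^sup>2 * real (card (disc_lattice m)) - pi)) \<le> 12 * pi * (3 / real m)"
    by (simp add: mult_ac)
  then show a: "\<bar>(3 / real m)\<^sup>2 * real (card (disc_lattice m)) - pi\<bar> \<le> 12 * pi * (3 / real m)"
    by (simp only: norm_of_real)
  have "12 * pi * (3 / real m) \<le> 12 * pi * (1 / 24)"
    using m by (intro mult_left_mono) (auto simp: field_simps)
  then have "3 / 2 \<le> (3 / real m)\<^sup>2 * real (card (disc_lattice m))"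
    using a pi_gt3 by linarith
  then show "(real m)\<^sup>2 / 6 \<le> real (card (disc_lattice m))"
    using m by (simp add: power_divide field_simps)
qed

text \<open>The kernel of radius 1/m is too singular for a Riemann sum, so it is first widened to
  radius \<tau> = h^3, at a cost of order \<tau> log m on average. The Riemann sum for the wider
  kernel, of Lipschitz constant 1/\<tau>^2, errs by order l/\<tau>^2; the choice 1/m = h^9 =
  \<tau>^3 makes this of order h^3. The dominant error is the O(h) of
  \<open>disc_integral_Kd\<close>, which fixes \<tau> = h^3.\<close>

lemma disc_lattice_average:
  assumes m: "m \<ge> 72" and h: "h = real m powr (-1/9)"
  shows "cmod ((\<Sum>x\<in>disc_lattice m. Kd (1 / real m) (\<zeta> - x)) / of_nat (card (disc_lattice m)) - Kd 1 \<zeta>) \<le> 3000 * h"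
proof -
  define k l where "k = real (card (disc_lattice m))" and "l = 3 / real m"
  have h0: "0 < h" using m by (simp add: h)
  have h9: "h ^ 9 = 1 / real m"
  proof -
    have "h ^ 9 = h powr real 9" using h0 by (rule powr_realpow[symmetric])
    also have "\<dots> = real m powr - 1" by (simp add: h powr_powr)
    finally show ?thesis using m by (simp add: powr_minus_divide)
  qed
  have "real m powr (-1/9) \<le> real m powr 0" using m by (intro powr_mono) auto
  then have h1: "h \<le> 1" using m by (simp add: h)
  have lh: "l = 3 * h ^ 9" by (simp add: l_def h9)
  have hp: "h ^ i \<le> h" if "i \<ge> 1" for i
    using power_decreasing[of 1 i h] h0 h1 that by simp
  define \<tau> where "\<tau> = h ^ 3"
  have \<tau>: "\<tau> > 0" "1 / real m \<le> \<tau>"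
    using h0 h1 power_decreasing[of 3 9 h] by (simp_all add: \<tau>_def h9)
  have k: "(real m)\<^sup>2 / 6 \<le> k" "\<bar>l\<^sup>2 * k - pi\<bar> \<le> 12 * pi * l" "k > 0"
    using card_disc_lattice_approx[OF m] m by (simp_all add: k_def l_def) (use m in \<open>auto intro!: Nat.gr0I\<close>)
  have lk: "3 / 2 \<le> l\<^sup>2 * k" using k(1) m by (simp add: l_def power_divide field_simps)
  have "cmod ((\<Sum>x\<in>disc_lattice m. Kd (1 / real m) (\<zeta> - x)) - (\<Sum>x\<in>disc_lattice m. Kd \<tau> (\<zeta> - x)))
      \<le> (\<Sum>x\<in>disc_lattice m. cmod (Kd (1 / real m) (\<zeta> - x) - Kd \<tau> (\<zeta> - x)))"
    unfolding sum_subtractf[symmetric] by (rule norm_sum)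
  \<comment> \<open>Both kernels are 1/z outside the disk of radius \<tau>. Inside it they are at
    most 1/M with M \<le> \<tau>, and 1/M \<le> \<tau>/M^2 brings in the inverse square lattice
    sum.\<close>
  also have "\<dots> \<le> (\<Sum>x\<in>disc_lattice m. 2 * \<tau> * (1 / (max (cmod (\<zeta> - x)) (1 / real m))\<^sup>2))"
  proof (rule sum_mono)
    fix x
    define y M where "y = \<zeta> - x" and "M = max (cmod y) (1 / real m)"
    have M: "M > 0" using m by (simp add: M_def less_max_iff_disj)
    show "cmod (Kd (1 / real m) (\<zeta> - x) - Kd \<tau> (\<zeta> - x)) \<le> 2 * \<tau> * (1 / (max (cmod (\<zeta> - x)) (1 / real m))\<^sup>2)"
    proof (cases "\<tau> \<le> cmod y")
      case True
      then have "Kd (1 / real m) y = Kd \<tau> y"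
        using \<tau> m by (simp add: Kd_outside)
      then show ?thesis using \<tau> by (simp add: y_def)
    next
      case False
      then have M\<tau>: "M \<le> \<tau>" using \<tau> by (simp add: M_def)
      have "cmod (Kd (1 / real m) y) \<le> 1 / M"
        unfolding M_def by (rule norm_Kd_le) (use m in simp)
      moreover have "cmod (Kd \<tau> y) \<le> 1 / max (cmod y) \<tau>"
        by (rule norm_Kd_le) (use \<tau> in simp)
      moreover have "1 / max (cmod y) \<tau> \<le> 1 / M"
        using M M\<tau> False \<tau> by (intro divide_left_mono) auto
      ultimately have "cmod (Kd (1 / real m) y - Kd \<tau> y) \<le> 2 * (1 / M)"
        using norm_triangle_ineq4[of "Kd (1 / real m) y" "Kd \<tau> y"] by linarith
      also have "1 / M = M * (1 / M\<^sup>2)" using M by (simp add: power2_eq_square)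
      also have "\<dots> \<le> \<tau> * (1 / M\<^sup>2)" using M\<tau> by (intro mult_right_mono) auto
      finally show ?thesis by (simp add: y_def[symmetric] M_def[symmetric])
    qed
  qed
  also have "\<dots> \<le> 2 * \<tau> * (17 * (real m)\<^sup>2 * (1 + ln (real m)))"
    unfolding sum_distrib_left[symmetric] using \<tau> m by (intro mult_left_mono disc_lattice_sum_le) auto
  also have "\<dots> \<le> 2 * \<tau> * (17 * (6 * k) * (1 + ln (real m)))"
    using k(1) \<tau> m by (intro mult_left_mono mult_right_mono) auto
  \<comment> \<open>One of the three factors h of \<tau> pays for the logarithm: ln m = 9 ln (1/h)
    \<le> 9 (1/h - 1), so h (1 + ln m) \<le> 10.\<close>
  also have "\<dots> \<le> 2 * h\<^sup>2 * (17 * (6 * k) * 10)"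
  proof -
    have "ln (real m) = 9 * ln (1 / h)"
      using m by (simp add: h ln_div ln_powr)
    moreover have "ln (1 / h) \<le> 1 / h - 1" using h0 by (intro ln_le_minus_one) auto
    ultimately have "1 + ln (real m) \<le> 10 / h" using h0 h1 by (simp add: field_simps)
    then have "h * (1 + ln (real m)) \<le> 10" using h0 by (simp add: field_simps)
    then have "2 * h\<^sup>2 * (17 * (6 * k)) * (h * (1 + ln (real m))) \<le> 2 * h\<^sup>2 * (17 * (6 * k)) * 10"
      using k by (intro mult_left_mono) auto
    then show ?thesis by (simp add: \<tau>_def power2_eq_square power3_eq_cube mult_ac)
  qed
  also have "\<dots> \<le> 2040 * h * k"
    using hp[of 2] k by simp
  finally have e1: "cmod ((\<Sum>x\<in>disc_lattice m. Kd (1 / real m) (\<zeta> - x)) - (\<Sum>x\<in>disc_lattice m. Kd \<tau> (\<zeta> - x))) \<le> 2040 * h * k" .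
  define X where "X = of_real (l\<^sup>2) * (\<Sum>x\<in>disc_lattice m. Kd \<tau> (\<zeta> - x))"
  have Kb: "cmod (Kd \<tau> z) \<le> 1 / \<tau>" for z
    by (rule order_trans[OF norm_Kd_le[OF \<tau>(1)]]) (use \<tau> in \<open>auto intro!: divide_left_mono mult_pos_pos simp: max_def\<close>)
  have "cmod (X - (LINT y:ball 0 1|lborel. Kd \<tau> (\<zeta> - y))) \<le> pi * l * (1 / \<tau>\<^sup>2 + 12 * (1 / \<tau>))"
    unfolding X_def
  proof (rule disc_lattice_Riemann_sum)
    show "continuous_on UNIV (\<lambda>y. Kd \<tau> (\<zeta> - y))"
      using \<tau> by (intro continuous_on_Kd continuous_intros)
    show "cmod (Kd \<tau> (\<zeta> - y) - Kd \<tau> (\<zeta> - z)) \<le> 1 / \<tau>\<^sup>2 * cmod (y - z)" for y z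
    proof -
      have "\<tau> * \<tau> \<le> max (cmod (\<zeta> - y)) \<tau> * max (cmod (\<zeta> - z)) \<tau>"
        using \<tau> by (intro mult_mono) auto
      then have "cmod ((\<zeta> - y) - (\<zeta> - z)) / (max (cmod (\<zeta> - y)) \<tau> * max (cmod (\<zeta> - z)) \<tau>)
          \<le> cmod ((\<zeta> - y) - (\<zeta> - z)) / (\<tau> * \<tau>)"
        using \<tau> by (intro divide_left_mono mult_pos_pos) auto
      with Kd_diff_le[OF \<tau>(1), of "\<zeta> - y" "\<zeta> - z"] show ?thesis
        by (simp add: norm_minus_commute power2_eq_square)
    qed
  qed (use m Kb in \<open>auto simp: l_def\<close>)
  also have "\<dots> = pi * (3 * h ^ 3 + 36 * h ^ 6)"
  proof -
    have e: "h ^ 9 = \<tau> * \<tau> * \<tau>" "h ^ 6 = \<tau> * \<tau>" "h ^ 3 = \<tau>"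
      by (simp_all add: \<tau>_def flip: power_add)
    show ?thesis
      unfolding lh e power2_eq_square using \<tau>(1) by (simp add: distrib_left)
  qed
  also have "\<dots> \<le> pi * (3 * h + 36 * h)"
    using hp[of 3] hp[of 6] by (intro mult_left_mono) auto
  finally have e2: "cmod (X - (LINT y:ball 0 1|lborel. Kd \<tau> (\<zeta> - y))) \<le> 39 * pi * h" by simp
  have e3: "cmod ((LINT y:ball 0 1|lborel. Kd \<tau> (\<zeta> - y)) - pi * Kd 1 \<zeta>) \<le> 11 * pi * h"
    unfolding \<tau>_def using h0 h1 by (rule disc_integral_Kd)
  have K1: "cmod (Kd 1 \<zeta>) \<le> 1"
    by (rule order_trans[OF norm_Kd_le]) (auto simp: max_def divide_simps)
  have "cmod (of_real (pi - l\<^sup>2 * k) * Kd 1 \<zeta>) \<le> 12 * pi * l * 1"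
    unfolding norm_mult norm_of_real using k K1 by (intro mult_mono) (auto simp: abs_minus_commute lh h0 less_imp_le)
  also have "\<dots> \<le> 36 * pi * h" using hp[of 9] by (simp add: lh)
  finally have e4: "cmod (of_real (pi - l\<^sup>2 * k) * Kd 1 \<zeta>) \<le> 36 * pi * h" .
  have "cmod (X - of_real (l\<^sup>2 * k) * Kd 1 \<zeta>) \<le> 86 * pi * h"
  proof -
    have "X - of_real (l\<^sup>2 * k) * Kd 1 \<zeta> = (X - (LINT y:ball 0 1|lborel. Kd \<tau> (\<zeta> - y)))
        + ((LINT y:ball 0 1|lborel. Kd \<tau> (\<zeta> - y)) - pi * Kd 1 \<zeta>) + of_real (pi - l\<^sup>2 * k) * Kd 1 \<zeta>"
      by (simp add: algebra_simps)
    also have "cmod \<dots> \<le> 39 * pi * h + 11 * pi * h + 36 * pi * h"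
      by (intro norm_triangle_le add_mono e2 e3 e4)
    finally show ?thesis by simp
  qed
  moreover have "X - of_real (l\<^sup>2 * k) * Kd 1 \<zeta>
     = of_real (l\<^sup>2 * k) * ((\<Sum>x\<in>disc_lattice m. Kd \<tau> (\<zeta> - x)) / of_real k - Kd 1 \<zeta>)"
    using k by (simp add: X_def right_diff_distrib)
  ultimately have "(l\<^sup>2 * k) * cmod ((\<Sum>x\<in>disc_lattice m. Kd \<tau> (\<zeta> - x)) / of_real k - Kd 1 \<zeta>) \<le> 86 * pi * h"
    using k by (simp add: norm_mult del: of_real_mult)
  moreover have "1 * cmod ((\<Sum>x\<in>disc_lattice m. Kd \<tau> (\<zeta> - x)) / of_real k - Kd 1 \<zeta>)
      \<le> (l\<^sup>2 * k) * cmod ((\<Sum>x\<in>disc_lattice m. Kd \<tau> (\<zeta> - x)) / of_real k - Kd 1 \<zeta>)"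
    using lk by (intro mult_right_mono) auto
  moreover have "pi * h \<le> 4 * h" using pi_less_4 h0 by simp
  ultimately have e5: "cmod ((\<Sum>x\<in>disc_lattice m. Kd \<tau> (\<zeta> - x)) / of_real k - Kd 1 \<zeta>) \<le> 344 * h" by linarith
  have "cmod (((\<Sum>x\<in>disc_lattice m. Kd (1 / real m) (\<zeta> - x)) - (\<Sum>x\<in>disc_lattice m. Kd \<tau> (\<zeta> - x))) / of_real k) \<le> 2040 * h"
    using e1 k by (simp add: norm_divide field_simps)
  from norm_triangle_le[OF add_mono[OF this e5]] show ?thesis
    using h0 by (simp add: k_def diff_divide_distrib)
qed

section \<open>One step of the construction\<close>

definition scaled_lattice :: "real \<Rightarrow> nat \<Rightarrow> complex set" where
  "scaled_lattice d m = (\<lambda>x. complex_of_real d * x) ` disc_lattice m"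

lemma inj_on_scale: "d > 0 \<Longrightarrow> inj_on (\<lambda>x. complex_of_real d * x) S"
  by (auto simp: inj_on_def)

lemma card_scaled_lattice: "d > 0 \<Longrightarrow> card (scaled_lattice d m) = card (disc_lattice m)"
  unfolding scaled_lattice_def by (intro card_image inj_on_scale)

lemma card_scaled_lattice_ge:
  "d > 0 \<Longrightarrow> m \<ge> 72 \<Longrightarrow> (real m)\<^sup>2 / 6 \<le> real (card (scaled_lattice d m))"
  using card_disc_lattice_approx(2)[of m] by (simp add: card_scaled_lattice)

text \<open>Dividing a sum of order m^2 log m by the number of points leaves log m; 102 is 17 times
  the 6 of the bound card \<ge> m^2/6.\<close>

lemma scaled_lattice_average_inverse_square:
  assumes d: "d > 0" and m: "m \<ge> 72" and l: "l = d / real m"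
  shows "(\<Sum>\<sigma>\<in>scaled_lattice d m. 1 / (max (cmod (P - \<sigma>)) l)\<^sup>2) / real (card (scaled_lattice d m))
     \<le> 102 / d\<^sup>2 * (1 + ln (real m))"
proof -
  define k where "k = real (card (scaled_lattice d m))"
  have k: "(real m)\<^sup>2 / 6 \<le> k" unfolding k_def using d m by (rule card_scaled_lattice_ge)
  have k0: "k > 0" using m by (intro less_le_trans[OF _ k]) simp
  have "1 / (max (cmod (P - of_real d * x)) l)\<^sup>2
      = 1 / d\<^sup>2 * (1 / (max (cmod (P / of_real d - x)) (1 / real m))\<^sup>2)" for x
  proof -
    have "P - of_real d * x = of_real d * (P / of_real d - x)" using d by (simp add: right_diff_distrib)
    then have "cmod (P - of_real d * x) = d * cmod (P / of_real d - x)"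
      using d by (simp add: norm_mult)
    moreover have "l = d * (1 / real m)" by (simp add: l)
    ultimately have "max (cmod (P - of_real d * x)) l = d * max (cmod (P / of_real d - x)) (1 / real m)"
      using d by (simp only: max_mult_distrib_left) simp
    then show ?thesis by (simp add: power_mult_distrib)
  qed
  then have "(\<Sum>\<sigma>\<in>scaled_lattice d m. 1 / (max (cmod (P - \<sigma>)) l)\<^sup>2)
      = 1 / d\<^sup>2 * (\<Sum>x\<in>disc_lattice m. 1 / (max (cmod (P / of_real d - x)) (1 / real m))\<^sup>2)"
    using d by (simp add: scaled_lattice_def sum.reindex inj_on_scale sum_distrib_left)
  also have "\<dots> \<le> 1 / d\<^sup>2 * (17 * (real m)\<^sup>2 * (1 + ln (real m)))"
    using m by (intro mult_left_mono disc_lattice_sum_le) auto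
  also have "\<dots> \<le> 1 / d\<^sup>2 * (17 * (6 * k) * (1 + ln (real m)))"
    using k m by (intro mult_left_mono mult_right_mono) auto
  finally show ?thesis
    using k0 by (simp add: k_def[symmetric] pos_divide_le_eq mult_ac)
qed

lemma scaled_lattice_average_Kd:
  assumes d: "d > 0" and m: "m \<ge> 72" and h: "h = real m powr (-1/9)" and l: "l = d / real m"
  shows "cmod ((\<Sum>\<sigma>\<in>scaled_lattice d m. Kd l (P - \<sigma>)) / of_nat (card (scaled_lattice d m)) - Kd d P)
     \<le> 3000 * h / d"
proof -
  define \<zeta> where "\<zeta> = P / of_real d"
  have P: "P = of_real d * \<zeta>" using d by (simp add: \<zeta>_def)
  have K1: "Kd d P = Kd 1 \<zeta> / of_real d"
    using Kd_scale[OF d, of 1 \<zeta>] by (simp add: P)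
  have K2: "Kd l (P - of_real d * x) = Kd (1 / real m) (\<zeta> - x) / of_real d" for x
  proof -
    have "P - of_real d * x = of_real d * (\<zeta> - x)" by (simp add: P right_diff_distrib)
    moreover have "l = d * (1 / real m)" by (simp add: l)
    ultimately show ?thesis by (simp only: Kd_scale[OF d])
  qed
  have "(\<Sum>\<sigma>\<in>scaled_lattice d m. Kd l (P - \<sigma>)) / of_nat (card (scaled_lattice d m)) - Kd d P
     = ((\<Sum>x\<in>disc_lattice m. Kd (1 / real m) (\<zeta> - x)) / of_nat (card (disc_lattice m)) - Kd 1 \<zeta>) / of_real d"
    unfolding card_scaled_lattice[OF d]
    unfolding scaled_lattice_def sum.reindex[OF inj_on_scale[OF d]] comp_def K1 K2
    by (simp add: diff_divide_distrib sum_divide_distrib[symmetric] mult.commute)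
  moreover have "cmod \<dots> \<le> 3000 * h / d"
    unfolding norm_divide using disc_lattice_average[OF m h, of \<zeta>] d by (simp add: divide_right_mono)
  ultimately show ?thesis by simp
qed

text \<open>The polynomial of the next level as a function of the values of the current polynomial
  and of the affine form at one point. The estimates of one step thus concern complex numbers
  only.\<close>

definition branch :: "real \<Rightarrow> nat \<Rightarrow> complex \<Rightarrow> complex \<Rightarrow> complex \<Rightarrow> complex" where
  "branch d m P A \<sigma> = (P - \<sigma>)\<^sup>2 - of_real (d\<^sup>2 / (2 * (real m)\<^sup>2)) * A"

text \<open>The weight \<open>1/2\<close> per level cancels the factor \<open>2\<close> in the derivative
  \<open>2 (P - \<sigma>) P' - \<epsilon> A'\<close> of the new branch, whence \<open>\<epsilon> / 2 = d\<^sup>2 / (4 m\<^sup>2)\<close> below.\<close>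

definition grad_diff :: "real \<Rightarrow> real \<Rightarrow> nat \<Rightarrow> complex \<Rightarrow> complex \<Rightarrow> complex \<Rightarrow> complex \<Rightarrow> complex" where
  "grad_diff d r m P A P' A' =
     (\<Sum>\<sigma>\<in>scaled_lattice d m. Kd (d\<^sup>2 * r / (4 * (real m)\<^sup>2)) (branch d m P A \<sigma>)
        * ((P - \<sigma>) * P' - of_real (d\<^sup>2 / (4 * (real m)\<^sup>2)) * A')) / of_nat (card (scaled_lattice d m))
     - Kd d P * P'"

text \<open>Here d, r and D stand for delta_n, r_{n+1} and a C^{1,1} bound of the polynomials of
  level n, all known before m; l is the radius of the sets X^int around the new centres.\<close>

locale lattice_step =
  fixes d r D :: real and m :: nat and h l :: real
  assumes d: "0 < d" "d \<le> 1" and r: "0 < r" "r \<le> 1" and D: "1 \<le> D" and m: "m \<ge> 72"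
  defines "h \<equiv> real m powr (-1/9)" and "l \<equiv> d / real m"
begin

definition d' :: real where "d' = d\<^sup>2 * r / (4 * (real m)\<^sup>2)"

lemma l_pos: "0 < l" "l \<le> 1" "l \<le> d"
proof -
  show "0 < l" using d m by (simp add: l_def)
  show "l \<le> d" using d m by (simp add: l_def field_simps)
  then show "l \<le> 1" using d by simp
qed

lemma d'_eq: "d' = l\<^sup>2 * r / 4" "0 < d'"
  using d r m by (simp_all add: d'_def l_def power_divide)

lemma branch_eq: "branch d m P A \<sigma> = (P - \<sigma>)\<^sup>2 - of_real (l\<^sup>2 / 2) * A"
  by (simp add: branch_def l_def power_divide mult.commute)

text \<open>The perturbation epsilon A has modulus at most epsilon = l^2/2, hence at most half of |P
  - \<sigma>|^2 once |P - \<sigma>| \<ge> l.\<close>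

lemma norm_branch_ge:
  assumes "cmod A \<le> 1" "l \<le> cmod (P - \<sigma>)"
  shows "(cmod (P - \<sigma>))\<^sup>2 / 2 \<le> cmod (branch d m P A \<sigma>)"
proof -
  have "cmod (of_real (l\<^sup>2 / 2) * A) \<le> l\<^sup>2 / 2 * 1"
    unfolding norm_mult norm_of_real using assms by (intro mult_mono) auto
  also have "\<dots> \<le> (cmod (P - \<sigma>))\<^sup>2 / 2"
    using assms l_pos by (simp add: power_mono)
  finally show ?thesis
    using norm_triangle_ineq2[of "(P - \<sigma>)\<^sup>2" "of_real (l\<^sup>2 / 2) * A"]
    unfolding branch_eq norm_power by linarith
qed

text \<open>Away from the centre this is the previous bound; within distance l of it the truncation
  takes over, because \<open>d'\<close> is exactly (r/4) l^2. Powers of 1/r in the constants start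
  here.\<close>

lemma max_norm_branch_ge:
  assumes "cmod A \<le> 1"
  shows "r / 4 * (max (cmod (P - \<sigma>)) l)\<^sup>2 \<le> max (cmod (branch d m P A \<sigma>)) d'"
proof (cases "l \<le> cmod (P - \<sigma>)")
  case True
  have "r / 4 * (cmod (P - \<sigma>))\<^sup>2 \<le> 1 / 2 * (cmod (P - \<sigma>))\<^sup>2"
    using r by (intro mult_right_mono) auto
  then show ?thesis using norm_branch_ge[OF assms True] True by (simp add: max_def)
next
  case False
  then show ?thesis by (simp add: d'_eq max_def mult.commute)
qed

lemma norm_Kd_branch_le:
  assumes "cmod A \<le> 1"
  shows "cmod (Kd d' (branch d m P A \<sigma>)) \<le> 4 / r * (1 / (max (cmod (P - \<sigma>)) l)\<^sup>2)"
proof -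
  have "0 < max (cmod (P - \<sigma>)) l" using l_pos by (simp add: less_max_iff_disj)
  then have p: "0 < r / 4 * (max (cmod (P - \<sigma>)) l)\<^sup>2" using r by simp
  have "cmod (Kd d' (branch d m P A \<sigma>)) \<le> 1 / max (cmod (branch d m P A \<sigma>)) d'"
    by (rule norm_Kd_le[OF d'_eq(2)])
  also have "\<dots> \<le> 1 / (r / 4 * (max (cmod (P - \<sigma>)) l)\<^sup>2)"
    using max_norm_branch_ge[OF assms, of P \<sigma>] p by (intro divide_left_mono mult_pos_pos) (use r in \<open>auto simp: less_max_iff_disj d'_eq(2)\<close>)
  finally show ?thesis using r by simp
qed

text \<open>Away from the centre, with y = P - \<sigma> and Q the branch, y/Q - 1/y = (y^2 - Q)/(Q
  y) is of order l^2/|y|^3, at most l/|y|^2. Near it both terms are O(1/l), with a constant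
  depending on r. After averaging, this is l log m, which is small.\<close>

lemma norm_Kd_branch_mult_diff_le:
  assumes A: "cmod A \<le> 1"
  shows "cmod (Kd d' (branch d m P A \<sigma>) * (P - \<sigma>) - Kd l (P - \<sigma>)) \<le> (4 / r + 1) * l * (1 / (max (cmod (P - \<sigma>)) l)\<^sup>2)"
proof (cases "l \<le> cmod (P - \<sigma>)")
  case True
  define y Q where "y = P - \<sigma>" and "Q = branch d m P A \<sigma>"
  have y: "l \<le> cmod y" "y \<noteq> 0" using True l_pos by (auto simp: y_def)
  have Q2: "(cmod y)\<^sup>2 / 2 \<le> cmod Q" unfolding y_def Q_def by (rule norm_branch_ge[OF A True])
  have Q0: "0 < cmod Q" using y by (intro less_le_trans[OF _ Q2]) simp
  have "d' \<le> l\<^sup>2 / 2" using r l_pos by (simp add: d'_eq mult_left_le)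
  also have "\<dots> \<le> cmod Q" using y l_pos by (intro order_trans[OF _ Q2]) (simp add: power_mono)
  finally have K: "Kd d' Q = 1 / Q" using d'_eq by (intro Kd_outside)
  have "Kd d' Q * y - Kd l y = of_real (l\<^sup>2 / 2) * A / (Q * y)"
  proof -
    have "y\<^sup>2 - Q = of_real (l\<^sup>2 / 2) * A" by (simp add: Q_def y_def branch_eq)
    moreover have "1 / Q * y - 1 / y = (y\<^sup>2 - Q) / (Q * y)"
      using y Q0 by (auto simp: field_simps power2_eq_square)
    moreover have "Kd d' Q * y - Kd l y = 1 / Q * y - 1 / y"
      using y l_pos by (simp add: K Kd_outside)
    ultimately show ?thesis by metis
  qed
  then have "cmod (Kd d' Q * y - Kd l y) = l\<^sup>2 / 2 * cmod A / (cmod Q * cmod y)"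
    by (simp add: norm_mult norm_divide norm_power)
  also have "\<dots> \<le> l\<^sup>2 / 2 * 1 / ((cmod y)\<^sup>2 / 2 * l)"
    using A Q2 y l_pos by (intro frac_le mult_mono mult_nonneg_nonneg mult_pos_pos) auto
  also have "\<dots> = l * (1 / (cmod y)\<^sup>2)"
    using l_pos by (simp add: power2_eq_square)
  also have "\<dots> \<le> (4 / r + 1) * (l * (1 / (cmod y)\<^sup>2))"
    using r l_pos mult_right_mono[of 1 "4 / r + 1" "l * (1 / (cmod y)\<^sup>2)"] by simp
  finally show ?thesis using True by (simp add: y_def Q_def max_def mult_ac)
next
  case False
  have "cmod (Kd d' (branch d m P A \<sigma>) * (P - \<sigma>)) \<le> 4 / r * (1 / l\<^sup>2) * l"
    unfolding norm_mult using norm_Kd_branch_le[OF A, of P \<sigma>] False r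
    by (intro mult_mono) (auto simp: max_def)
  moreover have "cmod (Kd l (P - \<sigma>)) \<le> 1 * (1 / l\<^sup>2) * l"
    using norm_Kd_le[OF l_pos(1), of "P - \<sigma>"] False l_pos by (simp add: max_def power2_eq_square)
  ultimately have "cmod (Kd d' (branch d m P A \<sigma>) * (P - \<sigma>) - Kd l (P - \<sigma>)) \<le> 4 / r * (1 / l\<^sup>2) * l + 1 * (1 / l\<^sup>2) * l"
    by (rule order_trans[OF norm_triangle_ineq4 add_mono])
  also have "\<dots> = (4 / r + 1) * l * (1 / l\<^sup>2)"
  proof -
    have "a * x * l + 1 * x * l = (a + 1) * l * x" for a x by (simp add: algebra_simps)
    then show ?thesis .
  qed
  finally show ?thesis using False by (simp add: max_def)
qed

definition k :: real where "k = real (card (scaled_lattice d m))"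

lemma k_pos: "k > 0"
  using card_scaled_lattice_ge[OF d(1) m] m less_le_trans[of 0 "(real m)\<^sup>2 / 6" k] by (simp add: k_def)

lemma average_inverse_square_le: "(\<Sum>\<sigma>\<in>scaled_lattice d m. 1 / (max (cmod (P - \<sigma>)) l)\<^sup>2) / k \<le> 102 / d\<^sup>2 * (1 + ln (real m))"
  unfolding k_def by (rule scaled_lattice_average_inverse_square) (use d m in \<open>auto simp: l_def\<close>)

lemma h_bounds: "0 < h" "h \<le> 1" "1 + ln (real m) \<ge> 1" "l * (1 + ln (real m)) \<le> 10 * d * h"
proof -
  show h0: "0 < h" using m by (simp add: h_def)
  have "real m powr (-1/9) \<le> real m powr 0" using m by (intro powr_mono) auto
  then show h1: "h \<le> 1" using m by (simp add: h_def)
  show "1 + ln (real m) \<ge> 1" using m by simp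
  have "h ^ 9 = h powr real 9" using h0 by (rule powr_realpow[symmetric])
  also have "\<dots> = real m powr - 1" by (simp add: h_def powr_powr)
  finally have h9: "h ^ 9 = 1 / real m" using m by (simp add: powr_minus_divide)
  have "ln (real m) = 9 * ln (1 / h)" using m by (simp add: h_def ln_div ln_powr)
  moreover have "ln (1 / h) \<le> 1 / h - 1" using h0 by (intro ln_le_minus_one) auto
  ultimately have "1 + ln (real m) \<le> 10 / h" using h0 h1 by (simp add: field_simps)
  then have "d * h ^ 9 * (1 + ln (real m)) \<le> d * h ^ 9 * (10 / h)"
    using d h0 by (intro mult_left_mono) auto
  also have "\<dots> = 10 * d * h ^ 8" using h0 by (simp add: power_Suc[symmetric] field_simps eval_nat_numeral)
  also have "\<dots> \<le> 10 * d * h" using d h0 h1 power_decreasing[of 1 8 h] by (intro mult_left_mono) auto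
  finally show "l * (1 + ln (real m)) \<le> 10 * d * h" by (simp add: l_def h9)
qed

text \<open>One constant for both gradient bounds, rounded up from the numerical factors 10140 and
  28562 that they produce.\<close>

abbreviation C :: real where "C \<equiv> 40000 * D\<^sup>2 / (r\<^sup>2 * d\<^sup>2)"

lemma grad_diff_eq: "grad_diff d r m P A P' A' =
     (\<Sum>\<sigma>\<in>scaled_lattice d m. Kd d' (branch d m P A \<sigma>) * ((P - \<sigma>) * P' - of_real (l\<^sup>2 / 4) * A')) / of_real k
     - Kd d P * P'"
  by (simp add: grad_diff_def d'_def l_def power_divide k_def mult.commute)

text \<open>The error splits into \<open>X\<close>, the lattice average of kernels of radius l
  against the kernel of radius d; \<open>Y\<close>, the replacement of each branch by its leading
  square; and \<open>Z\<close>, the contribution of the derivative of epsilon A. \<open>X\<close> is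
  O(h/d) by the lattice average, while \<open>Y\<close> and l^2 \<open>Z\<close> are controlled by l
  (1 + ln m) \<le> 10 d h.\<close>

lemma norm_grad_diff_le:
  assumes A: "cmod A \<le> 1" and v: "\<nu> \<ge> 0" "cmod P' \<le> D * \<nu>" "cmod A' \<le> 2 * \<nu>"
  shows "cmod (grad_diff d r m P A P' A') \<le> C * h * \<nu>"
proof -
  define S where "S = scaled_lattice d m"
  define w where "w = (\<lambda>\<sigma>. 1 / (max (cmod (P - \<sigma>)) l)\<^sup>2)"
  define a where "a = sum w S / k"
  have a: "a \<le> 102 / d\<^sup>2 * (1 + ln (real m))"
    unfolding a_def w_def S_def by (rule average_inverse_square_le)
  have la: "l * a \<le> 1020 * h / d"
  proof -
    have "l * a \<le> 102 / d\<^sup>2 * (l * (1 + ln (real m)))"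
      using mult_left_mono[OF a, of l] l_pos by (simp add: mult_ac)
    also have "\<dots> \<le> 102 / d\<^sup>2 * (10 * d * h)" using h_bounds(4) by (intro mult_left_mono) auto
    also have "\<dots> = 1020 * h / d" using d by (simp add: power2_eq_square)
    finally show ?thesis .
  qed
  define X Y Z where "X = (\<Sum>\<sigma>\<in>S. Kd l (P - \<sigma>)) / of_real k - Kd d P"
    and "Y = (\<Sum>\<sigma>\<in>S. Kd d' (branch d m P A \<sigma>) * (P - \<sigma>) - Kd l (P - \<sigma>)) / of_real k"
    and "Z = (\<Sum>\<sigma>\<in>S. Kd d' (branch d m P A \<sigma>)) / of_real k"
  have X: "cmod X \<le> 3000 * h / d"
    unfolding X_def S_def k_def of_real_of_nat_eq
    by (rule scaled_lattice_average_Kd) (use d m in \<open>auto simp: l_def h_def\<close>)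
  have "cmod (\<Sum>\<sigma>\<in>S. Kd d' (branch d m P A \<sigma>) * (P - \<sigma>) - Kd l (P - \<sigma>)) \<le> (\<Sum>\<sigma>\<in>S. (4 / r + 1) * l * w \<sigma>)"
    unfolding w_def by (intro sum_norm_le norm_Kd_branch_mult_diff_le A)
  also have "\<dots> = (4 / r + 1) * l * a * k" unfolding sum_distrib_left[symmetric] using k_pos by (simp add: a_def)
  finally have "cmod Y \<le> (4 / r + 1) * (l * a)"
    unfolding Y_def using k_pos by (simp add: norm_divide pos_divide_le_eq mult_ac)
  also have "\<dots> \<le> (4 / r + 1) * (1020 * h / d)" using la r by (intro mult_left_mono) auto
  also have "\<dots> \<le> (5 / r) * (1020 * h / d)" using r d h_bounds by (intro mult_right_mono) (auto simp: field_simps)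
  finally have Y: "cmod Y \<le> (5 / r) * (1020 * h / d)" .
  have "cmod (\<Sum>\<sigma>\<in>S. Kd d' (branch d m P A \<sigma>)) \<le> (\<Sum>\<sigma>\<in>S. 4 / r * w \<sigma>)"
    unfolding w_def by (intro sum_norm_le norm_Kd_branch_le A)
  also have "\<dots> = 4 / r * a * k" unfolding sum_distrib_left[symmetric] using k_pos by (simp add: a_def)
  finally have Z: "cmod Z \<le> 4 / r * a"
    unfolding Z_def using k_pos by (simp add: norm_divide pos_divide_le_eq)
  have "l\<^sup>2 * cmod Z \<le> l\<^sup>2 * (4 / r * a)" using Z by (intro mult_left_mono) auto
  also have "\<dots> = l * 4 / r * (l * a)" by (simp add: power2_eq_square)
  also have "\<dots> \<le> l * 4 / r * (1020 * h / d)" using la l_pos r by (intro mult_left_mono) auto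
  also have "\<dots> \<le> d * 4 / r * (1020 * h / d)" using l_pos r h_bounds d by (intro mult_right_mono divide_right_mono) auto
  also have "\<dots> = 4080 * h / r" using d by simp
  finally have Z2: "l\<^sup>2 * cmod Z \<le> 4080 * h / r" .
  have "grad_diff d r m P A P' A' = (X + Y) * P' - of_real (l\<^sup>2 / 4) * Z * A'"
  proof -
    have "(\<Sum>\<sigma>\<in>S. Kd d' (branch d m P A \<sigma>) * ((P - \<sigma>) * P' - of_real (l\<^sup>2 / 4) * A'))
       = (\<Sum>\<sigma>\<in>S. Kd l (P - \<sigma>) * P' + (Kd d' (branch d m P A \<sigma>) * (P - \<sigma>) - Kd l (P - \<sigma>)) * P'
            - of_real (l\<^sup>2 / 4) * A' * Kd d' (branch d m P A \<sigma>))"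
      by (intro sum.cong refl) (simp add: algebra_simps)
    also have "\<dots> = (\<Sum>\<sigma>\<in>S. Kd l (P - \<sigma>)) * P'
         + (\<Sum>\<sigma>\<in>S. Kd d' (branch d m P A \<sigma>) * (P - \<sigma>) - Kd l (P - \<sigma>)) * P'
         - of_real (l\<^sup>2 / 4) * A' * (\<Sum>\<sigma>\<in>S. Kd d' (branch d m P A \<sigma>))"
      unfolding sum_distrib_left sum_distrib_right sum.distrib[symmetric] sum_subtractf[symmetric] ..
    finally have sum: "(\<Sum>\<sigma>\<in>S. Kd d' (branch d m P A \<sigma>) * ((P - \<sigma>) * P' - of_real (l\<^sup>2 / 4) * A'))
      = (\<Sum>\<sigma>\<in>S. Kd l (P - \<sigma>)) * P'
         + (\<Sum>\<sigma>\<in>S. Kd d' (branch d m P A \<sigma>) * (P - \<sigma>) - Kd l (P - \<sigma>)) * P'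
         - of_real (l\<^sup>2 / 4) * A' * (\<Sum>\<sigma>\<in>S. Kd d' (branch d m P A \<sigma>))" .
    have "(x * P' + y * P' - c * A' * z) / q - K * P' = (x / q - K + y / q) * P' - c * (z / q) * A'"
      for x y z c K q :: complex
      by (simp add: add_divide_distrib diff_divide_distrib algebra_simps)
    then show ?thesis
      unfolding grad_diff_eq X_def Y_def Z_def S_def[symmetric] sum .
  qed
  also have "cmod \<dots> \<le> (3000 * h / d + (5 / r) * (1020 * h / d)) * (D * \<nu>) + (4080 * h / r) / 4 * (2 * \<nu>)"
  proof (intro norm_triangle_le_diff add_mono)
    show "cmod ((X + Y) * P') \<le> (3000 * h / d + (5 / r) * (1020 * h / d)) * (D * \<nu>)"
      unfolding norm_mult using X Y v d r h_bounds
      by (intro mult_mono norm_triangle_le add_mono) auto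
    have "cmod (of_real (l\<^sup>2 / 4) * Z * A') = (l\<^sup>2 * cmod Z) / 4 * cmod A'"
      by (simp add: norm_mult norm_power norm_divide)
    also have "\<dots> \<le> (4080 * h / r) / 4 * (2 * \<nu>)"
      using Z2 v r h_bounds by (intro mult_mono divide_right_mono) auto
    finally show "cmod (of_real (l\<^sup>2 / 4) * Z * A') \<le> (4080 * h / r) / 4 * (2 * \<nu>)" .
  qed
  also have "\<dots> = (3000 * (D / d) + 5100 * (D / (r * d)) + 2040 * (1 / r)) * (h * \<nu>)"
    by (simp add: field_simps)
  also have "\<dots> \<le> (3000 * (D\<^sup>2 / (r\<^sup>2 * d\<^sup>2)) + 5100 * (D\<^sup>2 / (r\<^sup>2 * d\<^sup>2)) + 2040 * (D\<^sup>2 / (r\<^sup>2 * d\<^sup>2))) * (h * \<nu>)"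
  proof -
    have D2: "D \<le> D\<^sup>2" "1 \<le> D\<^sup>2" using D by (auto simp: power2_eq_square mult_ge1_I intro: order_trans[of 1 D])
    have dd: "d\<^sup>2 \<le> d" "d\<^sup>2 \<le> 1" "0 < d\<^sup>2" using d by (auto simp: power2_eq_square mult_left_le mult_le_one)
    have rr: "r\<^sup>2 \<le> r" "r\<^sup>2 \<le> 1" "0 < r\<^sup>2" using r by (auto simp: power2_eq_square mult_left_le mult_le_one)
    have "D / d \<le> D\<^sup>2 / (r\<^sup>2 * d\<^sup>2)"
      using D2 mult_mono[OF rr(2) dd(1)] dd rr d D by (intro frac_le) auto
    moreover have "D / (r * d) \<le> D\<^sup>2 / (r\<^sup>2 * d\<^sup>2)"
      using D2 mult_mono[OF rr(1) dd(1)] dd rr d r D by (intro frac_le) auto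
    moreover have "1 / r \<le> D\<^sup>2 / (r\<^sup>2 * d\<^sup>2)"
      using D2 mult_mono[OF rr(1) dd(2)] dd rr d r D by (intro frac_le) auto
    ultimately show ?thesis
      using h_bounds v by (intro mult_right_mono add_mono mult_left_mono) auto
  qed
  also have "\<dots> = 10140 * (D\<^sup>2 / (r\<^sup>2 * d\<^sup>2)) * (h * \<nu>)" by (simp add: algebra_simps)
  also have "\<dots> \<le> 40000 * (D\<^sup>2 / (r\<^sup>2 * d\<^sup>2)) * (h * \<nu>)"
    using h_bounds v by (intro mult_right_mono) auto
  finally show ?thesis by simp
qed

text \<open>Each summand is a kernel times a linear factor. With M and N the truncated distances of
  the two points to \<sigma>, the kernels differ by order t (M + N)/(M^2 N^2) and the linear factor
  is O(M), so every summand is Lipschitz with constant of order 1/M^2 + 1/N^2, whose average is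
  O(log m). One \<open>A'\<close> serves both points because the form is affine.\<close>

lemma grad_diff_Lipschitz:
  assumes A: "cmod A1 \<le> 1" "cmod A2 \<le> 1" and t: "t \<ge> 0" "cmod (A1 - A2) \<le> 2 * t"
    and P: "cmod P2 \<le> D" "cmod (P1 - P2) \<le> D * t"
    and v: "\<nu> \<ge> 0" "cmod P1' \<le> D * \<nu>" "cmod P2' \<le> D * \<nu>" "cmod (P1' - P2') \<le> D * t * \<nu>" "cmod A' \<le> 2 * \<nu>"
  shows "cmod (grad_diff d r m P1 A1 P1' A' - grad_diff d r m P2 A2 P2' A') \<le> C * (1 + ln (real m)) * t * \<nu>"
proof -
  define S where "S = scaled_lattice d m"
  define M1 M2 where "M1 = (\<lambda>\<sigma>. max (cmod (P1 - \<sigma>)) l)" and "M2 = (\<lambda>\<sigma>. max (cmod (P2 - \<sigma>)) l)"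
  define T where "T = (\<lambda>P A P' \<sigma>. Kd d' (branch d m P A \<sigma>) * ((P - \<sigma>) * P' - of_real (l\<^sup>2 / 4) * A'))"
  define c where "c = 140 * D\<^sup>2 / r\<^sup>2 * t * \<nu>"
  have c0: "c \<ge> 0" using t v by (simp add: c_def)
  have S1: "cmod \<sigma> \<le> 1" if \<sigma>: "\<sigma> \<in> S" for \<sigma>
  proof -
    obtain x where x: "\<sigma> = of_real d * x" "cmod x \<le> 1 - 1 / real m"
      using \<sigma> by (auto simp: S_def scaled_lattice_def disc_lattice_def)
    then have "cmod x \<le> 1" using order_trans[of "cmod x" "1 - 1 / real m" 1] by simp
    then show ?thesis using d by (simp add: x norm_mult mult_le_one)
  qed
  have each: "cmod (T P1 A1 P1' \<sigma> - T P2 A2 P2' \<sigma>) \<le> c * (1 / (M1 \<sigma>)\<^sup>2 + 1 / (M2 \<sigma>)\<^sup>2)" if "\<sigma> \<in> S" for \<sigma>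
  proof -
    define M N where "M = M1 \<sigma>" and "N = M2 \<sigma>"
    have MN: "l \<le> M" "l \<le> N" "cmod (P1 - \<sigma>) \<le> M" "cmod (P2 - \<sigma>) \<le> N"
      by (auto simp: M_def N_def M1_def M2_def)
    have MN0: "M > 0" "N > 0" using MN l_pos by linarith+
    have N2D: "N \<le> 2 * D"
      using P(1) S1[OF that] D l_pos norm_triangle_ineq4[of P2 \<sigma>] by (auto simp: N_def M2_def)
    have "l * l \<le> l * 1" using l_pos by (intro mult_left_mono) auto
    then have ll: "l\<^sup>2 \<le> M" using MN by (simp add: power2_eq_square)
    define Q1 Q2 where "Q1 = branch d m P1 A1 \<sigma>" and "Q2 = branch d m P2 A2 \<sigma>"
    have Q: "cmod (Q1 - Q2) \<le> 2 * D * t * (M + N)"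
    proof -
      have "Q1 - Q2 = (P1 - P2) * ((P1 - \<sigma>) + (P2 - \<sigma>)) - of_real (l\<^sup>2 / 2) * (A1 - A2)"
        unfolding Q1_def Q2_def branch_eq power2_eq_square[of "_ - _"] by (simp only: algebra_simps)
      also have "cmod \<dots> \<le> D * t * (M + N) + l\<^sup>2 / 2 * (2 * t)"
      proof (intro norm_triangle_le_diff add_mono)
        show "cmod ((P1 - P2) * ((P1 - \<sigma>) + (P2 - \<sigma>))) \<le> D * t * (M + N)"
          unfolding norm_mult using P MN D t by (intro mult_mono norm_triangle_le add_mono) auto
        show "cmod (of_real (l\<^sup>2 / 2) * (A1 - A2)) \<le> l\<^sup>2 / 2 * (2 * t)"
          unfolding norm_mult norm_of_real using t by (intro mult_mono) auto
      qed
      also have "l\<^sup>2 / 2 * (2 * t) \<le> (M + N) * t" using ll MN0 t by (simp add: mult_right_mono)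
      also have "(M + N) * t \<le> D * t * (M + N)"
        using D t MN0 mult_right_mono[of 1 D "t * (M + N)"] by (simp add: mult_ac)
      finally show ?thesis by simp
    qed
    have KQ: "cmod (Kd d' Q1 - Kd d' Q2) \<le> 2 * D * t * (M + N) / ((r / 4 * M\<^sup>2) * (r / 4 * N\<^sup>2))"
    proof -
      have "cmod (Kd d' Q1 - Kd d' Q2) \<le> cmod (Q1 - Q2) / (max (cmod Q1) d' * max (cmod Q2) d')"
        by (rule Kd_diff_le[OF d'_eq(2)])
      also have "\<dots> \<le> 2 * D * t * (M + N) / ((r / 4 * M\<^sup>2) * (r / 4 * N\<^sup>2))"
        using max_norm_branch_ge[OF A(1), of P1 \<sigma>] max_norm_branch_ge[OF A(2), of P2 \<sigma>] Q r MN0 D t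
        by (intro frac_le mult_mono mult_pos_pos)
          (auto simp: Q1_def Q2_def M_def N_def M1_def M2_def le_max_iff_disj)
      finally show ?thesis .
    qed
    have lin: "cmod ((P1 - \<sigma>) * P1' - of_real (l\<^sup>2 / 4) * A') \<le> 2 * M * D * \<nu>"
    proof -
      have "cmod ((P1 - \<sigma>) * P1' - of_real (l\<^sup>2 / 4) * A') \<le> M * (D * \<nu>) + l\<^sup>2 / 4 * (2 * \<nu>)"
      proof (intro norm_triangle_le_diff add_mono)
        show "cmod ((P1 - \<sigma>) * P1') \<le> M * (D * \<nu>)"
          unfolding norm_mult using MN MN0 v by (intro mult_mono) auto
        show "cmod (of_real (l\<^sup>2 / 4) * A') \<le> l\<^sup>2 / 4 * (2 * \<nu>)"
          unfolding norm_mult norm_of_real using v by (intro mult_mono) auto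
      qed
      also have "l\<^sup>2 / 4 * (2 * \<nu>) = l\<^sup>2 / 2 * \<nu>" by simp
      also have "\<dots> \<le> M * \<nu>" using ll MN0 v by (intro mult_right_mono) auto
      also have "M * \<nu> \<le> M * (D * \<nu>)" using D v MN0 mult_right_mono[of 1 D \<nu>] by (intro mult_left_mono) auto
      finally show ?thesis by (simp add: mult_ac)
    qed
    have b1: "cmod ((Kd d' Q1 - Kd d' Q2) * ((P1 - \<sigma>) * P1' - of_real (l\<^sup>2 / 4) * A'))
        \<le> 128 * D\<^sup>2 / r\<^sup>2 * t * \<nu> * (1 / M\<^sup>2 + 1 / N\<^sup>2)"
    proof -
      have "cmod ((Kd d' Q1 - Kd d' Q2) * ((P1 - \<sigma>) * P1' - of_real (l\<^sup>2 / 4) * A'))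
          \<le> 2 * D * t * (M + N) / ((r / 4 * M\<^sup>2) * (r / 4 * N\<^sup>2)) * (2 * M * D * \<nu>)"
        unfolding norm_mult using KQ lin D t MN0 r by (intro mult_mono) auto
      also have "\<dots> = 64 * D\<^sup>2 / r\<^sup>2 * t * \<nu> * (1 / N\<^sup>2 + 1 / M * (1 / N))"
        using MN0 r by (simp add: power2_eq_square field_simps)
      \<comment> \<open>The mixed term 1/(M N) is split by the inequality of arithmetic and
        geometric means, so that each remaining term is a lattice sum centred at one of the two
        points.\<close>
      also have "\<dots> \<le> 64 * D\<^sup>2 / r\<^sup>2 * t * \<nu> * (2 * (1 / M\<^sup>2 + 1 / N\<^sup>2))"
      proof (intro mult_left_mono)
        have "0 \<le> (1 / M - 1 / N)\<^sup>2" by simp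
        then have "2 * (1 / M * (1 / N)) \<le> 1 / M\<^sup>2 + 1 / N\<^sup>2"
          by (simp add: power2_eq_square algebra_simps)
        moreover have "0 \<le> 1 / M\<^sup>2" "0 \<le> 1 / N\<^sup>2" by auto
        moreover have "x + q \<le> 2 * (y + x)" if "2 * q \<le> y + x" "0 \<le> y" "0 \<le> x" for x y q :: real
        proof -
          have "2 * (x + q) \<le> 2 * x + (y + x)" using that(1) by (simp add: distrib_left)
          also have "\<dots> \<le> 2 * (2 * (y + x))" using that by (simp add: distrib_left)
          finally show ?thesis by simp
        qed
        ultimately show "1 / N\<^sup>2 + 1 / M * (1 / N) \<le> 2 * (1 / M\<^sup>2 + 1 / N\<^sup>2)" by blast
      qed (use t v in auto)
      finally show ?thesis by (simp add: algebra_simps add_divide_distrib)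
    qed
    have b2: "cmod (Kd d' Q2 * ((P1 - P2) * P1' + (P2 - \<sigma>) * (P1' - P2'))) \<le> 12 * D\<^sup>2 / r\<^sup>2 * t * \<nu> * (1 / M\<^sup>2 + 1 / N\<^sup>2)"
    proof -
      have "cmod ((P1 - P2) * P1' + (P2 - \<sigma>) * (P1' - P2')) \<le> D * t * (D * \<nu>) + 2 * D * (D * t * \<nu>)"
      proof (intro norm_triangle_le add_mono)
        show "cmod ((P1 - P2) * P1') \<le> D * t * (D * \<nu>)"
          unfolding norm_mult using P v D t by (intro mult_mono) auto
        show "cmod ((P2 - \<sigma>) * (P1' - P2')) \<le> 2 * D * (D * t * \<nu>)"
          unfolding norm_mult using MN N2D v D t by (intro mult_mono) auto
      qed
      also have "\<dots> = 3 * D\<^sup>2 * t * \<nu>" by (simp add: power2_eq_square)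
      finally have "cmod (Kd d' Q2 * ((P1 - P2) * P1' + (P2 - \<sigma>) * (P1' - P2'))) \<le> 4 / r * (1 / N\<^sup>2) * (3 * D\<^sup>2 * t * \<nu>)"
        unfolding norm_mult using norm_Kd_branch_le[OF A(2), of P2 \<sigma>] r
        by (intro mult_mono) (auto simp: Q2_def N_def M2_def)
      also have "\<dots> = 12 * D\<^sup>2 * t * \<nu> * (1 / N\<^sup>2) * (1 / r)" by (simp add: mult_ac)
      also have "\<dots> \<le> 12 * D\<^sup>2 * t * \<nu> * (1 / M\<^sup>2 + 1 / N\<^sup>2) * (1 / r\<^sup>2)"
        using r t v by (intro mult_mono frac_le) (auto simp: power2_eq_square mult_left_le)
      finally show ?thesis by (simp add: mult_ac)
    qed
    have "T P1 A1 P1' \<sigma> - T P2 A2 P2' \<sigma> = (Kd d' Q1 - Kd d' Q2) * ((P1 - \<sigma>) * P1' - of_real (l\<^sup>2 / 4) * A')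
        + Kd d' Q2 * ((P1 - P2) * P1' + (P2 - \<sigma>) * (P1' - P2'))"
      by (simp add: T_def Q1_def Q2_def algebra_simps)
    also have "cmod \<dots> \<le> 128 * D\<^sup>2 / r\<^sup>2 * t * \<nu> * (1 / M\<^sup>2 + 1 / N\<^sup>2) + 12 * D\<^sup>2 / r\<^sup>2 * t * \<nu> * (1 / M\<^sup>2 + 1 / N\<^sup>2)"
      by (intro norm_triangle_le add_mono b1 b2)
    also have "\<dots> = c * (1 / M\<^sup>2 + 1 / N\<^sup>2)"
      unfolding c_def distrib_right[symmetric] add_divide_distrib[symmetric] by simp
    finally show ?thesis by (simp add: M_def N_def)
  qed
  have "cmod ((\<Sum>\<sigma>\<in>S. T P1 A1 P1' \<sigma>) - (\<Sum>\<sigma>\<in>S. T P2 A2 P2' \<sigma>)) \<le> (\<Sum>\<sigma>\<in>S. c * (1 / (M1 \<sigma>)\<^sup>2 + 1 / (M2 \<sigma>)\<^sup>2))"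
    unfolding sum_subtractf[symmetric] by (intro sum_norm_le each)
  also have "\<dots> = c * ((\<Sum>\<sigma>\<in>S. 1 / (M1 \<sigma>)\<^sup>2) / k + (\<Sum>\<sigma>\<in>S. 1 / (M2 \<sigma>)\<^sup>2) / k) * k"
    using k_pos by (simp add: sum_distrib_left[symmetric] sum.distrib distrib_right add_divide_distrib[symmetric])
  also have "\<dots> \<le> c * (102 / d\<^sup>2 * (1 + ln (real m)) + 102 / d\<^sup>2 * (1 + ln (real m))) * k"
    unfolding M1_def M2_def S_def using c0 k_pos
    by (intro mult_right_mono mult_left_mono add_mono average_inverse_square_le) auto
  finally have s: "cmod (((\<Sum>\<sigma>\<in>S. T P1 A1 P1' \<sigma>) - (\<Sum>\<sigma>\<in>S. T P2 A2 P2' \<sigma>)) / of_real k)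
      \<le> 204 * c / d\<^sup>2 * (1 + ln (real m))"
    using k_pos by (simp add: norm_divide pos_divide_le_eq mult_ac)
  have b3: "cmod (Kd d P1 * P1' - Kd d P2 * P2') \<le> 2 * D\<^sup>2 / d\<^sup>2 * t * \<nu>"
  proof -
    have "cmod (Kd d P1 - Kd d P2) \<le> cmod (P1 - P2) / (max (cmod P1) d * max (cmod P2) d)"
      by (rule Kd_diff_le[OF d(1)])
    also have "\<dots> \<le> D * t / (d * d)"
      using P d D t by (intro frac_le mult_mono) auto
    finally have K1: "cmod (Kd d P1 - Kd d P2) \<le> D * t / (d * d)" .
    have "cmod (Kd d P2) \<le> 1 / max (cmod P2) d" by (rule norm_Kd_le[OF d(1)])
    also have "\<dots> \<le> 1 / (d * d)" using d by (intro frac_le) (auto simp: le_max_iff_disj mult_left_le)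
    finally have K2: "cmod (Kd d P2) \<le> 1 / (d * d)" .
    have "Kd d P1 * P1' - Kd d P2 * P2' = (Kd d P1 - Kd d P2) * P1' + Kd d P2 * (P1' - P2')"
      by (simp add: algebra_simps)
    also have "cmod \<dots> \<le> D * t / (d * d) * (D * \<nu>) + 1 / (d * d) * (D * (D * t * \<nu>))"
    proof (intro norm_triangle_le add_mono)
      show "cmod ((Kd d P1 - Kd d P2) * P1') \<le> D * t / (d * d) * (D * \<nu>)"
        unfolding norm_mult using K1 v D t d by (intro mult_mono) auto
      have "D * t * \<nu> \<le> D * (D * t * \<nu>)" using D t v mult_right_mono[of 1 D "D * t * \<nu>"] by simp
      then show "cmod (Kd d P2 * (P1' - P2')) \<le> 1 / (d * d) * (D * (D * t * \<nu>))"
        unfolding norm_mult using K2 v by (intro mult_mono) auto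
    qed
    also have "\<dots> = 2 * D\<^sup>2 / d\<^sup>2 * t * \<nu>" by (simp add: power2_eq_square field_simps)
    finally show ?thesis .
  qed
  have "grad_diff d r m P1 A1 P1' A' - grad_diff d r m P2 A2 P2' A'
      = ((\<Sum>\<sigma>\<in>S. T P1 A1 P1' \<sigma>) - (\<Sum>\<sigma>\<in>S. T P2 A2 P2' \<sigma>)) / of_real k - (Kd d P1 * P1' - Kd d P2 * P2')"
    by (simp add: grad_diff_eq S_def T_def diff_divide_distrib)
  also have "cmod \<dots> \<le> 204 * c / d\<^sup>2 * (1 + ln (real m)) + 2 * D\<^sup>2 / d\<^sup>2 * t * \<nu>"
    by (intro norm_triangle_le_diff add_mono s b3)
  also have "\<dots> \<le> 28560 * (D\<^sup>2 / (r\<^sup>2 * d\<^sup>2)) * (1 + ln (real m)) * t * \<nu> + 2 * (D\<^sup>2 / (r\<^sup>2 * d\<^sup>2)) * (1 + ln (real m)) * t * \<nu>"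
  proof (intro add_mono)
    show "204 * c / d\<^sup>2 * (1 + ln (real m)) \<le> 28560 * (D\<^sup>2 / (r\<^sup>2 * d\<^sup>2)) * (1 + ln (real m)) * t * \<nu>"
      by (simp add: c_def mult_ac)
    have "D\<^sup>2 / d\<^sup>2 \<le> D\<^sup>2 / (r\<^sup>2 * d\<^sup>2)"
      using r d by (intro divide_left_mono) (auto simp: power_le_one mult_left_le_one_le)
    then have "D\<^sup>2 / d\<^sup>2 * 1 \<le> D\<^sup>2 / (r\<^sup>2 * d\<^sup>2) * (1 + ln (real m))"
      using h_bounds by (intro mult_mono) auto
    then have "2 * (t * \<nu>) * (D\<^sup>2 / d\<^sup>2 * 1) \<le> 2 * (t * \<nu>) * (D\<^sup>2 / (r\<^sup>2 * d\<^sup>2) * (1 + ln (real m)))"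
      using t v by (intro mult_left_mono) auto
    then show "2 * D\<^sup>2 / d\<^sup>2 * t * \<nu> \<le> 2 * (D\<^sup>2 / (r\<^sup>2 * d\<^sup>2)) * (1 + ln (real m)) * t * \<nu>"
      by (simp add: mult_ac)
  qed
  also have "\<dots> = 28562 * ((D\<^sup>2 / (r\<^sup>2 * d\<^sup>2)) * (1 + ln (real m)) * t * \<nu>)"
  proof -
    have "28560 * x * y * t * \<nu> + 2 * x * y * t * \<nu> = 28562 * (x * y * t * \<nu>)" for x y by simp
    then show ?thesis .
  qed
  also have "\<dots> \<le> 40000 * ((D\<^sup>2 / (r\<^sup>2 * d\<^sup>2)) * (1 + ln (real m)) * t * \<nu>)"
    using h_bounds t v by (intro mult_right_mono) auto
  finally show ?thesis by simp
qed

end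

text \<open>Put h = m powr (-1/9). Above \<open>t0\<close> monotonicity of \<psi> and smallness of h
  suffice; on [h, t0] one has 2 C h \<le> 10 C t |ln t|; below h, 1 + ln m = 1 - 9 ln h \<le> 10 |ln
  t|. So one factor 10 C against t |ln t| covers both small ranges. The extra condition C h \<le> 1
  serves the convergence of the gradients.\<close>

lemma exists_fine_lattice:
  fixes \<psi> :: "real \<Rightarrow> real"
  assumes \<rho>: "\<rho> > 0" "mono_on {0..\<rho>} \<psi>"
    and growth: "filterlim (\<lambda>t. \<psi> t / (t * \<bar>ln t\<bar>)) at_top (at_right 0)" and C: "C > 0"
  shows "\<exists>m\<ge>72. C * real m powr (-1/9) \<le> 1 \<and>
     (\<forall>t. 0 < t \<and> t \<le> \<rho> \<longrightarrow> 2 * C * real m powr (-1/9) \<le> \<psi> t \<or> C * (1 + ln (real m)) * t \<le> \<psi> t)"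
proof -
  have "\<forall>\<^sub>F t in at_right 0. 10 * C \<le> \<psi> t / (t * \<bar>ln t\<bar>)"
    using growth by (simp add: filterlim_at_top)
  then obtain b where b: "b > 0" "\<And>t. 0 < t \<Longrightarrow> t < b \<Longrightarrow> 10 * C \<le> \<psi> t / (t * \<bar>ln t\<bar>)"
    by (auto simp: eventually_at_right_field)
  \<comment> \<open>The bound exp (-1) makes |ln t| \<ge> 1 on the range, so that t \<le> t |ln
    t|.\<close>
  define t0 where "t0 = min (b / 2) (min \<rho> (exp (- 1)))"
  have t0: "0 < t0" "t0 < b" "t0 \<le> \<rho>" "t0 \<le> exp (- 1)" using b \<rho> by (auto simp: t0_def)
  have lnt: "\<bar>ln t\<bar> \<ge> 1" "ln t \<le> - 1" if "0 < t" "t \<le> t0" for t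
  proof -
    have "ln t \<le> ln (exp (- 1))" using that t0 by (subst ln_le_cancel_iff) auto
    then show "ln t \<le> - 1" "\<bar>ln t\<bar> \<ge> 1" by simp_all
  qed
  have \<psi>: "10 * C * t * \<bar>ln t\<bar> \<le> \<psi> t" if "0 < t" "t \<le> t0" for t
  proof -
    have "0 < t * \<bar>ln t\<bar>" using lnt(1)[OF that] that by (intro mult_pos_pos) auto
    moreover have "10 * C \<le> \<psi> t / (t * \<bar>ln t\<bar>)" using b(2)[of t] that t0 by simp
    ultimately show ?thesis by (simp add: pos_le_divide_eq mult_ac)
  qed
  have "10 * C * t0 * 1 \<le> 10 * C * t0 * \<bar>ln t0\<bar>" using lnt(1)[of t0] t0 C by (intro mult_left_mono) auto
  then have \<psi>0: "0 < \<psi> t0" using \<psi>[of t0] t0 C mult_pos_pos[of "10 * C" t0] by linarith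
  \<comment> \<open>The three upper bounds for h are for the split at \<open>t0\<close>, for all t
    \<ge> t0 at once, and for C h \<le> 1.\<close>
  define e where "e = min t0 (min (\<psi> t0 / (2 * C)) (1 / C))"
  have "e > 0" using t0 \<psi>0 C by (simp add: e_def)
  have "((\<lambda>m. real m powr (-1/9)) \<longlongrightarrow> 0) sequentially"
    by (rule tendsto_neg_powr) (auto simp: filterlim_real_sequentially)
  then have "\<forall>\<^sub>F m in sequentially. real m powr (-1/9) < e"
    using \<open>e > 0\<close> by (rule order_tendstoD)
  then have "\<forall>\<^sub>F m in sequentially. real m powr (-1/9) < e \<and> m \<ge> 72"
    using eventually_ge_at_top[of 72] by eventually_elim simp
  then obtain m where m: "real m powr (-1/9) < e" "m \<ge> 72"
    by (auto simp: eventually_sequentially)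
  define h where "h = real m powr (-1/9)"
  have h: "0 < h" "h < t0" "2 * C * h \<le> \<psi> t0" "C * h \<le> 1"
    using m C by (auto simp: h_def e_def field_simps)
  have lnm: "ln (real m) = - 9 * ln h" using m by (simp add: h_def ln_powr)
  have "2 * C * h \<le> \<psi> t \<or> C * (1 + ln (real m)) * t \<le> \<psi> t" if t: "0 < t" "t \<le> \<rho>" for t
  proof -
    consider "t0 \<le> t" | "h \<le> t" "t \<le> t0" | "t \<le> h" by linarith
    then show ?thesis
    proof cases
      case 1
      then have "\<psi> t0 \<le> \<psi> t" using t t0 \<rho>(2) by (auto simp: mono_on_def)
      then show ?thesis using h by linarith
    next
      case 2
      have "2 * C * h \<le> 10 * C * t" using 2 C h by (intro mult_mono) auto
      also have "\<dots> \<le> 10 * C * t * \<bar>ln t\<bar>" using lnt(1)[of t] 2 t C by simp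
      also have "\<dots> \<le> \<psi> t" using \<psi> 2 t by simp
      finally show ?thesis by simp
    next
      case 3
      have "ln t \<le> ln h" using 3 t h by simp
      moreover have "ln t \<le> - 1" using lnt(2)[of t] 3 t h by simp
      ultimately have "1 + ln (real m) \<le> 10 * \<bar>ln t\<bar>" unfolding lnm by linarith
      then have "C * (1 + ln (real m)) * t \<le> C * (10 * \<bar>ln t\<bar>) * t"
        using C t by (intro mult_right_mono mult_left_mono) auto
      also have "\<dots> = 10 * C * t * \<bar>ln t\<bar>" by simp
      also have "\<dots> \<le> \<psi> t" using \<psi>[of t] 3 t h by simp
      finally show ?thesis by simp
    qed
  qed
  then show ?thesis using m(2) h by (auto simp: h_def)
qed

section \<open>Derivatives of the polynomials\<close>

definition dAff :: "nat \<Rightarrow> complex \<times> complex \<Rightarrow> complex" where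
  "dAff n v = (if odd n then fst v else fst v + snd v / 100)"

primrec dPol :: "(nat \<Rightarrow> complex) \<Rightarrow> (nat \<Rightarrow> real) \<Rightarrow> (nat \<Rightarrow> nat) \<Rightarrow> nat \<Rightarrow> (nat \<Rightarrow> complex)
    \<Rightarrow> complex \<times> complex \<Rightarrow> complex \<times> complex \<Rightarrow> complex" where
  "dPol a r m 0 s p v = snd v"
| "dPol a r m (Suc n) s p v = 2 * (Pol a r m n s p - s (Suc n)) * dPol a r m n s p v
      - complex_of_real (eps r m (Suc n)) * dAff (Suc n) v"

lemma norm_components_le:
  fixes v :: "complex \<times> complex"
  shows "cmod (fst v) \<le> norm v" "cmod (snd v) \<le> norm v"
  using norm_fst_le[of "fst v" "snd v"] norm_snd_le[of "snd v" "fst v"] by simp_all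

lemma norm_dAff_le: "cmod (dAff n v) \<le> 2 * norm v"
proof -
  have "cmod (dAff n v) \<le> cmod (fst v) + cmod (snd v) / 100"
    using norm_triangle_ineq[of "fst v" "snd v / 100"] by (simp add: dAff_def norm_divide)
  then show ?thesis using norm_components_le[of v] norm_ge_zero[of "snd v"] by linarith
qed

lemma Aff_diff: "Aff a n p - Aff a n q = dAff n (p - q)"
  by (simp add: Aff_def dAff_def diff_divide_distrib)

text \<open>The 51/100 is 1/2 + 1/100 from the size of \<open>Omega\<close>; with |a_n| < 1/4 the
  form stays below 1, as the branch estimates require.\<close>

lemma norm_Aff_le:
  assumes "p \<in> Omega"
  shows "cmod (Aff a n p) \<le> 51/100 + cmod (a n)"
proof -
  have "cmod (fst p) < 1/2" "cmod (snd p) < 1" using assms by (auto simp: Omega_def)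
  moreover have "cmod (Aff a n p) \<le> cmod (fst p) + cmod (snd p) / 100 + cmod (a n)"
    using norm_triangle_ineq4[of "fst p + snd p / 100" "a n"] norm_triangle_ineq4[of "fst p" "a n"]
      norm_triangle_ineq[of "fst p" "snd p / 100"]
    by (auto simp: Aff_def norm_divide intro: order_trans)
  ultimately show ?thesis by linarith
qed

lemma Aff_has_derivative: "(Aff a n has_derivative dAff n) (at p)"
proof -
  have "Aff a n = (\<lambda>p. dAff n p - a n)" by (auto simp: Aff_def dAff_def fun_eq_iff)
  moreover have "bounded_linear (dAff n)"
    by (cases "odd n") (auto simp: dAff_def[abs_def] intro!: bounded_linear_add bounded_linear_fst
      bounded_linear_compose[OF bounded_linear_divide bounded_linear_snd])
  ultimately show ?thesis
    by (auto intro!: derivative_eq_intros bounded_linear_imp_has_derivative)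
qed

lemma Pol_has_derivative: "(Pol a r m n s has_derivative dPol a r m n s p) (at p)"
proof (induction n)
  case 0
  have "Pol a r m 0 s = snd" "dPol a r m 0 s p = snd" by (simp_all add: fun_eq_iff)
  then show ?case by (simp add: bounded_linear_imp_has_derivative bounded_linear_snd)
next
  case (Suc n)
  have "((\<lambda>q. (Pol a r m n s q - s (Suc n))\<^sup>2 - complex_of_real (eps r m (Suc n)) * Aff a (Suc n) q)
     has_derivative (\<lambda>v. of_nat 2 * (dPol a r m n s p v - 0) * (Pol a r m n s p - s (Suc n)) ^ (2 - 1)
        - complex_of_real (eps r m (Suc n)) * dAff (Suc n) v)) (at p)"
    by (intro has_derivative_diff has_derivative_power has_derivative_const Suc.IH
        has_derivative_mult_right Aff_has_derivative)
  moreover have "(\<lambda>v. of_nat 2 * (dPol a r m n s p v - 0) * (Pol a r m n s p - s (Suc n)) ^ (2 - 1)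
        - complex_of_real (eps r m (Suc n)) * dAff (Suc n) v) = dPol a r m (Suc n) s p"
    by (simp add: fun_eq_iff)
  moreover have "(\<lambda>q. (Pol a r m n s q - s (Suc n))\<^sup>2 - complex_of_real (eps r m (Suc n)) * Aff a (Suc n) q)
      = Pol a r m (Suc n) s"
    by (simp add: fun_eq_iff)
  ultimately show ?case by (simp only:)
qed

text \<open>The four bounds share one D because the induction over levels needs them jointly: the
  Lipschitz bound of the new derivative uses the size and the variation of both the old function and
  its derivative.\<close>

definition C11_bound :: "(complex \<times> complex \<Rightarrow> complex) \<Rightarrow> (complex \<times> complex \<Rightarrow> complex \<times> complex \<Rightarrow> complex) \<Rightarrow> real \<Rightarrow> bool" where
  "C11_bound f f' D \<longleftrightarrow> (\<forall>p\<in>Omega. \<forall>q\<in>Omega. \<forall>v. cmod (f p) \<le> D \<and> cmod (f p - f q) \<le> D * dist p q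
     \<and> cmod (f' p v) \<le> D * norm v \<and> cmod (f' p v - f' q v) \<le> D * dist p q * norm v)"

lemma C11_boundD:
  assumes "C11_bound f f' D" "p \<in> Omega"
  shows "cmod (f p) \<le> D" "cmod (f' p v) \<le> D * norm v"
    "q \<in> Omega \<Longrightarrow> cmod (f p - f q) \<le> D * dist p q"
    "q \<in> Omega \<Longrightarrow> cmod (f' p v - f' q v) \<le> D * dist p q * norm v"
  using assms unfolding C11_bound_def by blast+

lemma C11_bound_mono: "C11_bound f f' D \<Longrightarrow> D \<le> E \<Longrightarrow> C11_bound f f' E"
  unfolding C11_bound_def
  by (meson mult_right_mono norm_ge_zero order_trans zero_le_dist)

text \<open>Product rule estimates with a deliberately crude constant: the bound is only used at a
  fixed level, and its growth is absorbed by the later choice of m.\<close>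

lemma C11_bound_step:
  assumes f: "C11_bound f f' D" and D: "D \<ge> 1"
  shows "C11_bound (\<lambda>p. (f p - c)\<^sup>2 - complex_of_real e * Aff a n p) (\<lambda>p v. 2 * (f p - c) * f' p v - complex_of_real e * dAff n v)
     (8 * (D + cmod c)\<^sup>2 + (4 + cmod (a n)) * \<bar>e\<bar>)"
  unfolding C11_bound_def
proof (intro ballI allI)
  fix p q :: "complex \<times> complex" and v assume p: "p \<in> Omega" and q: "q \<in> Omega"
  define B E t where "B = D + cmod c" and "E = \<bar>e\<bar>" and "t = dist p q"
  have BE: "B \<ge> 1" "D \<le> B" "E \<ge> 0" "t \<ge> 0"
    using D norm_ge_zero[of c] unfolding B_def E_def t_def by (linarith | simp)+
  have fp: "cmod (f p) \<le> D" "cmod (f q) \<le> D" "cmod (f p - f q) \<le> D * t"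
    "cmod (f' p v) \<le> D * norm v" "cmod (f' p v - f' q v) \<le> D * t * norm v"
    unfolding t_def using p q by (auto intro: C11_boundD[OF f])
  have fc: "cmod (f p - c) \<le> B" "cmod (f q - c) \<le> B"
    using fp norm_triangle_ineq4[of "f p" c] norm_triangle_ineq4[of "f q" c] by (auto simp: B_def)
  have BB: "D * B \<le> B\<^sup>2" using BE by (simp add: power2_eq_square)
  have DD: "D * D \<le> B\<^sup>2" using BE D by (simp add: power2_eq_square mult_mono)
  let ?D = "8 * B\<^sup>2 + (4 + cmod (a n)) * E"
  have main: "2 * (D * B) + 2 * E \<le> ?D"
  proof -
    have "0 \<le> cmod (a n) * E" using BE by simp
    then show ?thesis using BB BE zero_le_power2[of B] unfolding distrib_right by linarith
  qed
  have 1: "cmod ((f p - c)\<^sup>2 - complex_of_real e * Aff a n p) \<le> ?D"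
  proof -
    have "cmod ((f p - c)\<^sup>2 - complex_of_real e * Aff a n p) \<le> B\<^sup>2 + E * (51/100 + cmod (a n))"
    proof (intro norm_triangle_le_diff add_mono)
      show "cmod ((f p - c)\<^sup>2) \<le> B\<^sup>2" unfolding norm_power using fc by (intro power_mono) auto
      show "cmod (complex_of_real e * Aff a n p) \<le> E * (51/100 + cmod (a n))"
        unfolding norm_mult norm_of_real E_def using norm_Aff_le[OF p] by (intro mult_left_mono) auto
    qed
    also have "\<dots> \<le> ?D" using BE by (simp add: algebra_simps)
    finally show ?thesis .
  qed
  have 2: "cmod (((f p - c)\<^sup>2 - complex_of_real e * Aff a n p) - ((f q - c)\<^sup>2 - complex_of_real e * Aff a n q)) \<le> ?D * t"
  proof -
    have "((f p - c)\<^sup>2 - complex_of_real e * Aff a n p) - ((f q - c)\<^sup>2 - complex_of_real e * Aff a n q)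
       = (f p - f q) * ((f p - c) + (f q - c)) - complex_of_real e * dAff n (p - q)"
      unfolding Aff_diff[of a, symmetric] by (simp add: power2_eq_square algebra_simps)
    also have "cmod \<dots> \<le> (D * t) * (B + B) + E * (2 * t)"
    proof (intro norm_triangle_le_diff add_mono)
      show "cmod ((f p - f q) * ((f p - c) + (f q - c))) \<le> (D * t) * (B + B)"
        unfolding norm_mult using fp fc BE D by (intro mult_mono norm_triangle_le add_mono) auto
      show "cmod (complex_of_real e * dAff n (p - q)) \<le> E * (2 * t)"
        unfolding norm_mult norm_of_real E_def t_def dist_norm using norm_dAff_le by (intro mult_left_mono) auto
    qed
    also have "\<dots> = (2 * (D * B) + 2 * E) * t" by (simp add: algebra_simps)
    also have "\<dots> \<le> ?D * t"
      using main BE by (intro mult_right_mono) auto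
    finally show ?thesis .
  qed
  have 3: "cmod (2 * (f p - c) * f' p v - complex_of_real e * dAff n v) \<le> ?D * norm v"
  proof -
    have "cmod (2 * (f p - c) * f' p v - complex_of_real e * dAff n v) \<le> 2 * B * (D * norm v) + E * (2 * norm v)"
    proof (intro norm_triangle_le_diff add_mono)
      show "cmod (2 * (f p - c) * f' p v) \<le> 2 * B * (D * norm v)"
        unfolding norm_mult using fp fc BE D by (intro mult_mono) auto
      show "cmod (complex_of_real e * dAff n v) \<le> E * (2 * norm v)"
        unfolding norm_mult norm_of_real E_def using norm_dAff_le by (intro mult_left_mono) auto
    qed
    also have "\<dots> = (2 * (D * B) + 2 * E) * norm v" by (simp add: algebra_simps)
    also have "\<dots> \<le> ?D * norm v"
      using main BE by (intro mult_right_mono) auto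
    finally show ?thesis .
  qed
  have 4: "cmod ((2 * (f p - c) * f' p v - complex_of_real e * dAff n v) - (2 * (f q - c) * f' q v - complex_of_real e * dAff n v))
      \<le> ?D * t * norm v"
  proof -
    have "(2 * (f p - c) * f' p v - complex_of_real e * dAff n v) - (2 * (f q - c) * f' q v - complex_of_real e * dAff n v)
       = 2 * ((f p - f q) * f' p v + (f q - c) * (f' p v - f' q v))"
      by (simp add: algebra_simps)
    also have "cmod \<dots> \<le> 2 * ((D * t) * (D * norm v) + B * (D * t * norm v))"
      unfolding norm_mult[of 2] norm_numeral
    proof (intro mult_left_mono norm_triangle_le add_mono)
      show "cmod ((f p - f q) * f' p v) \<le> (D * t) * (D * norm v)"
        unfolding norm_mult using fp BE D by (intro mult_mono) auto
      show "cmod ((f q - c) * (f' p v - f' q v)) \<le> B * (D * t * norm v)"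
        unfolding norm_mult using fp fc BE D by (intro mult_mono) auto
    qed simp
    also have "\<dots> = (2 * (D * D) + 2 * (D * B)) * (t * norm v)" by (simp add: algebra_simps)
    also have "\<dots> \<le> ?D * (t * norm v)"
    proof (intro mult_right_mono)
      have "0 \<le> (4 + cmod (a n)) * E" using BE by simp
      then show "2 * (D * D) + 2 * (D * B) \<le> ?D" using BB DD zero_le_power2[of B] by linarith
    qed (use BE in auto)
    finally show ?thesis by simp
  qed
  show "cmod ((f p - c)\<^sup>2 - complex_of_real e * Aff a n p) \<le> 8 * (D + cmod c)\<^sup>2 + (4 + cmod (a n)) * \<bar>e\<bar> \<and>
    cmod (((f p - c)\<^sup>2 - complex_of_real e * Aff a n p) - ((f q - c)\<^sup>2 - complex_of_real e * Aff a n q))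
      \<le> (8 * (D + cmod c)\<^sup>2 + (4 + cmod (a n)) * \<bar>e\<bar>) * dist p q \<and>
    cmod (2 * (f p - c) * f' p v - complex_of_real e * dAff n v) \<le> (8 * (D + cmod c)\<^sup>2 + (4 + cmod (a n)) * \<bar>e\<bar>) * norm v \<and>
    cmod ((2 * (f p - c) * f' p v - complex_of_real e * dAff n v) - (2 * (f q - c) * f' q v - complex_of_real e * dAff n v))
      \<le> (8 * (D + cmod c)\<^sup>2 + (4 + cmod (a n)) * \<bar>e\<bar>) * dist p q * norm v"
    using 1 2 3 4 unfolding B_def E_def t_def by blast
qed

lemma Pol_C11_bound: "\<exists>D\<ge>1. C11_bound (Pol a r m n s) (dPol a r m n s) D"
proof (induction n)
  case 0
  have "C11_bound (Pol a r m 0 s) (dPol a r m 0 s) 1"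
    unfolding C11_bound_def
  proof (intro ballI allI)
    fix p q v assume "p \<in> Omega" "q \<in> Omega"
    then show "cmod (Pol a r m 0 s p) \<le> 1 \<and> cmod (Pol a r m 0 s p - Pol a r m 0 s q) \<le> 1 * dist p q \<and>
      cmod (dPol a r m 0 s p v) \<le> 1 * norm v \<and> cmod (dPol a r m 0 s p v - dPol a r m 0 s q v) \<le> 1 * dist p q * norm v"
      using norm_components_le(2)[of v] norm_components_le(2)[of "p - q"] by (auto simp: Omega_def dist_norm)
  qed
  then show ?case by (meson order_refl)
next
  case (Suc n)
  then obtain D where D: "D \<ge> 1" "C11_bound (Pol a r m n s) (dPol a r m n s) D" by blast
  let ?E = "8 * (D + cmod (s (Suc n)))\<^sup>2 + (4 + cmod (a (Suc n))) * \<bar>eps r m (Suc n)\<bar>"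
  have "C11_bound (Pol a r m (Suc n) s) (dPol a r m (Suc n) s) ?E"
    using C11_bound_step[OF D(2,1), of "s (Suc n)" "eps r m (Suc n)" a "Suc n"]
    by (simp add: C11_bound_def)
  then have "C11_bound (Pol a r m (Suc n) s) (dPol a r m (Suc n) s) (max 1 ?E)"
    by (rule C11_bound_mono) simp
  then show ?case by (meson max.cobounded1)
qed

lemma uniform_Pol_C11_bound:
  assumes "finite S"
  shows "\<exists>D\<ge>1. \<forall>s\<in>S. C11_bound (Pol a r m n s) (dPol a r m n s) D"
  using assms
proof (induction S)
  case empty
  then show ?case by (intro exI[of _ 1]) simp
next
  case (insert s S)
  then obtain D1 where 1: "D1 \<ge> 1" "\<forall>s\<in>S. C11_bound (Pol a r m n s) (dPol a r m n s) D1" by blast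
  obtain D2 where 2: "D2 \<ge> 1" "C11_bound (Pol a r m n s) (dPol a r m n s) D2"
    using Pol_C11_bound by blast
  show ?case
    using 1 2 by (intro exI[of _ "max D1 D2"]) (auto intro: C11_bound_mono)
qed

section \<open>Dependence of level n on the first n entries of m\<close>

lemma delta_cong: "(\<And>i. 1 \<le> i \<Longrightarrow> i \<le> n \<Longrightarrow> m i = m' i) \<Longrightarrow> delta r m n = delta r m' n"
  by (induction n) auto

lemma eps_cong: "(\<And>i. 1 \<le> i \<Longrightarrow> i \<le> n \<Longrightarrow> m i = m' i) \<Longrightarrow> 1 \<le> n \<Longrightarrow> eps r m n = eps r m' n"
  using delta_cong[of "n - 1" m m' r] by (simp add: eps_def)

lemma Pol_cong:
  assumes "\<And>i. 1 \<le> i \<Longrightarrow> i \<le> n \<Longrightarrow> m i = m' i" "\<And>i. 1 \<le> i \<Longrightarrow> i \<le> n \<Longrightarrow> s i = s' i"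
  shows "Pol a r m n s = Pol a r m' n s'" "dPol a r m n s = dPol a r m' n s'"
proof -
  have "Pol a r m n s = Pol a r m' n s' \<and> dPol a r m n s = dPol a r m' n s'"
    using assms
  proof (induction n)
    case 0
    then show ?case by (simp add: fun_eq_iff)
  next
    case (Suc n)
    then have "Pol a r m n s = Pol a r m' n s'" "dPol a r m n s = dPol a r m' n s'" "s (Suc n) = s' (Suc n)"
      by auto
    moreover have "eps r m (Suc n) = eps r m' (Suc n)" using Suc.prems(1) by (intro eps_cong) auto
    ultimately show ?case by (simp add: fun_eq_iff)
  qed
  then show "Pol a r m n s = Pol a r m' n s'" "dPol a r m n s = dPol a r m' n s'" by auto
qed

lemma Sig_cong:
  assumes "\<And>i. 1 \<le> i \<Longrightarrow> i \<le> n \<Longrightarrow> m i = m' i" "1 \<le> n"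
  shows "Sig r m n = Sig r m' n"
  using delta_cong[of "n - 1" m m' r] assms by (simp add: Sig_def)

lemma Sidx_cong:
  assumes "\<And>i. 1 \<le> i \<Longrightarrow> i \<le> n \<Longrightarrow> m i = m' i"
  shows "Sidx r m n = Sidx r m' n"
proof -
  have "Sig r m k = Sig r m' k" if "1 \<le> k" "k \<le> n" for k
    using assms that by (intro Sig_cong) auto
  then show ?thesis by (auto simp: Sidx_def)
qed

lemma Sidx_0: "Sidx r m 0 = {\<lambda>_. 0}"
  by (auto simp: Sidx_def)

text \<open>Indices are functions vanishing beyond n, so appending \<sigma> is an update at n + 1
  and the inverse resets that entry to 0.\<close>

lemma bij_betw_Sidx_Suc:
  "bij_betw (\<lambda>(s, \<sigma>). s(Suc n := \<sigma>)) (Sidx r m n \<times> Sig r m (Suc n)) (Sidx r m (Suc n))"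
proof (rule bij_betw_byWitness[where f' = "\<lambda>s. (s(Suc n := 0), s (Suc n))"])
  show "\<forall>x\<in>Sidx r m n \<times> Sig r m (Suc n). (\<lambda>s. (s(Suc n := 0), s (Suc n))) ((\<lambda>(s, \<sigma>). s(Suc n := \<sigma>)) x) = x"
    by (auto simp: Sidx_def fun_eq_iff)
  show "(\<lambda>(s, \<sigma>). s(Suc n := \<sigma>)) ` (Sidx r m n \<times> Sig r m (Suc n)) \<subseteq> Sidx r m (Suc n)"
    by (auto simp: Sidx_def le_Suc_eq)
  show "(\<lambda>s. (s(Suc n := 0), s (Suc n))) ` Sidx r m (Suc n) \<subseteq> Sidx r m n \<times> Sig r m (Suc n)"
    by (auto simp: Sidx_def)
qed auto

lemma Sig_Suc_eq:
  assumes "delta r m n > 0" "m (Suc n) > 0"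
  shows "Sig r m (Suc n) = scaled_lattice (delta r m n) (m (Suc n))"
proof -
  define d M where "d = delta r m n" and "M = m (Suc n)"
  have d: "d > 0" using assms by (simp add: d_def)
  show ?thesis
  proof (intro set_eqI iffI)
    fix \<sigma> assume "\<sigma> \<in> Sig r m (Suc n)"
    then obtain j k :: int where s: "cmod \<sigma> \<le> d * (1 - 1 / real M)"
      "\<sigma> = complex_of_real (3 * d / real M) * (of_int j + \<i> * of_int k)"
      by (auto simp: Sig_def d_def M_def)
    define x where "x = complex_of_real (3 / real M) * (of_int j + \<i> * of_int k)"
    have sx: "\<sigma> = of_real d * x" by (simp add: s(2) x_def)
    then have "cmod x \<le> 1 - 1 / real M" using s(1) d by (simp add: norm_mult)
    then have "x \<in> disc_lattice M" by (auto simp: disc_lattice_def x_def)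
    then show "\<sigma> \<in> scaled_lattice (delta r m n) (m (Suc n))"
      by (auto simp: scaled_lattice_def sx d_def M_def)
  next
    fix \<sigma> assume "\<sigma> \<in> scaled_lattice (delta r m n) (m (Suc n))"
    then obtain x where x: "\<sigma> = of_real d * x" "x \<in> disc_lattice M"
      by (auto simp: scaled_lattice_def d_def M_def)
    then obtain j k :: int where jk: "x = complex_of_real (3 / real M) * (of_int j + \<i> * of_int k)"
      "cmod x \<le> 1 - 1 / real M" by (auto simp: disc_lattice_def)
    have "cmod \<sigma> \<le> d * (1 - 1 / real M)" using jk(2) d by (simp add: x norm_mult)
    moreover have "\<sigma> = complex_of_real (3 * d / real M) * (of_int j + \<i> * of_int k)"
      by (simp add: x jk(1))
    ultimately show "\<sigma> \<in> Sig r m (Suc n)"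
      unfolding Sig_def d_def M_def by auto
  qed
qed

section \<open>Choice of the sequence\<close>

definition potential :: "(nat \<Rightarrow> complex) \<Rightarrow> (nat \<Rightarrow> real) \<Rightarrow> (nat \<Rightarrow> nat) \<Rightarrow> nat
    \<Rightarrow> complex \<times> complex \<Rightarrow> real" where
  "potential a r m n p = (1 / (2 ^ n * real (card (Sidx r m n)))) *
      (\<Sum>s\<in>Sidx r m n. Vd (delta r m n) (Pol a r m n s p))"

definition dpotential :: "(nat \<Rightarrow> complex) \<Rightarrow> (nat \<Rightarrow> real) \<Rightarrow> (nat \<Rightarrow> nat) \<Rightarrow> nat
    \<Rightarrow> complex \<times> complex \<Rightarrow> complex \<times> complex \<Rightarrow> real" where
  "dpotential a r m n p v = (1 / (2 ^ n * real (card (Sidx r m n)))) *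
      (\<Sum>s\<in>Sidx r m n. Re (Kd (delta r m n) (Pol a r m n s p) * dPol a r m n s p v))"

lemma abs_average_le:
  fixes X :: "'a \<Rightarrow> real"
  assumes "finite S" "S \<noteq> {}" "\<And>s. s \<in> S \<Longrightarrow> \<bar>X s\<bar> \<le> B"
  shows "\<bar>1 / (2 ^ n * real (card S)) * (\<Sum>s\<in>S. X s)\<bar> \<le> (1/2) ^ n * B"
proof -
  have c: "real (card S) > 0" using assms by (simp add: card_gt_0_iff)
  have "\<bar>\<Sum>s\<in>S. X s\<bar> \<le> (\<Sum>s\<in>S. \<bar>X s\<bar>)" by (rule sum_abs)
  also have "\<dots> \<le> real (card S) * B" using assms by (intro sum_bounded_above) auto
  finally have "1 / (2 ^ n * real (card S)) * \<bar>\<Sum>s\<in>S. X s\<bar> \<le> 1 / (2 ^ n * real (card S)) * (real (card S) * B)"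
    by (intro mult_left_mono) auto
  also have "\<dots> = (1/2) ^ n * B" using c by (simp add: power_divide)
  finally show ?thesis by (simp add: abs_mult)
qed

section \<open>Increments of the gradient along the construction\<close>

locale construction =
  fixes a :: "nat \<Rightarrow> complex" and r :: "nat \<Rightarrow> real" and m :: "nat \<Rightarrow> nat"
  assumes a_lt: "n \<ge> 1 \<Longrightarrow> cmod (a n) < 1/4"
    and r_bounds: "n \<ge> 1 \<Longrightarrow> 0 < r n \<and> r n \<le> 1/10"
    and m_ge: "m n \<ge> 72"
begin

abbreviation "\<delta> \<equiv> delta r m"
abbreviation "\<S> \<equiv> Sidx r m"
abbreviation "P \<equiv> Pol a r m"

lemma delta_bounds: "0 < \<delta> n" "\<delta> n \<le> 1/2"
proof -
  have "0 < \<delta> n \<and> \<delta> n \<le> 1/2"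
  proof (induction n)
    case (Suc n)
    have r: "0 < r (Suc n)" "r (Suc n) \<le> 1/10" using r_bounds[of "Suc n"] by auto
    have m: "1 \<le> real (m (Suc n))" using m_ge[of "Suc n"] by simp
    have "(\<delta> n)\<^sup>2 * r (Suc n) / (4 * (real (m (Suc n)))\<^sup>2) \<le> 1 * (1/10) / (4 * 1)"
      using Suc r m by (intro frac_le mult_mono) (auto simp: power_le_one one_le_power)
    moreover have "0 < (\<delta> n)\<^sup>2 * r (Suc n) / (4 * (real (m (Suc n)))\<^sup>2)" using Suc r m by simp
    ultimately show ?case by simp
  qed simp
  then show "0 < \<delta> n" "\<delta> n \<le> 1/2" by auto
qed

lemma Sig_Suc: "Sig r m (Suc n) = scaled_lattice (\<delta> n) (m (Suc n))"
  using delta_bounds(1)[of n] m_ge[of "Suc n"] by (intro Sig_Suc_eq) auto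

lemma card_Sig_pos: "0 < card (Sig r m (Suc n))"
proof -
  have "0 < (real (m (Suc n)))\<^sup>2 / 6" using m_ge[of "Suc n"] by simp
  also have "\<dots> \<le> real (card (Sig r m (Suc n)))"
    unfolding Sig_Suc by (intro card_scaled_lattice_ge delta_bounds m_ge)
  finally show ?thesis by simp
qed

lemma card_Sidx_Suc: "card (\<S> (Suc n)) = card (\<S> n) * card (Sig r m (Suc n))"
  using bij_betw_same_card[OF bij_betw_Sidx_Suc[of n r m]] by (simp add: card_cartesian_product)

lemma card_Sidx_pos: "0 < card (\<S> n)"
  by (induction n) (use card_Sig_pos in \<open>auto simp: Sidx_0 card_Sidx_Suc\<close>)

lemma finite_Sidx: "finite (\<S> n)" and Sidx_nonempty: "\<S> n \<noteq> {}"
  using card_Sidx_pos[of n] card.infinite by fastforce+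

lemma sum_Sidx_Suc:
  "(\<Sum>s\<in>\<S> (Suc n). F s) = (\<Sum>s\<in>\<S> n. \<Sum>\<sigma>\<in>Sig r m (Suc n). F (s(Suc n := \<sigma>)))"
  unfolding sum.reindex_bij_betw[OF bij_betw_Sidx_Suc[of n r m], symmetric]
  by (simp add: sum.cartesian_product split_beta')

lemma Pol_upd: "P n (s(Suc n := \<sigma>)) = P n s" "dPol a r m n (s(Suc n := \<sigma>)) = dPol a r m n s"
  by (rule Pol_cong; simp)+

lemma Pol_Suc_upd:
  "P (Suc n) (s(Suc n := \<sigma>)) p = branch (\<delta> n) (m (Suc n)) (P n s p) (Aff a (Suc n) p) \<sigma>"
  by (simp add: Pol_upd branch_def eps_def)

lemma dPol_Suc_upd:
  "dPol a r m (Suc n) (s(Suc n := \<sigma>)) p v = 2 * ((P n s p - \<sigma>) * dPol a r m n s p v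
     - of_real ((\<delta> n)\<^sup>2 / (4 * (real (m (Suc n)))\<^sup>2)) * dAff (Suc n) v)"
  by (simp add: Pol_upd eps_def algebra_simps)

lemma potential_has_derivative: "(potential a r m n has_derivative dpotential a r m n p) (at p)"
proof -
  have "((\<lambda>q. Vd (\<delta> n) (P n s q)) has_derivative (\<lambda>v. Re (Kd (\<delta> n) (P n s p) * dPol a r m n s p v))) (at p)" for s
    by (rule has_derivative_compose[OF Pol_has_derivative Vd_has_derivative[OF delta_bounds(1)]])
  then have "((\<lambda>q. (1 / (2 ^ n * real (card (\<S> n)))) * (\<Sum>s\<in>\<S> n. Vd (\<delta> n) (P n s q))) has_derivative
     (\<lambda>v. (1 / (2 ^ n * real (card (\<S> n)))) * (\<Sum>s\<in>\<S> n. Re (Kd (\<delta> n) (P n s p) * dPol a r m n s p v)))) (at p)"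
    by (intro has_derivative_mult_right has_derivative_sum)
  then show ?thesis unfolding potential_def[abs_def] dpotential_def[abs_def] .
qed

text \<open>The index set of level n + 1 fibres over that of level n with fibres of equal size, so
  the average splits into an average over s of averages over \<sigma>. This reduces the increment to
  the one-step quantity \<open>grad_diff\<close>.\<close>

lemma dpotential_Suc:
  "dpotential a r m (Suc n) p v - dpotential a r m n p v = (1 / (2 ^ n * real (card (\<S> n)))) *
     (\<Sum>s\<in>\<S> n. Re (grad_diff (\<delta> n) (r (Suc n)) (m (Suc n)) (P n s p) (Aff a (Suc n) p) (dPol a r m n s p v) (dAff (Suc n) v)))"
proof -
  define k where "k = real (card (Sig r m (Suc n)))"
  have k: "k > 0" using card_Sig_pos by (simp add: k_def)
  have g: "Re (grad_diff (\<delta> n) (r (Suc n)) (m (Suc n)) (P n s p) (Aff a (Suc n) p) (dPol a r m n s p v) (dAff (Suc n) v))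
    = (\<Sum>\<sigma>\<in>Sig r m (Suc n). Re (Kd (\<delta> (Suc n)) (P (Suc n) (s(Suc n := \<sigma>)) p) * dPol a r m (Suc n) (s(Suc n := \<sigma>)) p v)) / (2 * k)
      - Re (Kd (\<delta> n) (P n s p) * dPol a r m n s p v)" for s
  proof -
    let ?T = "\<lambda>\<sigma>. Kd (\<delta> (Suc n)) (branch (\<delta> n) (m (Suc n)) (P n s p) (Aff a (Suc n) p) \<sigma>)
        * ((P n s p - \<sigma>) * dPol a r m n s p v - of_real ((\<delta> n)\<^sup>2 / (4 * (real (m (Suc n)))\<^sup>2)) * dAff (Suc n) v)"
    have "grad_diff (\<delta> n) (r (Suc n)) (m (Suc n)) (P n s p) (Aff a (Suc n) p) (dPol a r m n s p v) (dAff (Suc n) v)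
       = (\<Sum>\<sigma>\<in>Sig r m (Suc n). ?T \<sigma>) / of_real k - Kd (\<delta> n) (P n s p) * dPol a r m n s p v"
      by (simp only: grad_diff_def Sig_Suc k_def delta.simps of_real_of_nat_eq)
    moreover have "Re ((\<Sum>\<sigma>\<in>Sig r m (Suc n). ?T \<sigma>) / of_real k) = (\<Sum>\<sigma>\<in>Sig r m (Suc n). Re (?T \<sigma>)) / k"
      by (simp only: Re_divide_of_real Re_sum)
    moreover have "Re (Kd (\<delta> (Suc n)) (P (Suc n) (s(Suc n := \<sigma>)) p) * dPol a r m (Suc n) (s(Suc n := \<sigma>)) p v) = 2 * Re (?T \<sigma>)" for \<sigma>
    proof -
      have "Re (x * (2 * y)) = 2 * Re (x * y)" for x y by simp
      then show ?thesis unfolding Pol_Suc_upd dPol_Suc_upd .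
    qed
    ultimately show ?thesis
      by (simp only: minus_complex.sel sum_distrib_left[symmetric])
  qed
  have "dpotential a r m (Suc n) p v = (1 / (2 ^ n * real (card (\<S> n)))) *
     (\<Sum>s\<in>\<S> n. (\<Sum>\<sigma>\<in>Sig r m (Suc n). Re (Kd (\<delta> (Suc n)) (P (Suc n) (s(Suc n := \<sigma>)) p) * dPol a r m (Suc n) (s(Suc n := \<sigma>)) p v)) / (2 * k))"
  proof -
    have "1 / (2 * b * (c * k)) * X = 1 / (b * c) * (X / (2 * k))" for b c X :: real by simp
    then show ?thesis
      unfolding dpotential_def sum_Sidx_Suc card_Sidx_Suc sum_divide_distrib[symmetric] of_nat_mult power_Suc
      by (simp only: k_def)
  qed
  then show ?thesis
    unfolding g sum_subtractf right_diff_distrib by (simp add: dpotential_def)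
qed

end

text \<open>The first clause yields uniform convergence of the gradients, the second the modulus of
  their sum. The common weight is that of the normalisation by 2^n.\<close>

definition small_increment :: "(real \<Rightarrow> real) \<Rightarrow> real \<Rightarrow> (nat \<Rightarrow> complex) \<Rightarrow> (nat \<Rightarrow> real) \<Rightarrow> (nat \<Rightarrow> nat) \<Rightarrow> nat \<Rightarrow> bool" where
  "small_increment \<psi> \<rho> a r m n \<longleftrightarrow>
     (\<forall>p\<in>Omega. \<forall>v. \<bar>dpotential a r m (Suc n) p v - dpotential a r m n p v\<bar> \<le> (1/2) ^ n * norm v) \<and>
     (\<forall>p\<in>Omega. \<forall>q\<in>Omega. dist p q \<le> \<rho> \<longrightarrow> (\<forall>v.
        \<bar>(dpotential a r m (Suc n) p v - dpotential a r m n p v) - (dpotential a r m (Suc n) q v - dpotential a r m n q v)\<bar>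
          \<le> (1/2) ^ n * (\<psi> (dist p q) * norm v)))"

text \<open>Increment n involves the entries of m up to n + 1 only, so later choices do not spoil
  it.\<close>

lemma small_increment_cong:
  assumes "\<And>i. i \<le> Suc n \<Longrightarrow> m i = m' i"
  shows "small_increment \<psi> \<rho> a r m n = small_increment \<psi> \<rho> a r m' n"
proof -
  have "dpotential a r m k = dpotential a r m' k" if "k \<le> Suc n" for k
  proof -
    have "delta r m k = delta r m' k" "Sidx r m k = Sidx r m' k"
      "Pol a r m k s = Pol a r m' k s" "dPol a r m k s = dPol a r m' k s" for s
      using assms that by (auto intro!: delta_cong Sidx_cong Pol_cong)
    then show ?thesis by (simp add: dpotential_def fun_eq_iff)
  qed
  then show ?thesis by (simp add: small_increment_def)
qed

lemma (in construction) exists_small_increment: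
  assumes \<rho>: "\<rho> > 0" "mono_on {0..\<rho>} \<psi>" and \<psi>0: "\<psi> 0 = 0"
    and growth: "filterlim (\<lambda>t. \<psi> t / (t * \<bar>ln t\<bar>)) at_top (at_right 0)"
  shows "\<exists>k\<ge>72. small_increment \<psi> \<rho> a r (m(Suc n := k)) n"
proof -
  \<comment> \<open>D, d and R come from level n and from r_{n+1}, hence are fixed before k.\<close>
  obtain D where D: "D \<ge> 1" "\<And>s. s \<in> \<S> n \<Longrightarrow> C11_bound (P n s) (dPol a r m n s) D"
    using uniform_Pol_C11_bound[OF finite_Sidx] by blast
  define d R where "d = \<delta> n" and "R = r (Suc n)"
  have d: "0 < d" "d \<le> 1" using delta_bounds[of n] by (auto simp: d_def)
  have R: "0 < R" "R \<le> 1" using r_bounds[of "Suc n"] by (auto simp: R_def)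
  define C where "C = 40000 * D\<^sup>2 / (R\<^sup>2 * d\<^sup>2)"
  have "C > 0" using D d R by (simp add: C_def)
  then obtain k where k: "k \<ge> 72" "C * real k powr (-1/9) \<le> 1"
    "\<And>t. 0 < t \<Longrightarrow> t \<le> \<rho> \<Longrightarrow> 2 * C * real k powr (-1/9) \<le> \<psi> t \<or> C * (1 + ln (real k)) * t \<le> \<psi> t"
    using exists_fine_lattice[OF \<rho> growth] by blast
  define m' where "m' = m(Suc n := k)"
  have m': "m' i = m i" if "i \<le> n" for i using that by (simp add: m'_def)
  \<comment> \<open>\<open>N\<close> gives the formula for the increment of the modified sequence
    and \<open>L\<close> its estimates; changing the entry n + 1 leaves every object of level n as
    it was.\<close>
  interpret N: construction a r m'
    using a_lt r_bounds m_ge k(1) by unfold_locales (auto simp: m'_def)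
  interpret L: lattice_step d R D k "real k powr (-1/9)" "d / real k"
    using d R D k(1) by unfold_locales
  have eq: "delta r m' n = d" "Sidx r m' n = \<S> n" "Pol a r m' n s = P n s" "dPol a r m' n s = dPol a r m n s"
    "m' (Suc n) = k" for s
    using m' by (auto simp: m'_def d_def intro!: delta_cong Sidx_cong Pol_cong)
  define G where "G = (\<lambda>s p v. grad_diff d R k (P n s p) (Aff a (Suc n) p) (dPol a r m n s p v) (dAff (Suc n) v))"
  have inc: "dpotential a r m' (Suc n) p v - dpotential a r m' n p v
      = 1 / (2 ^ n * real (card (\<S> n))) * (\<Sum>s\<in>\<S> n. Re (G s p v))" for p v
    unfolding N.dpotential_Suc eq G_def R_def ..
  have A1: "cmod (Aff a (Suc n) p) \<le> 1" if "p \<in> Omega" for p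
    using norm_Aff_le[OF that, of a "Suc n"] a_lt[of "Suc n"] by simp
  have Gb: "cmod (G s p v) \<le> C * real k powr (-1/9) * norm v" if "s \<in> \<S> n" "p \<in> Omega" for s p v
    unfolding G_def C_def
    by (rule L.norm_grad_diff_le[OF A1[OF that(2)] norm_ge_zero C11_boundD(2)[OF D(2)[OF that(1)] that(2)] norm_dAff_le])
  have Gl: "cmod (G s p v - G s q v) \<le> C * (1 + ln (real k)) * dist p q * norm v"
    if s: "s \<in> \<S> n" and p: "p \<in> Omega" and q: "q \<in> Omega" for s p q v
    unfolding G_def C_def
  proof (rule L.grad_diff_Lipschitz[OF A1[OF p] A1[OF q]])
    show "cmod (Aff a (Suc n) p - Aff a (Suc n) q) \<le> 2 * dist p q"
      unfolding Aff_diff dist_norm by (rule norm_dAff_le)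
  qed (use C11_boundD[OF D(2)[OF s]] p q norm_dAff_le in auto)
  have "small_increment \<psi> \<rho> a r m' n"
    unfolding small_increment_def inc
  proof (intro conjI ballI allI impI)
    fix p v assume "p \<in> Omega"
    have "\<bar>Re (G s p v)\<bar> \<le> norm v" if "s \<in> \<S> n" for s
    proof -
      have "\<bar>Re (G s p v)\<bar> \<le> cmod (G s p v)" by (rule abs_Re_le_cmod)
      also have "\<dots> \<le> C * real k powr (-1/9) * norm v" using Gb[OF that \<open>p \<in> Omega\<close>] .
      also have "\<dots> \<le> 1 * norm v" using k(2) by (intro mult_right_mono) auto
      finally show ?thesis by simp
    qed
    then show "\<bar>1 / (2 ^ n * real (card (\<S> n))) * (\<Sum>s\<in>\<S> n. Re (G s p v))\<bar> \<le> (1/2) ^ n * norm v"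
      by (intro abs_average_le finite_Sidx Sidx_nonempty)
  next
    fix p q v assume p: "p \<in> Omega" and q: "q \<in> Omega" and t: "dist p q \<le> \<rho>"
    have "\<bar>Re (G s p v) - Re (G s q v)\<bar> \<le> \<psi> (dist p q) * norm v" if s: "s \<in> \<S> n" for s
    \<comment> \<open>The choice of k speaks of t > 0 only; at t = 0 both sides vanish because
      \<psi> 0 = 0.\<close>
    proof (cases "p = q")
      case True
      then show ?thesis by (simp add: \<psi>0)
    next
      case False
      then have "0 < dist p q" by simp
      have "\<bar>Re (G s p v) - Re (G s q v)\<bar> \<le> cmod (G s p v - G s q v)"
        using abs_Re_le_cmod[of "G s p v - G s q v"] by simp
      also have "\<dots> \<le> \<psi> (dist p q) * norm v"
      proof (cases "2 * C * real k powr (-1/9) \<le> \<psi> (dist p q)")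
        case True
        have "cmod (G s p v - G s q v) \<le> C * real k powr (-1/9) * norm v + C * real k powr (-1/9) * norm v"
          by (intro norm_triangle_le_diff add_mono Gb s p q)
        also have "\<dots> = (2 * C * real k powr (-1/9)) * norm v" by simp
        also have "\<dots> \<le> \<psi> (dist p q) * norm v" using True by (intro mult_right_mono) auto
        finally show ?thesis .
      next
        case False
        then have "C * (1 + ln (real k)) * dist p q \<le> \<psi> (dist p q)" using k(3)[OF \<open>0 < dist p q\<close> t] by blast
        then have "C * (1 + ln (real k)) * dist p q * norm v \<le> \<psi> (dist p q) * norm v"
          by (intro mult_right_mono) auto
        then show ?thesis using Gl[OF s p q, of v] by linarith
      qed
      finally show ?thesis .
    qed
    then show "\<bar>1 / (2 ^ n * real (card (\<S> n))) * (\<Sum>s\<in>\<S> n. Re (G s p v))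
        - 1 / (2 ^ n * real (card (\<S> n))) * (\<Sum>s\<in>\<S> n. Re (G s q v))\<bar> \<le> (1/2) ^ n * (\<psi> (dist p q) * norm v)"
      unfolding right_diff_distrib[symmetric] sum_subtractf[symmetric]
      by (intro abs_average_le finite_Sidx Sidx_nonempty)
  qed
  then show ?thesis using k(1) unfolding m'_def by blast
qed

text \<open>A dependent choice: the admissible entry n + 1 depends, through the C^{1,1} bounds, on
  all entries before it.\<close>

lemma exists_small_increments:
  assumes a: "\<And>n. n \<ge> 1 \<Longrightarrow> cmod (a n) < 1/4" and r: "\<And>n. n \<ge> 1 \<Longrightarrow> 0 < r n \<and> r n \<le> 1/10"
    and \<rho>: "\<rho> > 0" "mono_on {0..\<rho>} \<psi>" and \<psi>0: "\<psi> 0 = 0"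
    and growth: "filterlim (\<lambda>t. \<psi> t / (t * \<bar>ln t\<bar>)) at_top (at_right 0)"
  shows "\<exists>m. (\<forall>n. m n \<ge> 72) \<and> (\<forall>n. small_increment \<psi> \<rho> a r m n)"
proof -
  define K where "K = (\<lambda>n m. SOME k. k \<ge> 72 \<and> small_increment \<psi> \<rho> a r (m(Suc n := k)) n)"
  have K: "K n m \<ge> 72 \<and> small_increment \<psi> \<rho> a r (m(Suc n := K n m)) n" if "\<forall>i. m i \<ge> 72" for n m
  proof -
    interpret construction a r m using a r that by unfold_locales auto
    show ?thesis
      unfolding K_def using exists_small_increment[OF \<rho> \<psi>0 growth, of n] by (rule someI_ex)
  qed
  \<comment> \<open>Each stage is a complete sequence with default value 72, so that the locale
    applies to it. Stage n settles the entries up to n, and the diagonal collects them.\<close>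
  define M where "M = rec_nat (\<lambda>_. 72) (\<lambda>n f. f(Suc n := K n f))"
  have M: "M 0 = (\<lambda>_. 72)" "M (Suc n) = (M n)(Suc n := K n (M n))" for n
    by (simp_all add: M_def)
  have M_ge: "\<forall>i. M n i \<ge> 72" for n
    by (induction n) (use K in \<open>auto simp: M\<close>)
  have M_stable: "M n i = M i i" if "i \<le> n" for n i
    using that by (induction n rule: dec_induct) (auto simp: M)
  have "small_increment \<psi> \<rho> a r (\<lambda>i. M i i) n" for n
  proof -
    have "small_increment \<psi> \<rho> a r (M (Suc n)) n" using K[OF M_ge, of n n] by (simp add: M)
    moreover have "small_increment \<psi> \<rho> a r (M (Suc n)) n = small_increment \<psi> \<rho> a r (\<lambda>i. M i i) n"
      by (rule small_increment_cong) (rule M_stable)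
    ultimately show ?thesis by simp
  qed
  then show ?thesis using M_ge by (intro exI[of _ "\<lambda>i. M i i"]) auto
qed

section \<open>The limit potential\<close>

text \<open>For |\<sigma>| \<le> d \<le> (2/3) |P| the distance |P - \<sigma>| lies between |P|/3
  and (5/3) |P|, and m \<ge> 72 makes epsilon negligible. So half the logarithm of the branch is ln
  |P| up to a bounded error.\<close>

lemma norm_branch_far:
  assumes d: "d > 0" and M: "M \<ge> 72" and \<sigma>: "cmod \<sigma> \<le> d" and P: "3/2 * d \<le> cmod P" and A: "cmod A \<le> 1"
  shows "(cmod P)\<^sup>2 / 16 \<le> cmod (branch d M P A \<sigma>)" "cmod (branch d M P A \<sigma>) \<le> 4 * (cmod P)\<^sup>2"
proof -
  define x e where "x = cmod P" and "e = d\<^sup>2 / (2 * (real M)\<^sup>2)"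
  have x: "x > 0" "d \<le> 2/3 * x" using d P by (auto simp: x_def)
  have "72\<^sup>2 \<le> (real M)\<^sup>2" using M by (intro power_mono) auto
  then have "e \<le> x\<^sup>2 / 100"
    unfolding e_def using x d by (intro frac_le power_mono) auto
  moreover have "cmod (of_real e * A) \<le> e * 1"
    unfolding norm_mult norm_of_real e_def using A by (intro mult_mono) auto
  ultimately have eA: "cmod (of_real e * A) \<le> x\<^sup>2 / 100" by simp
  have "x / 3 \<le> cmod (P - \<sigma>)" "cmod (P - \<sigma>) \<le> 5/3 * x"
    using norm_triangle_ineq2[of P \<sigma>] norm_triangle_ineq4[of P \<sigma>] \<sigma> x by (auto simp: x_def)
  then have "(x / 3)\<^sup>2 \<le> cmod ((P - \<sigma>)\<^sup>2)" "cmod ((P - \<sigma>)\<^sup>2) \<le> (5/3 * x)\<^sup>2"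
    unfolding norm_power using x by (auto intro!: power_mono)
  then have "x\<^sup>2 / 9 \<le> cmod ((P - \<sigma>)\<^sup>2)" "cmod ((P - \<sigma>)\<^sup>2) \<le> 25/9 * x\<^sup>2"
    by (simp_all add: power_divide power_mult_distrib)
  then have "x\<^sup>2 / 9 - x\<^sup>2 / 100 \<le> cmod ((P - \<sigma>)\<^sup>2 - of_real e * A)"
    "cmod ((P - \<sigma>)\<^sup>2 - of_real e * A) \<le> 25/9 * x\<^sup>2 + x\<^sup>2 / 100"
    using norm_triangle_ineq2[of "(P - \<sigma>)\<^sup>2" "of_real e * A"] norm_triangle_ineq4[of "(P - \<sigma>)\<^sup>2" "of_real e * A"] eA
    by linarith+
  moreover have "x\<^sup>2 / 16 \<le> x\<^sup>2 / 9 - x\<^sup>2 / 100" "25/9 * x\<^sup>2 + x\<^sup>2 / 100 \<le> 4 * x\<^sup>2"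
    using zero_le_power2[of x] by linarith+
  ultimately show "(cmod P)\<^sup>2 / 16 \<le> cmod (branch d M P A \<sigma>)" "cmod (branch d M P A \<sigma>) \<le> 4 * (cmod P)\<^sup>2"
    unfolding branch_def e_def[symmetric] x_def[symmetric] by linarith+
qed

lemma convex_open_Omega: "convex Omega" "open Omega"
  by (auto simp: Omega_def intro: convex_Times open_Times)

section \<open>Convergence at a point away from all branches\<close>

context construction
begin

lemma norm_Aff_le_1: "p \<in> Omega \<Longrightarrow> cmod (Aff a (Suc n) p) \<le> 1"
  using norm_Aff_le[of p a "Suc n"] a_lt[of "Suc n"] by simp

lemma norm_Sig_le:
  assumes "\<sigma> \<in> Sig r m (Suc n)"
  shows "cmod \<sigma> \<le> \<delta> n"
proof -
  have "cmod \<sigma> \<le> \<delta> n * (1 - 1 / real (m (Suc n)))" using assms by (simp add: Sig_def)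
  also have "\<dots> \<le> \<delta> n * 1" using delta_bounds(1)[of n] by (intro mult_left_mono) auto
  finally show ?thesis by simp
qed

text \<open>A point outside all the sets \<open>X\<^sub>n\<close>, where every \<open>V_\<delta>\<close> is a plain logarithm: convergence
  of the potentials has to be checked only there, and follows elsewhere from that of the gradients.\<close>

definition base_point :: "complex \<times> complex" where "base_point = (0, 9/10)"

lemma base_point_in: "base_point \<in> Omega"
  by (simp add: base_point_def Omega_def)

text \<open>The margin 3/2 reproduces itself: (3/2) delta_{n+1} is at most (3/80) delta_n^2, while
  the new polynomial is at least ((3/2) delta_n)^2/16 = (9/64) delta_n^2. It starts from 9/10 \<ge>
  3/4.\<close>

lemma norm_Pol_base_point: "s \<in> \<S> n \<Longrightarrow> 3/2 * \<delta> n \<le> cmod (P n s base_point)"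
proof (induction n arbitrary: s)
  case 0
  then show ?case by (simp add: base_point_def)
next
  case (Suc n)
  have "s \<in> (\<lambda>(s, \<sigma>). s(Suc n := \<sigma>)) ` (\<S> n \<times> Sig r m (Suc n))"
    using Suc.prems bij_betw_imp_surj_on[OF bij_betw_Sidx_Suc[of n r m]] by simp
  then obtain s0 \<sigma> where s: "s = s0(Suc n := \<sigma>)" "s0 \<in> \<S> n" "\<sigma> \<in> Sig r m (Suc n)" by auto
  have r: "0 < r (Suc n)" "r (Suc n) \<le> 1/10" using r_bounds[of "Suc n"] by auto
  have m: "1 \<le> (real (m (Suc n)))\<^sup>2" using m_ge[of "Suc n"] by simp
  have IH: "3/2 * \<delta> n \<le> cmod (P n s0 base_point)" using Suc.IH s by simp
  have "3/2 * \<delta> (Suc n) \<le> 3/2 * ((\<delta> n)\<^sup>2 * (1/10) / (4 * 1))"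
    unfolding delta.simps using r m by (intro mult_left_mono frac_le mult_mono) auto
  also have "\<dots> \<le> (3/2 * \<delta> n)\<^sup>2 / 16" by (simp add: power_mult_distrib power_divide)
  also have "\<dots> \<le> (cmod (P n s0 base_point))\<^sup>2 / 16"
    using IH delta_bounds(1)[of n] by (intro divide_right_mono power_mono) auto
  also have "\<dots> \<le> cmod (P (Suc n) s base_point)"
    unfolding s(1) Pol_Suc_upd
    by (intro norm_branch_far delta_bounds m_ge norm_Sig_le s(3) IH norm_Aff_le_1 base_point_in)
  finally show ?case .
qed

text \<open>All potentials are logarithms there, and |P|^2/16 \<le> |branch| \<le> 4 |P|^2 gives
  |(1/2) ln |branch| - ln |P|| \<le> 2 ln 2 \<le> 2 for each pair.\<close>

lemma potential_base_point_increment: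
  "\<bar>potential a r m (Suc n) base_point - potential a r m n base_point\<bar> \<le> (1/2) ^ n * 2"
proof -
  define k where "k = real (card (Sig r m (Suc n)))"
  have k: "k > 0" using card_Sig_pos by (simp add: k_def)
  let ?V = "\<lambda>s \<sigma>. Vd (\<delta> (Suc n)) (P (Suc n) (s(Suc n := \<sigma>)) base_point)"
  let ?W = "\<lambda>s. Vd (\<delta> n) (P n s base_point)"
  have each: "\<bar>?V s \<sigma> / 2 - ?W s\<bar> \<le> 2" if s: "s \<in> \<S> n" and \<sigma>: "\<sigma> \<in> Sig r m (Suc n)" for s \<sigma>
  proof -
    define x y where "x = cmod (P n s base_point)" and "y = cmod (P (Suc n) (s(Suc n := \<sigma>)) base_point)"
    have s': "s(Suc n := \<sigma>) \<in> \<S> (Suc n)"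
      using s \<sigma> bij_betw_imp_surj_on[OF bij_betw_Sidx_Suc[of n r m]] by (metis (no_types, lifting) case_prod_conv image_eqI mem_Sigma_iff)
    have x: "3/2 * \<delta> n \<le> x" "x > 0" and y: "3/2 * \<delta> (Suc n) \<le> y" "y > 0"
      using norm_Pol_base_point[OF s] norm_Pol_base_point[OF s'] delta_bounds(1)[of n] delta_bounds(1)[of "Suc n"]
      unfolding x_def y_def by linarith+
    have xy: "x\<^sup>2 / 16 \<le> y" "y \<le> 4 * x\<^sup>2"
      using norm_branch_far[OF delta_bounds(1) m_ge norm_Sig_le[OF \<sigma>] x(1)[unfolded x_def] norm_Aff_le_1[OF base_point_in]]
      unfolding x_def y_def Pol_Suc_upd by auto
    have ln2: "ln (2::real) \<le> 1" using ln_le_minus_one[of 2] by simp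
    have "ln (16::real) = ln (2 ^ 4)" "ln (4::real) = ln (2 ^ 2)" by simp_all
    then have l: "ln (16::real) = 4 * ln 2" "ln (4::real) = 2 * ln 2" by (simp_all only: ln_realpow)
    have "ln (x\<^sup>2 / 16) \<le> ln y" using xy x y by (subst ln_le_cancel_iff) auto
    moreover have "ln y \<le> ln (4 * x\<^sup>2)" using xy x y by (subst ln_le_cancel_iff) auto
    moreover have "ln (x\<^sup>2 / 16) = 2 * ln x - ln 16" "ln (4 * x\<^sup>2) = ln 4 + 2 * ln x"
      using x by (simp_all add: ln_div ln_mult ln_realpow)
    ultimately have "\<bar>ln y / 2 - ln x\<bar> \<le> 2" using l ln2 by linarith
    moreover have "?V s \<sigma> = ln y" "?W s = ln x"
      using x y delta_bounds(1)[of n] delta_bounds(1)[of "Suc n"] unfolding x_def y_def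
      by (auto intro!: Vd_outside)
    ultimately show ?thesis by simp
  qed
  have "potential a r m (Suc n) base_point = (1 / (2 ^ n * real (card (\<S> n)))) * (\<Sum>s\<in>\<S> n. (\<Sum>\<sigma>\<in>Sig r m (Suc n). ?V s \<sigma> / 2) / k)"
  proof -
    have "1 / (2 * b * (c * k)) * X = 1 / (b * c) * (X / 2 / k)" for b c X :: real by simp
    then show ?thesis
      unfolding potential_def sum_Sidx_Suc card_Sidx_Suc sum_divide_distrib[symmetric] of_nat_mult power_Suc
      by (simp only: k_def)
  qed
  then have "potential a r m (Suc n) base_point - potential a r m n base_point
     = (1 / (2 ^ n * real (card (\<S> n)))) * (\<Sum>s\<in>\<S> n. (\<Sum>\<sigma>\<in>Sig r m (Suc n). ?V s \<sigma> / 2) / k - ?W s)"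
    by (simp add: potential_def sum_subtractf right_diff_distrib)
  also have "\<bar>\<dots>\<bar> \<le> (1/2) ^ n * 2"
  proof (intro abs_average_le finite_Sidx Sidx_nonempty)
    fix s assume s: "s \<in> \<S> n"
    have "(\<Sum>\<sigma>\<in>Sig r m (Suc n). ?V s \<sigma> / 2) / k - ?W s = (\<Sum>\<sigma>\<in>Sig r m (Suc n). ?V s \<sigma> / 2 - ?W s) / k"
      using k by (simp add: sum_subtractf k_def diff_divide_distrib)
    also have "\<bar>\<dots>\<bar> \<le> 2"
    proof -
      have "\<bar>\<Sum>\<sigma>\<in>Sig r m (Suc n). ?V s \<sigma> / 2 - ?W s\<bar> \<le> (\<Sum>\<sigma>\<in>Sig r m (Suc n). \<bar>?V s \<sigma> / 2 - ?W s\<bar>)"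
        by (rule sum_abs)
      also have "\<dots> \<le> k * 2" unfolding k_def using each[OF s] by (intro sum_bounded_above) auto
      finally show ?thesis using k by (simp add: pos_divide_le_eq mult.commute)
    qed
    finally show "\<bar>(\<Sum>\<sigma>\<in>Sig r m (Suc n). ?V s \<sigma> / 2) / k - ?W s\<bar> \<le> 2" .
  qed
  finally show ?thesis .
qed

lemma convergent_potential_base_point: "convergent (\<lambda>n. potential a r m n base_point)"
proof -
  have "summable (\<lambda>n. potential a r m (Suc n) base_point - potential a r m n base_point)"
    by (rule summable_comparison_test'[where g = "\<lambda>n. (1/2) ^ n * 2" and N = 0])
      (use potential_base_point_increment in \<open>auto intro!: summable_mult2 summable_geometric\<close>)
  then have "convergent (\<lambda>n. \<Sum>i<n. potential a r m (Suc i) base_point - potential a r m i base_point)"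
    by (simp add: summable_iff_convergent)
  then have "convergent (\<lambda>n. (potential a r m n base_point - potential a r m 0 base_point) + potential a r m 0 base_point)"
    unfolding sum_lessThan_telescope[of "\<lambda>n. potential a r m n base_point"] by (intro convergent_add convergent_const)
  then show ?thesis by simp
qed

lemma u_approx_minus_potential: "(\<lambda>n. u_approx a r m n p - potential a r m n p) \<longlonglongrightarrow> 0"
proof (rule Lim_null_comparison)
  show "\<forall>\<^sub>F n in sequentially. norm (u_approx a r m n p - potential a r m n p) \<le> (1/2) ^ n * (1/2)"
  proof (intro always_eventually allI)
    fix n
    have "u_approx a r m n p - potential a r m n p = 1 / (2 ^ n * real (card (\<S> n))) *
       (\<Sum>s\<in>\<S> n. ln (max (cmod (P n s p)) (\<delta> n)) - Vd (\<delta> n) (P n s p))"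
      by (simp add: u_approx_def potential_def sum_subtractf right_diff_distrib)
    also have "\<bar>\<dots>\<bar> \<le> (1/2) ^ n * (1/2)"
      using Vd_minus_ln_max[OF delta_bounds(1)]
      by (intro abs_average_le finite_Sidx Sidx_nonempty) (simp add: abs_minus_commute)
    finally show "norm (u_approx a r m n p - potential a r m n p) \<le> (1/2) ^ n * (1/2)" by simp
  qed
  show "(\<lambda>n. (1/2) ^ n * (1/2 :: real)) \<longlonglongrightarrow> 0"
    by (intro tendsto_mult_left_zero LIMSEQ_power_zero) simp
qed

text \<open>The initial term of the telescoping sum, the gradient of \<open>Vd (1/2)\<close> in w;
  the constant is 1/delta_0^2 = 4.\<close>

lemma dpotential_0_Lipschitz: "\<bar>dpotential a r m 0 p v - dpotential a r m 0 q v\<bar> \<le> 4 * dist p q * norm v"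
proof -
  have "dpotential a r m 0 p v - dpotential a r m 0 q v = Re ((Kd (1/2) (snd p) - Kd (1/2) (snd q)) * snd v)"
    by (simp add: dpotential_def Sidx_0 algebra_simps)
  also have "\<bar>\<dots>\<bar> \<le> cmod (Kd (1/2) (snd p) - Kd (1/2) (snd q)) * cmod (snd v)"
    unfolding norm_mult[symmetric] by (rule abs_Re_le_cmod)
  also have "\<dots> \<le> 4 * dist p q * norm v"
  proof (intro mult_mono)
    have "cmod (Kd (1/2) (snd p) - Kd (1/2) (snd q))
       \<le> cmod (snd p - snd q) / (max (cmod (snd p)) (1/2) * max (cmod (snd q)) (1/2))"
      by (rule Kd_diff_le) simp
    also have "\<dots> \<le> dist p q / (1/2 * (1/2))"
      using norm_components_le(2)[of "p - q"] by (intro frac_le mult_mono) (auto simp: dist_norm)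
    finally show "cmod (Kd (1/2) (snd p) - Kd (1/2) (snd q)) \<le> 4 * dist p q" by simp
  qed (use norm_components_le in auto)
  finally show ?thesis .
qed

text \<open>The limit gradient \<open>G\<close> is the initial gradient plus all increments. Summing
  the weights 2^{-n} to 2 gives it the modulus 4 t + 2 \<psi>(t).\<close>

lemma C1psi_limit:
  assumes incr: "\<And>n. small_increment \<psi> \<rho> a r m n"
    and \<rho>: "\<rho> > 0" "continuous_on {0..\<rho>} \<psi>" and \<psi>0: "\<psi> 0 = 0"
    and growth: "filterlim (\<lambda>t. \<psi> t / (t * \<bar>ln t\<bar>)) at_top (at_right 0)"
  shows "\<forall>p\<in>Omega. convergent (\<lambda>n. u_approx a r m n p)"
    and "C1psi_loc \<psi> (\<lambda>p. lim (\<lambda>n. u_approx a r m n p)) Omega"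
proof -
  define \<Delta> where "\<Delta> = (\<lambda>n p v. dpotential a r m (Suc n) p v - dpotential a r m n p v)"
  define G where "G = (\<lambda>p v. dpotential a r m 0 p v + (\<Sum>n. \<Delta> n p v))"
  have \<Delta>b: "\<bar>\<Delta> n p v\<bar> \<le> (1/2) ^ n * norm v" if "p \<in> Omega" for n p v
    using incr[of n] that unfolding small_increment_def \<Delta>_def by blast
  have \<Delta>l: "\<bar>\<Delta> n p v - \<Delta> n q v\<bar> \<le> (1/2) ^ n * (\<psi> (dist p q) * norm v)"
    if "p \<in> Omega" "q \<in> Omega" "dist p q \<le> \<rho>" for n p q v
    using incr[of n] that unfolding small_increment_def \<Delta>_def by blast
  have geo: "(\<lambda>n. (1/2) ^ n * c) sums (2 * c)" for c :: real
    using sums_mult2[OF geometric_sums[of "1/2 :: real"], of c] by simp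
  have summ: "summable (\<lambda>n. \<Delta> n p v)" if "p \<in> Omega" for p v
    by (rule summable_comparison_test'[OF sums_summable[OF geo], of 0]) (use \<Delta>b[OF that] in simp)
  have dn: "dpotential a r m n p v = dpotential a r m 0 p v + (\<Sum>i<n. \<Delta> i p v)" for n p v
    unfolding \<Delta>_def by (simp add: sum_lessThan_telescope[of "\<lambda>n. dpotential a r m n p v"])
  have conv: "\<bar>dpotential a r m n p v - G p v\<bar> \<le> 2 * (1/2) ^ n * norm v" if p: "p \<in> Omega" for n p v
  proof -
    have "G p v - dpotential a r m n p v = (\<Sum>i. \<Delta> (i + n) p v)"
      unfolding G_def dn[of n] using suminf_split_initial_segment[OF summ[OF p], of v n] by simp
    moreover have "norm (\<Sum>i. \<Delta> (i + n) p v) \<le> (\<Sum>i. (1/2) ^ i * ((1/2) ^ n * norm v))"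
    proof (rule norm_suminf_le)
      show "norm (\<Delta> (i + n) p v) \<le> (1/2) ^ i * ((1/2) ^ n * norm v)" for i
        using \<Delta>b[OF p, of "i + n" v] by (simp add: power_add mult_ac)
    qed (rule sums_summable[OF geo])
    ultimately show ?thesis
      using sums_unique[OF geo, of "(1/2) ^ n * norm v"] by (simp add: abs_minus_commute)
  qed
  have Gl: "\<bar>G p v - G q v\<bar> \<le> (4 * dist p q + 2 * \<psi> (dist p q)) * norm v"
    if pq: "p \<in> Omega" "q \<in> Omega" "dist p q \<le> \<rho>" for p q v
  proof -
    have "G p v - G q v = (dpotential a r m 0 p v - dpotential a r m 0 q v) + (\<Sum>n. \<Delta> n p v - \<Delta> n q v)"
      unfolding G_def using suminf_diff[OF summ[OF pq(1)] summ[OF pq(2)], of v v] by simp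
    moreover have "norm (\<Sum>n. \<Delta> n p v - \<Delta> n q v) \<le> (\<Sum>n. (1/2) ^ n * (\<psi> (dist p q) * norm v))"
      by (rule norm_suminf_le) (use \<Delta>l[OF pq] in \<open>auto intro: sums_summable[OF geo]\<close>)
    ultimately show ?thesis
      using dpotential_0_Lipschitz[of p v q] sums_unique[OF geo, of "\<psi> (dist p q) * norm v"]
      by (simp add: algebra_simps)
  qed
  obtain l where "(\<lambda>n. potential a r m n base_point) \<longlonglongrightarrow> l"
    using convergent_potential_base_point by (auto simp: convergent_def)
  moreover have "\<forall>\<^sub>F n in sequentially. \<forall>p\<in>Omega. \<forall>v. norm (dpotential a r m n p v - G p v) \<le> e * norm v"
    if "e > 0" for e
  proof -
    have "(\<lambda>n. 2 * (1/2) ^ n :: real) \<longlonglongrightarrow> 2 * 0"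
      by (intro tendsto_mult_left LIMSEQ_power_zero) simp
    then have "\<forall>\<^sub>F n in sequentially. 2 * (1/2) ^ n < e"
      using that by (intro order_tendstoD(2)) auto
    then show ?thesis
    proof eventually_elim
      case (elim n)
      show ?case
      proof (intro ballI allI)
        fix p v assume "p \<in> Omega"
        then have "norm (dpotential a r m n p v - G p v) \<le> 2 * (1/2) ^ n * norm v" using conv by simp
        also have "\<dots> \<le> e * norm v" using elim by (intro mult_right_mono) auto
        finally show "norm (dpotential a r m n p v - G p v) \<le> e * norm v" .
      qed
    qed
  qed
  \<comment> \<open>Convexity of \<open>Omega\<close> turns uniform convergence of derivatives and
    convergence at the base point into convergence everywhere, with \<open>G\<close> as derivative
    of the limit.\<close>
  ultimately have "\<exists>g. \<forall>p\<in>Omega. (\<lambda>n. potential a r m n p) \<longlonglongrightarrow> g p \<and> (g has_derivative G p) (at p within Omega)"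
    using base_point_in has_derivative_at_withinI[OF potential_has_derivative]
    by (intro has_derivative_sequence[OF convex_open_Omega(1)])
  then obtain g where g: "\<And>p. p \<in> Omega \<Longrightarrow> (\<lambda>n. potential a r m n p) \<longlonglongrightarrow> g p"
    "\<And>p. p \<in> Omega \<Longrightarrow> (g has_derivative G p) (at p within Omega)" by blast
  have u: "(\<lambda>n. u_approx a r m n p) \<longlonglongrightarrow> g p" if "p \<in> Omega" for p
    using tendsto_add[OF u_approx_minus_potential[of p] g(1)[OF that]] by simp
  then show "\<forall>p\<in>Omega. convergent (\<lambda>n. u_approx a r m n p)"
    by (auto simp: convergent_def)
  define f where "f = (\<lambda>p. lim (\<lambda>n. u_approx a r m n p))"
  have fg: "f p = g p" if "p \<in> Omega" for p
    unfolding f_def using u[OF that] by (rule limI)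
  have fG: "(f has_derivative G p) (at p)" if p: "p \<in> Omega" for p
  proof -
    have "(f has_derivative G p) (at p within Omega)"
      by (rule has_derivative_transform[OF p _ g(2)[OF p]]) (rule fg)
    then show ?thesis unfolding at_within_open[OF p convex_open_Omega(2)] .
  qed
  have "\<forall>\<^sub>F t in at_right 0. 1 \<le> \<psi> t / (t * \<bar>ln t\<bar>)"
    using growth by (simp add: filterlim_at_top)
  then obtain b where b: "b > 0" "\<And>t. 0 < t \<Longrightarrow> t < b \<Longrightarrow> 1 \<le> \<psi> t / (t * \<bar>ln t\<bar>)"
    by (auto simp: eventually_at_right_field)
  define t1 where "t1 = min (b / 2) (min \<rho> (exp (- 1)))"
  have t1: "0 < t1" "t1 < b" "t1 \<le> \<rho>" "t1 \<le> exp (- 1)" using b \<rho> by (auto simp: t1_def)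
  \<comment> \<open>Growth faster than t |ln t| gives t \<le> \<psi> t near 0, which absorbs the
    Lipschitz initial term: 4 t + 2 \<psi>(t) \<le> 6 \<psi>(t).\<close>
  have t\<psi>: "t \<le> \<psi> t" if t: "0 \<le> t" "t \<le> t1" for t
  proof (cases "t = 0")
    case False
    then have "0 < t" using t by simp
    have "ln t \<le> ln (exp (- 1))" using t t1 \<open>0 < t\<close> by (subst ln_le_cancel_iff) auto
    then have "1 \<le> \<bar>ln t\<bar>" by simp
    then have "0 < t * \<bar>ln t\<bar>" using \<open>0 < t\<close> by (intro mult_pos_pos) auto
    moreover have "1 \<le> \<psi> t / (t * \<bar>ln t\<bar>)" using b(2)[of t] \<open>0 < t\<close> t t1 by simp
    ultimately have "t * \<bar>ln t\<bar> \<le> \<psi> t" by (simp add: pos_le_divide_eq)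
    moreover have "t * 1 \<le> t * \<bar>ln t\<bar>" using \<open>1 \<le> \<bar>ln t\<bar>\<close> t by (intro mult_left_mono) auto
    ultimately show ?thesis by simp
  qed (simp add: \<psi>0)
  have on: "onorm (\<lambda>v. G p v - G q v) \<le> 6 * \<psi> (dist p q)"
    if pq: "p \<in> Omega" "q \<in> Omega" "dist p q \<le> t1" for p q
  proof (rule onorm_bound)
    show "0 \<le> 6 * \<psi> (dist p q)" using t\<psi>[of "dist p q"] pq zero_le_dist[of p q] by linarith
    fix v
    have "norm (G p v - G q v) \<le> (4 * dist p q + 2 * \<psi> (dist p q)) * norm v"
      using Gl[OF pq(1,2)] pq(3) t1 by simp
    also have "\<dots> \<le> (6 * \<psi> (dist p q)) * norm v"
      using t\<psi>[of "dist p q"] pq by (intro mult_right_mono) auto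
    finally show "norm (G p v - G q v) \<le> 6 * \<psi> (dist p q) * norm v" .
  qed
  have bl: "bounded_linear (G p)" if "p \<in> Omega" for p
    using fG[OF that] by (rule has_derivative_bounded_linear)
  have "continuous_on Omega (\<lambda>p. Blinfun (G p))"
    unfolding continuous_on_iff
  proof (intro ballI allI impI)
    fix p and e :: real assume p: "p \<in> Omega" and "e > 0"
    then obtain d where d: "d > 0" "\<And>t. t \<in> {0..\<rho>} \<Longrightarrow> dist t 0 < d \<Longrightarrow> dist (\<psi> t) (\<psi> 0) < e / 6"
      using \<rho> unfolding continuous_on_iff by (metis atLeastAtMost_iff divide_pos_pos less_imp_le order_refl zero_less_numeral)
    have "dist (Blinfun (G q)) (Blinfun (G p)) < e" if q: "q \<in> Omega" "dist q p < min d t1" for q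
    proof -
      have "Blinfun (G q) - Blinfun (G p) = Blinfun (\<lambda>v. G q v - G p v)"
        using bl[OF p] bl[OF q(1)]
        by (intro blinfun_eqI) (simp add: minus_blinfun.rep_eq bounded_linear_Blinfun_apply bounded_linear_sub)
      then have "dist (Blinfun (G q)) (Blinfun (G p)) = onorm (\<lambda>v. G q v - G p v)"
        using bl[OF p] bl[OF q(1)]
        by (simp add: dist_norm norm_blinfun.rep_eq bounded_linear_Blinfun_apply bounded_linear_sub)
      also have "\<dots> \<le> 6 * \<psi> (dist q p)" using on[OF q(1) p] q(2) by simp
      also have "\<dots> < e" using d(2)[of "dist q p"] q(2) t1 by (simp add: \<psi>0 dist_real_def)
      finally show ?thesis .
    qed
    then show "\<exists>d>0. \<forall>q\<in>Omega. dist q p < d \<longrightarrow> dist (Blinfun (G q)) (Blinfun (G p)) < e"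
      using d(1) t1(1) by (intro exI[of _ "min d t1"]) auto
  qed
  moreover have "\<exists>e>0. \<exists>C. ball x e \<subseteq> Omega \<and>
      (\<forall>p\<in>ball x e. \<forall>q\<in>ball x e. onorm (\<lambda>v. G p v - G q v) \<le> C * \<psi> (dist p q))" if x: "x \<in> Omega" for x
  proof -
    obtain e0 where e0: "e0 > 0" "ball x e0 \<subseteq> Omega"
      using convex_open_Omega(2) x by (auto simp: open_contains_ball)
    \<comment> \<open>The radius t1/2 keeps any two points of the ball within distance t1, where the
      modulus is valid.\<close>
    define e where "e = min e0 (t1 / 2)"
    have e: "e > 0" "ball x e \<subseteq> Omega" using e0 t1 by (auto simp: e_def)
    have "onorm (\<lambda>v. G p v - G q v) \<le> 6 * \<psi> (dist p q)" if "p \<in> ball x e" "q \<in> ball x e" for p q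
    proof (rule on)
      show "p \<in> Omega" "q \<in> Omega" using that e by auto
      show "dist p q \<le> t1" using that dist_triangle2[of p q x] by (auto simp: e_def dist_commute)
    qed
    then show ?thesis using e by blast
  qed
  ultimately show "C1psi_loc \<psi> (\<lambda>p. lim (\<lambda>n. u_approx a r m n p)) Omega"
    unfolding C1psi_loc_def f_def[symmetric] using fG by (intro exI[of _ G]) blast
qed

end

theorem theorem3:
  fixes a :: "nat \<Rightarrow> complex" and r :: "nat \<Rightarrow> real" and \<psi> :: "real \<Rightarrow> real"
  assumes a_in: "\<forall>n\<ge>1. a n \<in> ball 0 (1/4)"
    and a_even_dense: "ball 0 (1/4) \<subseteq> closure {a (2*p) | p. p \<ge> 1}"
    and a_odd_dense: "ball 0 (1/4) \<subseteq> closure {a (2*p+1) | p. True}"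
    and r_pos: "\<forall>n\<ge>1. 0 < r n \<and> r n \<le> 1/10 \<and> r (Suc n) \<le> r n"
    and r_lim: "r \<longlonglongrightarrow> 0"
    and r_sum: "summable (\<lambda>n. \<bar>ln (r (Suc n))\<bar> / 2 ^ Suc n)"
    and gauge: "gauge_fun \<psi>"
    and psi_growth: "filterlim (\<lambda>t. \<psi> t / (t * \<bar>ln t\<bar>)) at_top (at_right 0)"
  shows "\<exists>m :: nat \<Rightarrow> nat. (\<forall>n\<ge>1. 0 < m n) \<and>
           (\<forall>p\<in>Omega. convergent (\<lambda>n. u_approx a r m n p)) \<and>
           C1psi_loc \<psi> (\<lambda>p. lim (\<lambda>n. u_approx a r m n p)) Omega"
proof -
  obtain \<rho> where \<rho>: "\<rho> > 0" "continuous_on {0..\<rho>} \<psi>" "mono_on {0..\<rho>} \<psi>" and \<psi>0: "\<psi> 0 = 0"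
    using gauge by (auto simp: gauge_fun_def)
  have a: "cmod (a n) < 1/4" and r: "0 < r n \<and> r n \<le> 1/10" if "n \<ge> 1" for n
    using a_in r_pos that by auto
  have "\<exists>m. (\<forall>n. m n \<ge> 72) \<and> (\<forall>n. small_increment \<psi> \<rho> a r m n)"
    by (rule exists_small_increments) (use a r \<rho> \<psi>0 psi_growth in auto)
  then obtain m where m: "\<And>n. m n \<ge> 72" "\<And>n. small_increment \<psi> \<rho> a r m n" by blast
  interpret construction a r m using a r m(1) by unfold_locales
  have "\<forall>n\<ge>1. 0 < m n" using m(1) by (auto intro: less_le_trans[of 0 72])
  then show ?thesis
    using C1psi_limit[OF m(2) \<rho>(1,2) \<psi>0 psi_growth] by blast
qed

end
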